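(* Let $n\ge1$, $\mathbf t=(t_1,\ldots,t_n)$ indeterminates, and let $f\in\mathbb Z[[\mathbf t]]$ be an algebraic power series with degree $d$, total height $h$, and partial height $(h_1,\ldots,h_n)$. Set $$N:=(d+1)\cdot\min\left\{\prod_{i=1}^n(h_i+1)-\prod_{i=1}^n h_i,\ \binom{n+h}{n}-\binom{h}{n}\right\}.$$ Then, for all prime numbers $p$, $\Delta(f)_{|p}$ has degree at most $p^N-1$ over $\mathbb F_p(t)$.
   Context: Here algebraic means algebraic over $\mathbb Q(\mathbf t)$. The degree of $f$ is $d=[\mathbb Q(\mathbf t)(f):\mathbb Q(\mathbf t)]$; $h_i$ is the minimal degree in $t_i$ of a nonzero polynomial $A(\mathbf t,y)\in\mathbb Q[\mathbf t,y]$ with $A(\mathbf t,f)=0$; the total height $h$ is the minimal total degree in $\mathbf t$ of a nonzero polynomial $A(\mathbf t,y)\in\mathbb Q[\mathbf t,y]$ with $A(\mathbf t,f)=0$. The diagonal of $f=\sum_{(i_1,\ldots,i_n)\in\mathbb N^n}a(i_1,\ldots,i_n)t_1^{i_1}\cdots t_n^{i_n}$ is $\Delta(f)(t)=\sum_{i\ge0}a(i,\ldots,i)t^i$, and $\Delta(f)_{|p}=\sum_{i\ge0}(a(i,\ldots,i)\bmod p)\,t^i\in\mathbb F_p[[t]]$ is its reduction modulo $p$. The degree of $g\in\mathbb F_p[[t]]$ over $\mathbb F_p(t)$ is $[\mathbb F_p(t)(g):\mathbb F_p(t)]$ (in particular, the statement includes that $\Delta(f)_{|p}$ is algebraic over $\mathbb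 F_p(t)$). *)

theory Defs
  imports
    "HOL-Library.Poly_Mapping"
    "HOL-Computational_Algebra.Computational_Algebra"
    "HOL-Algebra.Generated_Fields"
    "HOL-Algebra.Algebraic_Closure_Type"
    "Berlekamp_Zassenhaus.Finite_Field"
begin

section \<open>Multivariate formal power series\<close>

text \<open>
  The variables are indexed by a finite type \<open>'n\<close>, so the number of variables is
  \<open>CARD('n) \<ge> 1\<close>. A monomial is an exponent vector in \<open>'n \<Rightarrow>\<^sub>0 nat\<close>, and
  \<open>('n \<Rightarrow>\<^sub>0 nat) \<Rightarrow>\<^sub>0 'a\<close> is the polynomial ring in the same variables.
\<close>

typedef ('a, 'n) mfps = "UNIV :: (('n \<Rightarrow>\<^sub>0 nat) \<Rightarrow> 'a) set"
  morphisms mfps_nth Abs_mfps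
  by simp

setup_lifting type_definition_mfps

lemma mfps_eqI: "(\<And>m. mfps_nth f m = mfps_nth g m) \<Longrightarrow> f = g"
  by transfer auto

lemma mfps_nth_Abs [simp]: "mfps_nth (Abs_mfps c) = c"
  by (simp add: Abs_mfps_inverse)

definition splits :: "('n \<Rightarrow>\<^sub>0 nat) \<Rightarrow> (('n \<Rightarrow>\<^sub>0 nat) \<times> ('n \<Rightarrow>\<^sub>0 nat)) set"
  where "splits m = {(i, j). i + j = m}"

lemma in_splits [simp]: "(i, j) \<in> splits m \<longleftrightarrow> i + j = m"
  by (simp add: splits_def)

lemma finite_splits [simp, intro]: "finite (splits (m :: 'n::finite \<Rightarrow>\<^sub>0 nat))"
proof -
  let ?L = "\<lambda>(i :: 'n \<Rightarrow>\<^sub>0 nat, j :: 'n \<Rightarrow>\<^sub>0 nat). (Poly_Mapping.lookup i, Poly_Mapping.lookup j)"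
  let ?B = "PiE UNIV (\<lambda>x. {..Poly_Mapping.lookup m x})"
  have "finite ?B"
    by (intro finite_PiE) auto
  then have "finite (?B \<times> ?B)"
    by blast
  moreover have "?L ` splits m \<subseteq> ?B \<times> ?B"
    by (auto simp: splits_def lookup_add)
  ultimately have "finite (?L ` splits m)"
    by (rule rev_finite_subset)
  moreover have "inj_on ?L (splits m)"
    by (auto intro!: inj_onI poly_mapping_eqI)
  ultimately show ?thesis
    by (rule finite_imageD)
qed

instantiation mfps :: (comm_ring_1, finite) comm_ring_1
begin

lift_definition zero_mfps :: "('a, 'b) mfps" is "\<lambda>_. 0" .
lift_definition one_mfps :: "('a, 'b) mfps" is "\<lambda>m. if m = 0 then 1 else 0" .
lift_definition plus_mfps :: "('a, 'b) mfps \<Rightarrow> ('a, 'b) mfps \<Rightarrow> ('a, 'b) mfps"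
  is "\<lambda>f g m. f m + g m" .
lift_definition minus_mfps :: "('a, 'b) mfps \<Rightarrow> ('a, 'b) mfps \<Rightarrow> ('a, 'b) mfps"
  is "\<lambda>f g m. f m - g m" .
lift_definition uminus_mfps :: "('a, 'b) mfps \<Rightarrow> ('a, 'b) mfps"
  is "\<lambda>f m. - f m" .
lift_definition times_mfps :: "('a, 'b) mfps \<Rightarrow> ('a, 'b) mfps \<Rightarrow> ('a, 'b) mfps"
  is "\<lambda>f g m. \<Sum>(i, j)\<in>splits m. f i * g j" .

instance
proof
  fix f g h :: "('a, 'b) mfps"
  show "f * g * h = f * (g * h)"
  proof (transfer, rule ext)
    fix f g h :: "('b \<Rightarrow>\<^sub>0 nat) \<Rightarrow> 'a" and m :: "'b \<Rightarrow>\<^sub>0 nat"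
    have "(\<Sum>(x, k)\<in>splits m. (\<Sum>(i, j)\<in>splits x. f i * g j) * h k)
        = (\<Sum>(x, k)\<in>splits m. \<Sum>(i, j)\<in>splits x. f i * g j * h k)"
      by (simp add: sum_distrib_right case_prod_beta)
    also have "\<dots> = (\<Sum>((x, k), (i, j))\<in>Sigma (splits m) (\<lambda>(x, k). splits x). f i * g j * h k)"
      by (subst sum.Sigma [symmetric]) (auto simp: case_prod_beta)
    also have "\<dots> = (\<Sum>((i, y), (j, k))\<in>Sigma (splits m) (\<lambda>(i, y). splits y). f i * (g j * h k))"
      by (rule sum.reindex_bij_witness [of _
            "\<lambda>((i, y), (j, k)). ((i + j, k), (i, j))" "\<lambda>((x, k), (i, j)). ((i, j + k), (j, k))"])
         (auto simp: ac_simps)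
    also have "\<dots> = (\<Sum>(i, y)\<in>splits m. \<Sum>(j, k)\<in>splits y. f i * (g j * h k))"
      by (subst sum.Sigma [symmetric]) (auto simp: case_prod_beta)
    also have "\<dots> = (\<Sum>(i, y)\<in>splits m. f i * (\<Sum>(j, k)\<in>splits y. g j * h k))"
      by (simp add: sum_distrib_left case_prod_beta)
    finally show "(\<Sum>(x, k)\<in>splits m. (\<Sum>(i, j)\<in>splits x. f i * g j) * h k)
        = (\<Sum>(i, y)\<in>splits m. f i * (\<Sum>(j, k)\<in>splits y. g j * h k))" .
  qed
  show "f * g = g * f"
  proof (transfer, rule ext)
    fix f g :: "('b \<Rightarrow>\<^sub>0 nat) \<Rightarrow> 'a" and m :: "'b \<Rightarrow>\<^sub>0 nat"
    show "(\<Sum>(i, j)\<in>splits m. f i * g j) = (\<Sum>(i, j)\<in>splits m. g i * f j)"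
      by (rule sum.reindex_bij_witness [of _ "\<lambda>(i, j). (j, i)" "\<lambda>(i, j). (j, i)"])
         (auto simp: ac_simps)
  qed
  show "1 * f = f"
  proof (transfer, rule ext)
    fix f :: "('b \<Rightarrow>\<^sub>0 nat) \<Rightarrow> 'a" and m :: "'b \<Rightarrow>\<^sub>0 nat"
    have "(\<Sum>(i, j)\<in>splits m. (if i = 0 then 1 else 0) * f j)
        = (\<Sum>(i, j)\<in>{(0 :: 'b \<Rightarrow>\<^sub>0 nat, m)}. (if i = 0 then 1 else 0) * f j)"
      by (rule sum.mono_neutral_right) (auto split: if_splits)
    then show "(\<Sum>(i, j)\<in>splits m. (if i = 0 then 1 else 0) * f j) = f m"
      by simp
  qed
  show "(f + g) * h = f * h + g * h"
    by transfer (simp add: fun_eq_iff algebra_simps sum.distrib case_prod_beta)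
  show "(0 :: ('a, 'b) mfps) \<noteq> 1"
    by transfer (auto simp: fun_eq_iff intro!: exI [of _ 0])
qed (transfer; simp add: fun_eq_iff algebra_simps)+

end

text \<open>
  Minimising the coordinates one after the other singles out one exponent in each of the
  two supports whose sum is obtained in no other way; hence there are no zero divisors.
\<close>

lemma lexicographic_minimum:
  fixes S T :: "('n \<Rightarrow>\<^sub>0 nat) set"
  assumes "finite V" "S \<noteq> {}" "T \<noteq> {}"
  shows "\<exists>a\<in>S. \<exists>b\<in>T. \<forall>i\<in>S. \<forall>j\<in>T.
    (\<forall>x\<in>V. Poly_Mapping.lookup i x + Poly_Mapping.lookup j x
         = Poly_Mapping.lookup a x + Poly_Mapping.lookup b x) \<longrightarrow>
    (\<forall>x\<in>V. Poly_Mapping.lookup i x = Poly_Mapping.lookup a x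
         \<and> Poly_Mapping.lookup j x = Poly_Mapping.lookup b x)"
  using assms
proof (induction V arbitrary: S T rule: finite_induct)
  case empty
  then show ?case by auto
next
  case (insert x V)
  define least where "least U = {i\<in>U. \<forall>j\<in>U. Poly_Mapping.lookup i x \<le> Poly_Mapping.lookup j x}"
    for U :: "('n \<Rightarrow>\<^sub>0 nat) set"
  have least_ne: "least U \<noteq> {}" if "U \<noteq> {}" for U
  proof -
    have "\<exists>i. i \<in> U \<and> (\<forall>j. j \<in> U \<longrightarrow> Poly_Mapping.lookup i x \<le> Poly_Mapping.lookup j x)"
      using that by (intro ex_has_least_nat [of "\<lambda>i. i \<in> U" "SOME i. i \<in> U"]) (simp add: some_in_eq)
    then show ?thesis by (auto simp: least_def)
  qed
  obtain a b where ab: "a \<in> least S" "b \<in> least T"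
    and uniq: "\<forall>i\<in>least S. \<forall>j\<in>least T.
        (\<forall>y\<in>V. Poly_Mapping.lookup i y + Poly_Mapping.lookup j y
            = Poly_Mapping.lookup a y + Poly_Mapping.lookup b y) \<longrightarrow>
        (\<forall>y\<in>V. Poly_Mapping.lookup i y = Poly_Mapping.lookup a y
            \<and> Poly_Mapping.lookup j y = Poly_Mapping.lookup b y)"
    using insert.IH [OF least_ne [OF insert.prems(1)] least_ne [OF insert.prems(2)]]
    by (elim bexE) (rule that)
  show ?case
  proof (rule bexI [of _ a], rule bexI [of _ b], intro ballI impI)
    fix i j y
    assume i: "i \<in> S" and j: "j \<in> T" and y: "y \<in> insert x V"
      and eq: "\<forall>x\<in>insert x V. Poly_Mapping.lookup i x + Poly_Mapping.lookup j x
            = Poly_Mapping.lookup a x + Poly_Mapping.lookup b x"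
    have "Poly_Mapping.lookup a x \<le> Poly_Mapping.lookup i x"
         "Poly_Mapping.lookup b x \<le> Poly_Mapping.lookup j x"
      using ab i j by (auto simp: least_def)
    moreover have "Poly_Mapping.lookup i x + Poly_Mapping.lookup j x
            = Poly_Mapping.lookup a x + Poly_Mapping.lookup b x"
      using eq by simp
    ultimately have x: "Poly_Mapping.lookup i x = Poly_Mapping.lookup a x"
         "Poly_Mapping.lookup j x = Poly_Mapping.lookup b x"
      by linarith+
    then have il: "i \<in> least S" and jl: "j \<in> least T"
      using ab i j by (auto simp: least_def)
    have "\<forall>y\<in>V. Poly_Mapping.lookup i y + Poly_Mapping.lookup j y
            = Poly_Mapping.lookup a y + Poly_Mapping.lookup b y"
      using eq by simp
    then have "\<forall>y\<in>V. Poly_Mapping.lookup i y = Poly_Mapping.lookup a y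
            \<and> Poly_Mapping.lookup j y = Poly_Mapping.lookup b y"
      by (rule uniq [THEN bspec, OF il, THEN bspec, OF jl, THEN mp])
    then show "Poly_Mapping.lookup i y = Poly_Mapping.lookup a y
            \<and> Poly_Mapping.lookup j y = Poly_Mapping.lookup b y"
      using x y by auto
  qed (use ab in \<open>auto simp: least_def\<close>)
qed

instance mfps :: (idom, finite) idom
proof
  fix f g :: "('a, 'b) mfps"
  assume "f \<noteq> 0" "g \<noteq> 0"
  then have "{i. mfps_nth f i \<noteq> 0} \<noteq> {}" "{i. mfps_nth g i \<noteq> 0} \<noteq> {}"
    by (auto simp: zero_mfps.rep_eq intro: mfps_eqI)
  from lexicographic_minimum [OF finite_class.finite_UNIV this]
  obtain a b where ab: "a \<in> {i. mfps_nth f i \<noteq> 0}" "b \<in> {i. mfps_nth g i \<noteq> 0}"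
    and uniq: "\<forall>i\<in>{i. mfps_nth f i \<noteq> 0}. \<forall>j\<in>{i. mfps_nth g i \<noteq> 0}.
      (\<forall>x\<in>UNIV. Poly_Mapping.lookup i x + Poly_Mapping.lookup j x
        = Poly_Mapping.lookup a x + Poly_Mapping.lookup b x) \<longrightarrow>
      (\<forall>x\<in>UNIV. Poly_Mapping.lookup i x = Poly_Mapping.lookup a x
        \<and> Poly_Mapping.lookup j x = Poly_Mapping.lookup b x)"
    by (elim bexE) (rule that)
  have "i = a \<and> j = b"
    if i: "mfps_nth f i \<noteq> 0" and j: "mfps_nth g j \<noteq> 0" and eq: "i + j = a + b" for i j
  proof -
    have "\<forall>x\<in>UNIV. Poly_Mapping.lookup i x = Poly_Mapping.lookup a x
        \<and> Poly_Mapping.lookup j x = Poly_Mapping.lookup b x"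
      using i j eq by (intro uniq [THEN bspec, THEN bspec, THEN mp]) (simp_all flip: lookup_add)
    then show ?thesis
      by (simp add: poly_mapping_eq_iff fun_eq_iff)
  qed
  then have "(\<Sum>(i, j)\<in>splits (a + b). mfps_nth f i * mfps_nth g j)
      = (\<Sum>(i, j)\<in>{(a, b)}. mfps_nth f i * mfps_nth g j)"
    by (intro sum.mono_neutral_right) auto
  with ab have "mfps_nth (f * g) (a + b) \<noteq> 0"
    by (simp add: times_mfps.rep_eq)
  then show "f * g \<noteq> 0"
    by (metis zero_mfps.rep_eq)
qed

definition mfps_of_mpoly :: "(('n \<Rightarrow>\<^sub>0 nat) \<Rightarrow>\<^sub>0 'a::zero) \<Rightarrow> ('a, 'n) mfps"
  where "mfps_of_mpoly P = Abs_mfps (Poly_Mapping.lookup P)"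

definition mfps_of_int :: "(int, 'n) mfps \<Rightarrow> ('a::ring_1, 'n) mfps"
  where "mfps_of_int f = Abs_mfps (\<lambda>m. of_int (mfps_nth f m))"


section \<open>Algebraic elements and degrees\<close>

text \<open>
  Here \<open>K\<close> is meant to be a subfield of the ambient field \<open>'a\<close>, and
  \<^const>\<open>generate_field\<close> produces the subfield \<open>K(x)\<close>. The value of \<open>ext_degree K x\<close> is
  meaningful only if \<open>x\<close> is algebraic over \<open>K\<close>.
\<close>

definition algebraic_elem :: "'a::field set \<Rightarrow> 'a \<Rightarrow> bool"
  where "algebraic_elem K x \<longleftrightarrow> (ring.algebraic ring_of_type_algebra over K) x"

definition ext_degree :: "'a::field set \<Rightarrow> 'a \<Rightarrow> nat"
  where "ext_degree K x =
    (ring.dim ring_of_type_algebra over K) (generate_field ring_of_type_algebra (insert x K))"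

text \<open>The subfield $\mathbb Q(\mathbf t)$ of the field of fractions of $\mathbb Q[[\mathbf t]]$.\<close>

definition rat_functions :: "(rat, 'n::finite) mfps fract set"
  where "rat_functions = {Fract (mfps_of_mpoly P) (mfps_of_mpoly Q) | P Q. Q \<noteq> 0}"

text \<open>The subfield $F(t)$ of the field $F((t))$ of Laurent series.\<close>

definition fls_rat_functions :: "'a::field fls set"
  where "fls_rat_functions =
    {fps_to_fls (fps_of_poly P) / fps_to_fls (fps_of_poly Q) | P Q. Q \<noteq> 0}"

definition mfps_to_fract :: "(int, 'n::finite) mfps \<Rightarrow> (rat, 'n) mfps fract"
  where "mfps_to_fract f = Fract (mfps_of_int f) 1"


section \<open>Heights\<close>

text \<open>A polynomial $A(\mathbf t, y)$ is regarded as a polynomial in $y$ over $\mathbb Q[\mathbf t]$.\<close>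

definition annihilates ::
    "(('n \<Rightarrow>\<^sub>0 nat) \<Rightarrow>\<^sub>0 rat) poly \<Rightarrow> (int, 'n::finite) mfps \<Rightarrow> bool"
  where "annihilates A f \<longleftrightarrow> poly (map_poly mfps_of_mpoly A) (mfps_of_int f) = 0"

definition t_monomials :: "(('n \<Rightarrow>\<^sub>0 nat) \<Rightarrow>\<^sub>0 'a::zero) poly \<Rightarrow> ('n \<Rightarrow>\<^sub>0 nat) set"
  where "t_monomials A = (\<Union>c\<in>set (coeffs A). Poly_Mapping.keys c)"

definition partial_degree :: "'n \<Rightarrow> (('n \<Rightarrow>\<^sub>0 nat) \<Rightarrow>\<^sub>0 'a::zero) poly \<Rightarrow> nat"
  where "partial_degree i A = Max (insert 0 ((\<lambda>m. Poly_Mapping.lookup m i) ` t_monomials A))"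

definition total_degree :: "(('n::finite \<Rightarrow>\<^sub>0 nat) \<Rightarrow>\<^sub>0 'a::zero) poly \<Rightarrow> nat"
  where "total_degree A =
    Max (insert 0 ((\<lambda>m. \<Sum>i\<in>UNIV. Poly_Mapping.lookup m i) ` t_monomials A))"

definition partial_height :: "(int, 'n::finite) mfps \<Rightarrow> 'n \<Rightarrow> nat"
  where "partial_height f i =
    (LEAST k. \<exists>A. A \<noteq> 0 \<and> annihilates A f \<and> partial_degree i A = k)"

definition total_height :: "(int, 'n::finite) mfps \<Rightarrow> nat"
  where "total_height f =
    (LEAST k. \<exists>A. A \<noteq> 0 \<and> annihilates A f \<and> total_degree A = k)"


section \<open>Diagonals\<close>

definition diagonal :: "('a, 'n::finite) mfps \<Rightarrow> 'a fps"
  where "diagonal f = Abs_fps (\<lambda>i. mfps_nth f (Abs_poly_mapping (\<lambda>_. i)))"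

text \<open>For a type \<open>'p\<close> of prime cardinality $p$, the type \<open>'p mod_ring\<close> is the field $\mathbb F_p$.\<close>

definition reduce_mod :: "int fps \<Rightarrow> 'p::prime_card mod_ring fps"
  where "reduce_mod g = Abs_fps (\<lambda>i. of_int (fps_nth g i))"

end

theory Submission
  imports Defs
begin

text \<open>
  Dividing a relation of \<open>f\<close> by its content and reducing it modulo \<open>p\<close> bounds the degree and the
  heights of \<open>f mod p\<close>. As \<open>\<bbbF>\<^sub>p[t]\<close> is factorial, one irreducible and separable polynomial \<open>A(t, y)\<close>
  realises all these bounds. Furstenberg's residue formula shows that the series \<open>P(t, f) / A'(t, f)\<close>,
  with \<open>P\<close> subject to the same bounds, are stable under the Cartier operators; they include \<open>f\<close>.
  Multiplication by \<open>t\<^sub>1 \<dots> t\<^sub>n\<close> becomes multiplication by \<open>t\<close> on diagonals, so only the monomials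
  of \<open>P\<close> that omit some variable count, and the diagonals span a space of dimension at most \<open>N\<close>
  over \<open>\<bbbF>\<^sub>p(t)\<close>. Since \<open>g = \<Sum>\<^sub>r t^r S\<^sub>r(g)^p\<close>, the powers \<open>g, g^p, \<dots>, g^(p^N)\<close> of the diagonal \<open>g\<close>
  all lie in one space of dimension at most \<open>N\<close>, and a linear relation between them may be divided by \<open>g\<close>.
\<close>

section \<open>Unique factorisation in subrings\<close>

text \<open>The minima that define \<open>d\<close>, each \<open>h_i\<close> and \<open>h\<close>
  are taken separately, so every bound arrives with a relation of its own. Each of these is reduced
  modulo p, and a reduction may well be inseparable, with vanishing derivative at \<open>f\<close>.
  Therefore \<open>A\<close> is chosen only after reduction. Factoriality lets it divide every
  reduced relation with a quotient in F_p[t][y], not merely over F_p(t), and degrees in any of the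
  variables do not grow on passing to such a divisor. The factor d + 1 counts the powers 1, y, ...,
  y^d: to include \<open>f\<close> one takes P = y A', whose degree in y can be d. A Cartier step
  replaces P by a section of P A^(p-1); a bound c for P and A becomes p c for this product, and the
  section divides it by p again. So the same bounds persist for ever. The diagonal is linear over
  polynomials in the product t_1 ... t_n but not multiplicative. For this reason linear relations
  are sought between the series w A'(f), where finitely many monomials suffice, and A'(f) is
  cancelled before any diagonal is taken.\<close>

locale idom_subring =
  fixes R :: "'a::idom set"
  assumes one_mem: "1 \<in> R"
    and diff_mem: "\<And>a b. a \<in> R \<Longrightarrow> b \<in> R \<Longrightarrow> a - b \<in> R"
    and mult_mem: "\<And>a b. a \<in> R \<Longrightarrow> b \<in> R \<Longrightarrow> a * b \<in> R"
begin

lemma zero_mem: "0 \<in> R"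
  using diff_mem [OF one_mem one_mem] by simp

lemma uminus_mem: "a \<in> R \<Longrightarrow> - a \<in> R"
  using diff_mem [OF zero_mem, of a] by simp

lemma add_mem: "a \<in> R \<Longrightarrow> b \<in> R \<Longrightarrow> a + b \<in> R"
  using diff_mem [OF _ uminus_mem, of a b] by simp

lemma sum_mem: "(\<And>x. x \<in> A \<Longrightarrow> g x \<in> R) \<Longrightarrow> sum g A \<in> R"
  by (induction A rule: infinite_finite_induct) (auto intro: zero_mem add_mem)

lemma power_mem: "a \<in> R \<Longrightarrow> a ^ n \<in> R"
  by (induction n) (auto intro: one_mem mult_mem)

end

text \<open>Plain \<open>dvd\<close> would mean divisibility in the whole ring. Among power series
  over a field every polynomial with nonzero constant term is a unit, so the quotient has to be
  confined to \<open>R\<close>.\<close>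

definition dvd_in :: "'a::idom set \<Rightarrow> 'a \<Rightarrow> 'a \<Rightarrow> bool"
  where "dvd_in R a b \<longleftrightarrow> (\<exists>c\<in>R. b = a * c)"

definition prime_in :: "'a::idom set \<Rightarrow> 'a \<Rightarrow> bool"
  where "prime_in R q \<longleftrightarrow> q \<in> R \<and> q \<noteq> 0 \<and> \<not> dvd_in R q 1 \<and>
    (\<forall>a\<in>R. \<forall>b\<in>R. dvd_in R q (a * b) \<longrightarrow> dvd_in R q a \<or> dvd_in R q b)"

text \<open>The factors are prime, not merely irreducible, so the existence of a factorisation
  already contains its uniqueness. The number of primes is a measure for inductions that remove one
  prime at a time.\<close>

inductive factors_in :: "'a::idom set \<Rightarrow> nat \<Rightarrow> 'a \<Rightarrow> bool" for R
  where
    factors_in_unit: "u \<in> R \<Longrightarrow> dvd_in R u 1 \<Longrightarrow> factors_in R 0 u"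
  | factors_in_step: "prime_in R q \<Longrightarrow> factors_in R n a \<Longrightarrow> factors_in R (Suc n) (q * a)"

definition factorial_in :: "'a::idom set \<Rightarrow> bool"
  where "factorial_in R \<longleftrightarrow> idom_subring R \<and> (\<forall>a\<in>R. a \<noteq> 0 \<longrightarrow> (\<exists>n. factors_in R n a))"

lemma dvd_inI: "c \<in> R \<Longrightarrow> b = a * c \<Longrightarrow> dvd_in R a b"
  by (auto simp: dvd_in_def)

lemma dvd_inE: "dvd_in R a b \<Longrightarrow> (\<And>c. c \<in> R \<Longrightarrow> b = a * c \<Longrightarrow> thesis) \<Longrightarrow> thesis"
  by (auto simp: dvd_in_def)

context idom_subring
begin

lemma dvd_in_mult_left: "dvd_in R a b \<Longrightarrow> c \<in> R \<Longrightarrow> dvd_in R a (c * b)"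
  unfolding dvd_in_def by (metis mult.left_commute mult_mem)

lemma dvd_in_trans: "dvd_in R a b \<Longrightarrow> dvd_in R b c \<Longrightarrow> dvd_in R a c"
  unfolding dvd_in_def by (metis mult.assoc mult_mem)

lemma dvd_in_add: "dvd_in R a b \<Longrightarrow> dvd_in R a c \<Longrightarrow> dvd_in R a (b + c)"
  unfolding dvd_in_def by (metis distrib_left add_mem)

lemma dvd_in_diff: "dvd_in R a b \<Longrightarrow> dvd_in R a c \<Longrightarrow> dvd_in R a (b - c)"
  unfolding dvd_in_def by (metis right_diff_distrib diff_mem)

lemma dvd_in_0: "dvd_in R a 0"
  by (rule dvd_inI [OF zero_mem]) simp

lemma dvd_in_sum: "(\<And>x. x \<in> A \<Longrightarrow> dvd_in R a (g x)) \<Longrightarrow> dvd_in R a (sum g A)"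
  by (induction A rule: infinite_finite_induct) (auto intro: dvd_in_0 dvd_in_add)

lemma factors_in_mem: "factors_in R n a \<Longrightarrow> a \<in> R"
  by (induction rule: factors_in.induct) (auto simp: prime_in_def intro: mult_mem)

lemma factors_in_unit_mult:
  assumes "factors_in R n a" "u \<in> R" "dvd_in R u 1"
  shows "factors_in R n (u * a)"
  using assms
proof (induction rule: factors_in.induct)
  case (factors_in_unit v)
  then show ?case
  proof -
    obtain v' u' where "v' \<in> R" "1 = v * v'" "u' \<in> R" "1 = u * u'"
      using factors_in_unit by (auto elim!: dvd_inE)
    then have "1 = u * v * (u' * v')" "u' * v' \<in> R"
      using mult_mem by (auto simp: mult_ac)
    then show ?thesis
      using factors_in_unit by (intro factors_in.factors_in_unit mult_mem) (auto intro: dvd_inI)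
  qed
next
  case (factors_in_step q n a)
  then show ?case
    by (metis factors_in.factors_in_step mult.left_commute)
qed

lemma factors_in_mult:
  assumes "factors_in R n a" "factors_in R m b"
  shows "factors_in R (n + m) (a * b)"
  using assms
proof (induction rule: factors_in.induct)
  case (factors_in_unit v)
  then show ?case
    by (simp add: factors_in_unit_mult)
next
  case (factors_in_step q n a)
  then show ?case
    by (simp add: factors_in.factors_in_step mult.assoc)
qed

text \<open>Either \<open>q\<close> divides the first prime, and then the two are associates and the
  quotient is a unit absorbed by the other factors, or \<open>q\<close> divides the rest. Exactly
  one prime disappears.\<close>

lemma factors_in_cancel_prime:
  assumes "factors_in R n a" "prime_in R q" "c \<in> R" "a = q * c"
  shows "\<exists>m. n = Suc m \<and> factors_in R m c"
  using assms
proof (induction arbitrary: c rule: factors_in.induct)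
  case (factors_in_unit u)
  from \<open>dvd_in R u 1\<close> have "dvd_in R q 1"
    using dvd_in_trans factors_in_unit.prems by (metis dvd_inI)
  with factors_in_unit.prems show ?case
    by (simp add: prime_in_def)
next
  case (factors_in_step r n a)
  have q: "q \<in> R" "q \<noteq> 0" "\<not> dvd_in R q 1" and r: "r \<in> R" "r \<noteq> 0" and a: "a \<in> R"
    using factors_in_step by (auto simp: prime_in_def intro: factors_in_mem)
  have "dvd_in R q (r * a)"
    using factors_in_step.prems by (auto intro: dvd_inI)
  then consider "dvd_in R q r" | "dvd_in R q a"
    using factors_in_step.prems(1) r a by (auto simp: prime_in_def)
  then show ?case
  proof cases
    case 1
    then obtain e where e: "e \<in> R" "r = q * e"
      by (rule dvd_inE)
    \<comment> \<open>The prime \<open>r\<close> divides its own factorisation \<open>q * e\<close>.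
      If it divides \<open>q\<close>, then \<open>e\<close> is a unit; if it divides
      \<open>e\<close>, then \<open>q\<close> would be a unit.\<close>
    then have "dvd_in R r (q * e)"
      using one_mem by (auto simp: dvd_in_def)
    then consider "dvd_in R r q" | "dvd_in R r e"
      using factors_in_step.hyps(1) q e by (auto simp: prime_in_def)
    then have "dvd_in R e 1"
    proof cases
      case 1
      then obtain g where g: "g \<in> R" "q = r * g"
        by (rule dvd_inE)
      then have "r * 1 = r * (e * g)"
        using e by (simp add: mult_ac)
      then have "1 = e * g"
        using r mult_left_cancel by blast
      then show ?thesis
        using g by (auto intro: dvd_inI)
    next
      case 2
      then obtain g where g: "g \<in> R" "e = r * g"
        by (rule dvd_inE)
      then have "r * 1 = r * (q * g)"
        using e by (metis mult.assoc mult.commute mult.right_neutral)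
      then have "1 = q * g"
        using r mult_left_cancel by blast
      then show ?thesis
        using g q by (auto simp: dvd_in_def)
    qed
    moreover have "c = e * a"
      using factors_in_step.prems(3) e(2) q(2) by (simp add: mult.assoc)
    ultimately show ?thesis
      using factors_in_unit_mult [OF factors_in_step.hyps(2) e(1)] by simp
  next
    case 2
    then obtain b where b: "b \<in> R" "a = q * b"
      by (rule dvd_inE)
    then obtain m where m: "n = Suc m" "factors_in R m b"
      using factors_in_step.IH [OF factors_in_step.prems(1)] by blast
    moreover have "c = r * b"
      using factors_in_step.prems(3) b(2) q(2) by (simp add: mult.left_commute)
    ultimately show ?thesis
      using factors_in.factors_in_step [OF factors_in_step.hyps(1) m(2)] by simp
  qed
qed

text \<open>\<open>I\<close> will be the set of relations of \<open>f\<close>. It is prime because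
  the values lie in a domain, so one of the prime factors of a relation is itself a
  relation.\<close>

lemma factors_in_prime_ideal:
  assumes "factors_in R n a" "a \<in> I"
    and "\<And>a b. a \<in> R \<Longrightarrow> b \<in> R \<Longrightarrow> a * b \<in> I \<Longrightarrow> a \<in> I \<or> b \<in> I"
    and "\<And>u. u \<in> R \<Longrightarrow> dvd_in R u 1 \<Longrightarrow> u \<notin> I"
  shows "\<exists>q. prime_in R q \<and> q \<in> I \<and> dvd_in R q a"
  using assms(1,2)
proof (induction rule: factors_in.induct)
  case (factors_in_unit u)
  then show ?case using assms(4) by blast
next
  case (factors_in_step q n a)
  have qa: "q \<in> R" "a \<in> R"
    using factors_in_step by (auto simp: prime_in_def intro: factors_in_mem)
  then consider "q \<in> I" | "a \<in> I"
    using assms(3) factors_in_step.prems by blast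
  then show ?case
  proof cases
    case 1
    then show ?thesis
      using factors_in_step.hyps qa by (blast intro: dvd_inI)
  next
    case 2
    then show ?thesis
      using factors_in_step.IH qa dvd_in_mult_left by blast
  qed
qed

end

section \<open>Polynomials over a factorial subring: Gauss's lemma\<close>

definition polys :: "'a::idom set \<Rightarrow> 'a poly set"
  where "polys R = {P. \<forall>i. coeff P i \<in> R}"

lemma (in idom_subring) idom_subring_polys: "idom_subring (polys R)"
  by unfold_locales
     (auto simp: polys_def coeff_mult intro: zero_mem one_mem diff_mem mult_mem sum_mem)

lemma (in idom_subring) const_mem_polys: "[:a:] \<in> polys R \<longleftrightarrow> a \<in> R"
  by (auto simp: polys_def coeff_pCons zero_mem split: nat.splits elim: allE [of _ 0])

lemma (in idom_subring) monom_mem_polys: "a \<in> R \<Longrightarrow> monom a n \<in> polys R"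
  by (auto simp: polys_def zero_mem)

lemma polys_coeff: "P \<in> polys R \<Longrightarrow> coeff P i \<in> R"
  by (simp add: polys_def)

lemma (in idom_subring) smult_mem_polys: "a \<in> R \<Longrightarrow> P \<in> polys R \<Longrightarrow> smult a P \<in> polys R"
  by (auto simp: polys_def mult_mem)

lemma (in idom_subring) dvd_in_polys_const:
  assumes "a \<noteq> 0"
  shows "dvd_in (polys R) [:a:] P \<longleftrightarrow> (\<forall>i. dvd_in R a (coeff P i))"
proof
  assume "dvd_in (polys R) [:a:] P"
  then show "\<forall>i. dvd_in R a (coeff P i)"
    by (auto simp: dvd_in_def polys_def)
next
  assume "\<forall>i. dvd_in R a (coeff P i)"
  then obtain c where c: "\<And>i. c i \<in> R" "\<And>i. coeff P i = a * c i"
    unfolding dvd_in_def by metis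
  have "\<forall>i>degree P. c i = 0"
    using c(2) assms by (metis coeff_eq_0 mult_eq_0_iff)
  then have "coeff (Abs_poly c) = c"
    by (intro coeff_Abs_poly) auto
  then show "dvd_in (polys R) [:a:] P"
    by (intro dvd_inI [of "Abs_poly c"]) (auto simp: polys_def c poly_eq_iff)
qed

text \<open>Gauss's argument: take the lowest coefficients of \<open>G\<close> and \<open>H\<close>
  that \<open>q\<close> does not divide. In the coefficient of \<open>G * H\<close> at the sum of
  their indices, every other summand contains a lower, hence divisible, coefficient.\<close>

lemma (in idom_subring) prime_in_polys_const:
  assumes "prime_in R q"
  shows "prime_in (polys R) [:q:]"
proof -
  interpret P: idom_subring "polys R"
    by (rule idom_subring_polys)
  have q: "q \<in> R" "q \<noteq> 0" "\<not> dvd_in R q 1"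
    and qp: "\<And>a b. a \<in> R \<Longrightarrow> b \<in> R \<Longrightarrow> dvd_in R q (a * b) \<Longrightarrow> dvd_in R q a \<or> dvd_in R q b"
    using assms by (auto simp: prime_in_def)
  have "dvd_in (polys R) [:q:] G \<or> dvd_in (polys R) [:q:] H"
    if GH: "G \<in> polys R" "H \<in> polys R" "dvd_in (polys R) [:q:] (G * H)" for G H
  proof (rule ccontr)
    assume "\<not> ?thesis"
    then have ex: "\<exists>i. \<not> dvd_in R q (coeff G i)" "\<exists>i. \<not> dvd_in R q (coeff H i)"
      by (auto simp: dvd_in_polys_const q)
    define i where "i = (LEAST i. \<not> dvd_in R q (coeff G i))"
    define j where "j = (LEAST i. \<not> dvd_in R q (coeff H i))"
    have i: "\<not> dvd_in R q (coeff G i)" "\<And>k. k < i \<Longrightarrow> dvd_in R q (coeff G k)"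
      unfolding i_def using LeastI_ex [OF ex(1)] not_less_Least by blast+
    have j: "\<not> dvd_in R q (coeff H j)" "\<And>k. k < j \<Longrightarrow> dvd_in R q (coeff H k)"
      unfolding j_def using LeastI_ex [OF ex(2)] not_less_Least by blast+
    have "dvd_in R q (coeff (G * H) (i + j))"
      using GH(3) by (auto simp: dvd_in_polys_const q)
    moreover have "coeff (G * H) (i + j) = coeff G i * coeff H j
        + (\<Sum>k\<in>{..i+j} - {i}. coeff G k * coeff H (i + j - k))"
      by (simp add: coeff_mult sum.remove [of "{..i+j}" i])
    moreover have "dvd_in R q (\<Sum>k\<in>{..i+j} - {i}. coeff G k * coeff H (i + j - k))"
    proof (rule dvd_in_sum)
      fix k assume k: "k \<in> {..i+j} - {i}"
      show "dvd_in R q (coeff G k * coeff H (i + j - k))"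
      proof (cases "k < i")
        case True
        then show ?thesis
          using dvd_in_mult_left [OF i(2), of k "coeff H (i + j - k)"] polys_coeff [OF GH(2)]
          by (simp add: mult.commute)
      next
        case False
        then have "i + j - k < j" using k by auto
        then show ?thesis
          using dvd_in_mult_left [OF j(2)] polys_coeff [OF GH(1)] by blast
      qed
    qed
    ultimately have "dvd_in R q (coeff G i * coeff H j)"
      using dvd_in_diff [of q "coeff (G * H) (i + j)"
          "\<Sum>k\<in>{..i+j} - {i}. coeff G k * coeff H (i + j - k)"] by simp
    then show False
      using qp i j GH polys_coeff by blast
  qed
  moreover have "\<not> dvd_in (polys R) [:q:] 1"
    using q by (auto simp: dvd_in_polys_const elim: allE [of _ 0])
  ultimately show ?thesis
    using q by (auto simp: prime_in_def const_mem_polys)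
qed

lemma (in idom_subring) unit_polys_const: "dvd_in R u 1 \<Longrightarrow> dvd_in (polys R) [:u:] 1"
  by (auto simp: dvd_in_def one_pCons const_mem_polys intro!: bexI [of _ "[:_:]"])

lemma (in idom_subring) factors_in_polys_const:
  "factors_in R n a \<Longrightarrow> factors_in (polys R) n [:a:]"
proof (induction rule: factors_in.induct)
  case (factors_in_unit u)
  then show ?case
    by (intro factors_in.factors_in_unit unit_polys_const) (auto simp: const_mem_polys)
next
  case (factors_in_step q n a)
  from factors_in.factors_in_step [OF prime_in_polys_const [OF this(1)] this(3)]
  show ?case by (simp add: mult.commute)
qed

text \<open>Testing prime constants only avoids any notion of gcd. If \<open>R\<close> is a field,
  it has no primes and every element of \<open>polys R\<close> is primitive.\<close>

definition primitive_in :: "'a::idom set \<Rightarrow> 'a poly \<Rightarrow> bool"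
  where "primitive_in R F \<longleftrightarrow> F \<in> polys R \<and> (\<forall>q. prime_in R q \<longrightarrow> \<not> dvd_in (polys R) [:q:] F)"

text \<open>The primes of \<open>r\<close> are cancelled one at a time: each divides
  \<open>F * Z\<close> but not the primitive \<open>F\<close>, hence by Gauss it divides the
  cofactor \<open>Z\<close>.\<close>

lemma (in idom_subring) primitive_in_cancel:
  assumes "factors_in R n r" "primitive_in R F" "G \<in> polys R" "dvd_in (polys R) F (smult r G)"
  shows "dvd_in (polys R) F G"
proof -
  interpret P: idom_subring "polys R"
    by (rule idom_subring_polys)
  show ?thesis
    using assms(1,3,4)
  proof (induction arbitrary: G rule: factors_in.induct)
    case (factors_in_unit u)
    then obtain v where v: "v \<in> R" "1 = u * v"
      by (auto elim: dvd_inE)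
    then have "dvd_in (polys R) F ([:v:] * smult u G)"
      using factors_in_unit by (intro P.dvd_in_mult_left) (auto simp: const_mem_polys)
    moreover have "[:v:] * smult u G = G"
      using v by (simp add: mult.commute)
    ultimately show ?case by simp
  next
    case (factors_in_step q n r)
    obtain Z where Z: "Z \<in> polys R" "smult (q * r) G = F * Z"
      using factors_in_step.prems by (auto elim: dvd_inE)
    have F: "F \<in> polys R" "\<not> dvd_in (polys R) [:q:] F"
      using assms(2) factors_in_step.hyps by (auto simp: primitive_in_def)
    have r: "r \<in> R"
      using factors_in_step by (blast intro: factors_in_mem)
    have "F * Z = [:q:] * smult r G"
      using Z(2) by (simp add: mult.commute)
    then have "dvd_in (polys R) [:q:] (F * Z)"
      using factors_in_step.prems r by (blast intro: dvd_inI smult_mem_polys)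
    then have "dvd_in (polys R) [:q:] Z"
      using prime_in_polys_const [OF factors_in_step.hyps(1)] F Z by (auto simp: prime_in_def)
    then obtain Y where Y: "Y \<in> polys R" "Z = [:q:] * Y"
      by (rule dvd_inE)
    have q: "q \<noteq> 0"
      using factors_in_step.hyps by (auto simp: prime_in_def)
    have "smult q (smult r G) = smult q (F * Y)"
      using Z Y by simp
    then have "smult r G = F * Y"
      using q by (metis mult_left_cancel pCons_0_0 pCons_eq_iff smult_0_right mult_pCons_left mult_zero_left add.right_neutral)
    then show ?case
      using factors_in_step Y by (blast intro: dvd_inI)
  qed
qed

text \<open>A prime constant that divides \<open>F\<close> divides its leading coefficient, so the
  number of primes there bounds how often one can be extracted.\<close>

lemma (in idom_subring) primitive_factor:
  assumes "factors_in R n (lead_coeff F)" "F \<in> polys R"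
  shows "\<exists>m c F'. factors_in R m c \<and> primitive_in R F' \<and> F = smult c F'"
  using assms
proof (induction n arbitrary: F)
  case 0
  have unit: "factors_in R 0 1"
    using one_mem factors_in_unit dvd_inI [of 1 R 1 1] by simp
  have "\<not> dvd_in (polys R) [:q:] F" if "prime_in R q" for q
    using factors_in_cancel_prime [OF 0(1) that] that
    by (auto simp: dvd_in_polys_const prime_in_def elim!: dvd_inE dest!: spec [of _ "degree F"])
  then have "primitive_in R F"
    using 0 by (auto simp: primitive_in_def)
  then show ?case
    using unit by (metis smult_1_left)
next
  case (Suc n)
  show ?case
  proof (cases "primitive_in R F")
    case True
    moreover have "factors_in R 0 1"
      using one_mem factors_in_unit dvd_inI [of 1 R 1 1] by simp
    ultimately show ?thesis
      by (metis smult_1_left)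
  next
    case False
    then obtain q G where q: "prime_in R q" and G: "G \<in> polys R" "F = [:q:] * G"
      using Suc.prems by (auto simp: primitive_in_def elim!: dvd_inE)
    have "lead_coeff F = q * lead_coeff G"
      using G q by (simp add: prime_in_def)
    with factors_in_cancel_prime [OF Suc.prems(1) q] polys_coeff [OF G(1)]
    have "factors_in R n (lead_coeff G)"
      by blast
    from Suc.IH [OF this G(1)] obtain m c F'
      where "factors_in R m c" "primitive_in R F'" "G = smult c F'"
      by blast
    then have "factors_in R (Suc m) (q * c)" "primitive_in R F'" "F = smult (q * c) F'"
      using q G factors_in_step by (fastforce simp: mult.commute)+
    then show ?thesis by blast
  qed
qed

text \<open>The leading coefficient of \<open>G\<close> need not be invertible, so \<open>F\<close>
  is multiplied by it at every step of the division; \<open>r\<close> collects these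
  factors.\<close>

lemma (in idom_subring) pseudo_division:
  assumes "G \<in> polys R" "G \<noteq> 0" "F \<in> polys R"
  shows "\<exists>r\<in>R. \<exists>Q\<in>polys R. \<exists>S\<in>polys R. r \<noteq> 0 \<and> smult r F = Q * G + S \<and> (S = 0 \<or> degree S < degree G)"
  using assms(3)
proof (induction "degree F" arbitrary: F rule: less_induct)
  case less
  interpret P: idom_subring "polys R"
    by (rule idom_subring_polys)
  show ?case
  proof (cases "F = 0 \<or> degree F < degree G")
    case True
    then show ?thesis
      using one_mem less.prems P.zero_mem
      by (intro bexI [of _ 1] bexI [of _ 0] bexI [of _ F]) auto
  next
    case False
    define M where "M = monom (lead_coeff F) (degree F - degree G)"
    define F' where "F' = smult (lead_coeff G) F - M * G"
    have M: "M \<in> polys R"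
      unfolding M_def using less.prems polys_coeff by (intro monom_mem_polys) blast
    have F': "F' \<in> polys R"
      unfolding F'_def using assms M less.prems polys_coeff
      by (intro P.diff_mem P.mult_mem smult_mem_polys) blast+
    have "degree (M * G) = degree F"
      using False assms by (simp add: M_def degree_mult_eq degree_monom_eq monom_eq_0_iff)
    moreover have "coeff (M * G) (degree F) = lead_coeff F * lead_coeff G"
      using False coeff_monom_mult [of "lead_coeff F" "degree F - degree G" G "degree F"]
      by (simp add: M_def)
    ultimately have deg: "degree F' \<le> degree F" "coeff F' (degree F) = 0"
      unfolding F'_def by (auto intro!: degree_diff_le)
    have lc: "lead_coeff G \<in> R" "lead_coeff G \<noteq> 0"
      using assms polys_coeff by auto
    consider "F' = 0" | "degree F' < degree F"
      using deg by (metis leading_coeff_0_iff le_neq_implies_less)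
    then show ?thesis
    proof cases
      case 1
      then have "smult (lead_coeff G) F = M * G + 0"
        by (simp add: F'_def)
      then show ?thesis
        using lc M P.zero_mem by blast
    next
      case 2
      from less.hyps [OF this F'] obtain r Q S where
        rQS: "r \<in> R" "Q \<in> polys R" "S \<in> polys R" "r \<noteq> 0" "smult r F' = Q * G + S"
          "S = 0 \<or> degree S < degree G"
        by blast
      have "smult (r * lead_coeff G) F = smult r F' + smult r (M * G)"
        by (simp add: F'_def smult_diff_right)
      also have "\<dots> = (Q + smult r M) * G + S"
        using rQS by (simp add: algebra_simps)
      finally have "smult (r * lead_coeff G) F = (Q + smult r M) * G + S" .
      moreover have "Q + smult r M \<in> polys R" "r * lead_coeff G \<in> R" "r * lead_coeff G \<noteq> 0"
        using rQS lc M by (auto intro: P.add_mem smult_mem_polys mult_mem)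
      ultimately show ?thesis
        using rQS by blast
    qed
  qed
qed

text \<open>The gcd of \<open>F\<close> and \<open>G\<close> over the field of fractions is an element of least degree in the
  ideal they generate, made primitive; it divides both.\<close>

lemma prime_in_polysI:
  assumes R: "factorial_in R" and F: "primitive_in R F" "degree F > 0"
    and irred: "\<And>G H. G \<in> polys R \<Longrightarrow> H \<in> polys R \<Longrightarrow> F = G * H \<Longrightarrow> degree G = 0 \<or> degree H = 0"
  shows "prime_in (polys R) F"
proof -
  interpret idom_subring R
    using R by (simp add: factorial_in_def)
  interpret P: idom_subring "polys R"
    by (rule idom_subring_polys)
  have fac: "\<exists>n. factors_in R n a" if "a \<in> R" "a \<noteq> 0" for a
    using R that by (simp add: factorial_in_def)
  have FR: "F \<in> polys R" and F0: "F \<noteq> 0"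
    using F by (auto simp: primitive_in_def)
  have cancel: "dvd_in (polys R) F H" if "primitive_in R F" "a \<in> R" "a \<noteq> 0" "H \<in> polys R"
      "dvd_in (polys R) F (smult a H)" for a H F
    using fac [OF that(2,3)] primitive_in_cancel that by blast
  have "dvd_in (polys R) F G \<or> dvd_in (polys R) F H"
    if GH: "G \<in> polys R" "H \<in> polys R" "dvd_in (polys R) F (G * H)" for G H
  proof -
    define J where "J = {D. D \<noteq> 0 \<and> (\<exists>a\<in>polys R. \<exists>b\<in>polys R. D = a * F + b * G)}"
    have "F \<in> J"
      using F0 P.one_mem P.zero_mem unfolding J_def
      by (intro CollectI conjI bexI [of _ 1] bexI [of _ 0]) auto
    then obtain D where D: "D \<in> J" "\<And>E. E \<in> J \<Longrightarrow> degree D \<le> degree E"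
      using ex_has_least_nat [of "\<lambda>D. D \<in> J" F degree] by blast
    then obtain a b where ab: "a \<in> polys R" "b \<in> polys R" "D = a * F + b * G" and D0: "D \<noteq> 0"
      by (auto simp: J_def)
    have DR: "D \<in> polys R"
      unfolding ab using ab FR GH by (intro P.add_mem P.mult_mem)
    obtain n c D' m where D': "factors_in R n c" "primitive_in R D'" "D = smult c D'"
      using fac [of "lead_coeff D"] polys_coeff [OF DR] D0 primitive_factor [OF _ DR] by (metis leading_coeff_0_iff)
    have c: "c \<in> R" "c \<noteq> 0"
      using D' D0 factors_in_mem by auto
    have D'R: "D' \<in> polys R"
      using D' by (simp add: primitive_in_def)
    \<comment> \<open>Pseudo-division of \<open>E\<close> by \<open>D\<close> leaves a remainder in
      the ideal, which is 0 by minimality; primitivity of \<open>D'\<close> then removes the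
      constant \<open>r\<close>.\<close>
    have div: "dvd_in (polys R) D' E"
      if E: "E \<in> polys R" "a' \<in> polys R" "b' \<in> polys R" "E = a' * F + b' * G" for E a' b'
    proof -
      obtain r Q S where rQS: "r \<in> R" "Q \<in> polys R" "S \<in> polys R" "r \<noteq> 0" "smult r E = Q * D + S"
          "S = 0 \<or> degree S < degree D"
        using pseudo_division [OF DR D0 E(1)] by blast
      have "S = (smult r a' - Q * a) * F + (smult r b' - Q * b) * G"
        using rQS(5) ab(3) E(4) by (simp add: algebra_simps smult_add_right)
      moreover have "smult r a' - Q * a \<in> polys R" "smult r b' - Q * b \<in> polys R"
        using rQS ab E by (auto intro!: P.diff_mem P.mult_mem smult_mem_polys)
      ultimately have "S \<noteq> 0 \<Longrightarrow> S \<in> J"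
        by (auto simp: J_def)
      with rQS(6) D(2) have "S = 0"
        by (meson linorder_not_less)
      then have "smult r E = D' * smult c Q"
        using rQS D' by (simp add: mult.commute)
      then show ?thesis
        using cancel [OF D'(2) rQS(1,4) E(1)] rQS c by (blast intro: dvd_inI smult_mem_polys)
    qed
    have divF: "dvd_in (polys R) D' F"
      using div [of F 1 0] FR P.one_mem P.zero_mem by simp
    have divG: "dvd_in (polys R) D' G"
      using div [of G 0 1] GH P.one_mem P.zero_mem by simp
    from divF obtain E where E: "E \<in> polys R" "F = D' * E"
      by (rule dvd_inE)
    from irred [OF D'R E] show ?thesis
    proof
      \<comment> \<open>Coprime case: \<open>D\<close> is a nonzero constant \<open>e\<close>. Its
        expression by \<open>F\<close> and \<open>G\<close>, multiplied by \<open>H\<close>, shows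
        that \<open>F\<close> divides \<open>e * H\<close>, hence \<open>H\<close>.\<close>
      assume "degree D' = 0"
      then obtain e where "D = [:e:]"
        using D' by (metis degree_eq_zeroE smult_pCons smult_0_right)
      with DR D0 have e: "D = [:e:]" "e \<in> R" "e \<noteq> 0"
        by (auto simp: const_mem_polys)
      have "smult e H = F * (a * H) + b * (G * H)"
      proof -
        have "smult e H = D * H"
          using e(1) by simp
        then show ?thesis
          using ab(3) by (simp add: algebra_simps)
      qed
      moreover have "dvd_in (polys R) F (F * (a * H) + b * (G * H))"
        by (rule P.dvd_in_add [OF dvd_inI [OF P.mult_mem [OF ab(1) GH(2)] refl]
              P.dvd_in_mult_left [OF GH(3) ab(2)]])
      ultimately show ?thesis
        using cancel [OF F(1) e(2,3) GH(2)] by simp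
    next
      \<comment> \<open>Now \<open>F\<close> is \<open>D'\<close> up to a constant, which is a unit
        because \<open>F\<close> is primitive. So \<open>F\<close> divides \<open>D'\<close>, and
        \<open>D'\<close> divides \<open>G\<close>.\<close>
      assume "degree E = 0"
      then obtain e where e: "E = [:e:]"
        by (rule degree_eq_zeroE)
      then have eR: "e \<in> R" "e \<noteq> 0"
        using E F0 by (auto simp: const_mem_polys)
      obtain k where k: "factors_in R k e"
        using fac eR by blast
      have "dvd_in R e 1"
        using k
      proof cases
        case (factors_in_step q l x)
        then have x: "x \<in> R" by (blast intro: factors_in_mem)
        have "F = [:q:] * ([:x:] * D')"
          using E e factors_in_step by (simp add: mult.commute)
        then have "dvd_in (polys R) [:q:] F"
          using x D'R by (blast intro: dvd_inI P.mult_mem const_mem_polys [THEN iffD2])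
        then show ?thesis
          using F factors_in_step by (auto simp: primitive_in_def)
      qed
      then obtain v where v: "v \<in> R" "1 = e * v"
        by (rule dvd_inE)
      then have "F * [:v:] = D'"
        using E e by (simp add: mult.commute)
      then have "dvd_in (polys R) F D'"
        using v by (metis dvd_inI const_mem_polys)
      then show ?thesis
        using divG P.dvd_in_trans by blast
    qed
  qed
  moreover have "\<not> dvd_in (polys R) F 1"
  proof
    assume "dvd_in (polys R) F 1"
    then obtain E where "1 = F * E" by (auto elim: dvd_inE)
    moreover from this have "F \<noteq> 0" "E \<noteq> 0"
      by auto
    ultimately have "degree (1 :: 'a poly) = degree F + degree E"
      by (metis degree_mult_eq)
    then show False using F by simp
  qed
  ultimately show ?thesis
    using FR F0 by (auto simp: prime_in_def)
qed

text \<open>Induction on the degree: constants keep their primes from \<open>R\<close>, and a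
  primitive polynomial of positive degree that does not split into factors of positive degree is
  prime.\<close>

theorem factorial_in_polys:
  assumes R: "factorial_in R"
  shows "factorial_in (polys R)"
proof -
  interpret idom_subring R
    using R by (simp add: factorial_in_def)
  interpret P: idom_subring "polys R"
    by (rule idom_subring_polys)
  have fac: "\<exists>n. factors_in R n a" if "a \<in> R" "a \<noteq> 0" for a
    using R that by (simp add: factorial_in_def)
  have "\<exists>n. factors_in (polys R) n F" if "F \<in> polys R" "F \<noteq> 0" for F
    using that
  proof (induction "degree F" arbitrary: F rule: less_induct)
    case less
    show ?case
    proof (cases "degree F = 0")
      case True
      then obtain a where "F = [:a:]"
        by (rule degree_eq_zeroE)
      then show ?thesis
        using less.prems fac [of a] factors_in_polys_const by (auto simp: const_mem_polys)
    next
      case False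
      obtain n c F' where F': "factors_in R n c" "primitive_in R F'" "F = smult c F'"
        using fac [of "lead_coeff F"] polys_coeff [OF less.prems(1)] less.prems(2)
          primitive_factor [OF _ less.prems(1)] by (metis leading_coeff_0_iff)
      have c0: "c \<noteq> 0"
        using F' less.prems by auto
      have "\<exists>m. factors_in (polys R) m F'"
      proof (cases "\<exists>G\<in>polys R. \<exists>H\<in>polys R. F' = G * H \<and> degree G \<noteq> 0 \<and> degree H \<noteq> 0")
        case True
        then obtain G H where GH: "G \<in> polys R" "H \<in> polys R" "F' = G * H" "degree G \<noteq> 0" "degree H \<noteq> 0"
          by blast
        moreover from this have "G \<noteq> 0" "H \<noteq> 0"
          by auto
        ultimately have "degree F = degree G + degree H"
          using F' c0 by (auto simp: degree_mult_eq)
        then have "degree G < degree F" "degree H < degree F"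
          using GH by auto
        then show ?thesis
          using less.hyps GH P.factors_in_mult by (metis degree_0)
      next
        case split: False
        have "prime_in (polys R) F'"
        proof (rule prime_in_polysI [OF R F'(2)])
          show "degree F' > 0"
            using False F' c0 by simp
        qed (use split in auto)
        moreover have "factors_in (polys R) 0 1"
          using P.one_mem factors_in_unit dvd_inI [of 1 "polys R" 1 1] by simp
        ultimately show ?thesis
          by (metis factors_in_step mult.right_neutral)
      qed
      then obtain m where "factors_in (polys R) m F'"
        by blast
      from P.factors_in_mult [OF factors_in_polys_const [OF F'(1)] this] F'(3)
      show ?thesis by auto
    qed
  qed
  then show ?thesis
    by (simp add: factorial_in_def P.idom_subring_axioms)
qed

text \<open>Meant for evaluation at a further variable, which maps the polynomials over
  \<open>mpolys V\<close> injectively into the power series.\<close>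

lemma factorial_in_image:
  fixes \<phi> :: "'a::idom \<Rightarrow> 'b::idom"
  assumes S: "factorial_in S" and inj: "inj_on \<phi> S" and one: "\<phi> 1 = 1"
    and diff: "\<And>a b. a \<in> S \<Longrightarrow> b \<in> S \<Longrightarrow> \<phi> (a - b) = \<phi> a - \<phi> b"
    and mult: "\<And>a b. a \<in> S \<Longrightarrow> b \<in> S \<Longrightarrow> \<phi> (a * b) = \<phi> a * \<phi> b"
  shows "factorial_in (\<phi> ` S)"
proof -
  interpret idom_subring S
    using S by (simp add: factorial_in_def)
  have sub: "idom_subring (\<phi> ` S)"
    by unfold_locales (auto simp flip: one diff mult intro: one_mem diff_mem mult_mem)
  have zero: "\<phi> 0 = 0"
    using diff [OF one_mem one_mem] by simp
  have dvd_iff: "dvd_in (\<phi> ` S) (\<phi> a) (\<phi> b) \<longleftrightarrow> dvd_in S a b" if "a \<in> S" "b \<in> S" for a b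
    using that inj by (auto simp: dvd_in_def inj_on_eq_iff mult_mem simp flip: mult)
  have dvd_one: "dvd_in (\<phi> ` S) (\<phi> a) 1 \<longleftrightarrow> dvd_in S a 1" if "a \<in> S" for a
    using dvd_iff [OF that one_mem] by (simp add: one)
  have prime: "prime_in (\<phi> ` S) (\<phi> a)" if "prime_in S a" for a
    unfolding prime_in_def
  proof (intro conjI ballI impI)
    have a: "a \<in> S" "a \<noteq> 0" "\<not> dvd_in S a 1"
      using that by (auto simp: prime_in_def)
    then show "\<phi> a \<in> \<phi> ` S" "\<phi> a \<noteq> 0" "\<not> dvd_in (\<phi> ` S) (\<phi> a) 1"
      using inj_onD [OF inj _ a(1) zero_mem] by (auto simp: zero dvd_one)
    fix x y assume "x \<in> \<phi> ` S" "y \<in> \<phi> ` S" and d: "dvd_in (\<phi> ` S) (\<phi> a) (x * y)"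
    then obtain b c where bc: "b \<in> S" "c \<in> S" "x = \<phi> b" "y = \<phi> c"
      by blast
    with d have "dvd_in (\<phi> ` S) (\<phi> a) (\<phi> (b * c))"
      by (simp add: mult)
    then have "dvd_in S a (b * c)"
      using dvd_iff a bc mult_mem by blast
    then show "dvd_in (\<phi> ` S) (\<phi> a) x \<or> dvd_in (\<phi> ` S) (\<phi> a) y"
      using that bc a by (auto simp: dvd_iff prime_in_def)
  qed
  have "factors_in (\<phi> ` S) n (\<phi> a)" if "factors_in S n a" for n a
    using that
  proof (induction rule: factors_in.induct)
    case (factors_in_unit u)
    then show ?case
      by (intro factors_in.factors_in_unit) (auto simp: dvd_one)
  next
    case (factors_in_step q n a)
    then have "\<phi> (q * a) = \<phi> q * \<phi> a"
      using factors_in_mem by (intro mult) (auto simp: prime_in_def)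
    then show ?case
      using factors_in_step by (auto intro: factors_in.factors_in_step prime)
  qed
  then show ?thesis
    using S sub zero by (auto simp: factorial_in_def) metis
qed

text \<open>A relation of least degree divides the others only over the field of fractions. Its
  prime factor \<open>A\<close> that kills \<open>f\<close> does more: pseudo-division gives
  \<open>smult r B = Q * A\<close>, and as the prime \<open>A\<close> cannot divide the nonzero
  constant \<open>r\<close>, it divides \<open>B\<close> with quotient in
  \<open>polys R\<close>.\<close>

lemma minimal_relation:
  fixes f :: "'a::idom"
  assumes R: "factorial_in R" and ex: "\<exists>B. B \<in> polys R \<and> B \<noteq> 0 \<and> poly B f = 0"
  obtains A where "A \<in> polys R" "A \<noteq> 0" "poly A f = 0"
    "\<And>B. B \<in> polys R \<Longrightarrow> B \<noteq> 0 \<Longrightarrow> poly B f = 0 \<Longrightarrow> degree A \<le> degree B"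
    "\<And>B. B \<in> polys R \<Longrightarrow> poly B f = 0 \<Longrightarrow> dvd_in (polys R) A B"
proof -
  interpret idom_subring R
    using R by (simp add: factorial_in_def)
  interpret P: idom_subring "polys R"
    by (rule idom_subring_polys)
  define I where "I = {B \<in> polys R. poly B f = 0}"
  obtain B0 where "B0 \<in> I \<and> B0 \<noteq> 0"
    using ex by (auto simp: I_def)
  from ex_has_least_nat [of "\<lambda>B. B \<in> I \<and> B \<noteq> 0", OF this]
  obtain D where D: "D \<in> I" "D \<noteq> 0" "\<And>B. B \<in> I \<Longrightarrow> B \<noteq> 0 \<Longrightarrow> degree D \<le> degree B"
    by blast
  obtain n where n: "factors_in (polys R) n D"
    using factorial_in_polys [OF R] D by (auto simp: factorial_in_def I_def)
  have "\<exists>q. prime_in (polys R) q \<and> q \<in> I \<and> dvd_in (polys R) q D"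
  proof (rule P.factors_in_prime_ideal [OF n D(1)])
    fix u assume "dvd_in (polys R) u 1"
    then obtain v where "1 = u * v" by (rule dvd_inE)
    then have "1 = poly u f * poly v f"
      by (metis poly_1 poly_mult)
    then show "u \<notin> I" by (auto simp: I_def)
  qed (auto simp: I_def)
  then obtain A where A: "prime_in (polys R) A" "A \<in> I" "dvd_in (polys R) A D"
    by blast
  have A0: "A \<noteq> 0" and AR: "A \<in> polys R" and Af: "poly A f = 0"
    using A by (auto simp: prime_in_def I_def)
  have "degree A \<le> degree D"
    using A(3) D(2) by (auto elim!: dvd_inE simp: degree_mult_eq)
  then have min: "degree A \<le> degree B" if "B \<in> I" "B \<noteq> 0" for B
    using D(3) that by (meson order_trans)
  have "dvd_in (polys R) A B" if B: "B \<in> polys R" "poly B f = 0" for B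
  proof -
    obtain r Q S where rQS: "r \<in> R" "Q \<in> polys R" "S \<in> polys R" "r \<noteq> 0" "smult r B = Q * A + S"
      "S = 0 \<or> degree S < degree A"
      using pseudo_division [OF AR A0 B(1)] by blast
    have "poly S f = 0"
      using arg_cong [OF rQS(5), of "\<lambda>P. poly P f"] B Af by simp
    then have "S = 0"
      using min [of S] rQS by (fastforce simp: I_def)
    then have "[:r:] * B = A * Q"
      using rQS by (simp add: mult.commute)
    then have "dvd_in (polys R) A ([:r:] * B)"
      using rQS by (blast intro: dvd_inI)
    then have "dvd_in (polys R) A [:r:] \<or> dvd_in (polys R) A B"
      using A(1) B rQS by (auto simp: prime_in_def const_mem_polys)
    moreover have "\<not> dvd_in (polys R) A [:r:]"
    proof
      assume "dvd_in (polys R) A [:r:]"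
      then obtain C where "[:r:] = A * C" by (rule dvd_inE)
      then have "poly [:r:] f = poly A f * poly C f" by (metis poly_mult)
      then show False using Af rQS by simp
    qed
    ultimately show ?thesis by blast
  qed
  with that [OF AR A0 Af] min show thesis
    by (auto simp: I_def)
qed

section \<open>Coefficients of multivariate power series\<close>

lemma lookup_Abs_finite [simp]: "Poly_Mapping.lookup (Abs_poly_mapping g) = (g :: 'n::finite \<Rightarrow> 'a::zero)"
  by (simp add: Abs_poly_mapping_inverse)

lemmas mfps_nth_0 [simp] = zero_mfps.rep_eq
lemmas mfps_nth_1 = one_mfps.rep_eq
lemmas mfps_nth_add [simp] = plus_mfps.rep_eq
lemmas mfps_nth_diff [simp] = minus_mfps.rep_eq
lemmas mfps_nth_uminus [simp] = uminus_mfps.rep_eq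
lemmas mfps_nth_mult = times_mfps.rep_eq

lemma mfps_eq_iff: "f = g \<longleftrightarrow> (\<forall>m. mfps_nth f m = mfps_nth g m)"
  by (auto intro: mfps_eqI)

lemma mfps_nth_sum [simp]: "mfps_nth (sum g A) m = (\<Sum>x\<in>A. mfps_nth (g x) m)"
  by (induction A rule: infinite_finite_induct) auto

lemma mfps_mult_nonzero:
  assumes "mfps_nth (f * g) m \<noteq> 0"
  shows "\<exists>i j. m = i + j \<and> mfps_nth f i \<noteq> 0 \<and> mfps_nth g j \<noteq> 0"
proof (rule ccontr)
  assume "\<not> ?thesis"
  then have "mfps_nth (f * g) m = 0"
    unfolding mfps_nth_mult by (intro sum.neutral) (auto, metis mult_zero_left mult_zero_right)
  with assms show False by simp
qed

definition mfps_term :: "'a::zero \<Rightarrow> ('n::finite \<Rightarrow>\<^sub>0 nat) \<Rightarrow> ('a, 'n) mfps"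
  where "mfps_term c a = Abs_mfps (\<lambda>m. if m = a then c else 0)"

lemma mfps_nth_term [simp]: "mfps_nth (mfps_term c a) m = (if m = a then c else 0)"
  by (simp add: mfps_term_def)

lemma mfps_nth_term_mult_add [simp]: "mfps_nth (mfps_term c a * g) (a + b) = c * mfps_nth g b"
proof -
  have "(\<Sum>(i, j)\<in>splits (a + b). mfps_nth (mfps_term c a) i * mfps_nth g j)
      = (\<Sum>(i, j)\<in>{(a, b)}. mfps_nth (mfps_term c a) i * mfps_nth g j)"
    by (rule sum.mono_neutral_right) (auto split: if_splits)
  then show ?thesis
    by (simp add: mfps_nth_mult)
qed

lemma mfps_nth_term_mult_eq_0: "(\<And>b. m \<noteq> a + b) \<Longrightarrow> mfps_nth (mfps_term c a * g) m = 0"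
  unfolding mfps_nth_mult by (rule sum.neutral) (auto simp: splits_def)

lemma mfps_term_mult: "mfps_term c a * mfps_term d b = mfps_term (c * d) (a + b)"
proof (rule mfps_eqI)
  fix m
  show "mfps_nth (mfps_term c a * mfps_term d b) m = mfps_nth (mfps_term (c * d) (a + b)) m"
    by (cases "\<exists>b'. m = a + b'") (auto simp: mfps_nth_term_mult_eq_0)
qed

lemma mfps_term_1_0: "mfps_term 1 0 = 1"
  by (auto simp: mfps_eq_iff mfps_nth_1)

lemma mfps_term_power:
  "mfps_term c a ^ k = mfps_term (c ^ k) (Abs_poly_mapping (\<lambda>i. k * Poly_Mapping.lookup a i))"
proof (induction k)
  case 0
  have "Abs_poly_mapping (\<lambda>i. 0 * Poly_Mapping.lookup a i) = 0"
    by (intro poly_mapping_eqI) simp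
  then show ?case by (simp add: mfps_term_1_0)
next
  case (Suc k)
  have "a + Abs_poly_mapping (\<lambda>i. k * Poly_Mapping.lookup a i)
      = Abs_poly_mapping (\<lambda>i. Suc k * Poly_Mapping.lookup a i)"
    by (intro poly_mapping_eqI) (simp add: lookup_add)
  then show ?case by (simp add: Suc mfps_term_mult)
qed

lemma mfps_nth_of_nat: "mfps_nth (of_nat k) m = (if m = 0 then of_nat k else 0)"
  by (induction k) (auto simp: mfps_nth_1)

lemma char_mfps: "CHAR(('a::comm_ring_1, 'n::finite) mfps) = CHAR('a)"
  by (rule CHAR_eqI) (auto simp: mfps_eq_iff mfps_nth_of_nat of_nat_eq_0_iff_char_dvd split: if_splits)

lemma freshmans_dream_mfps:
  fixes x y :: "('p::prime_card mod_ring, 'n::finite) mfps"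
  shows "(x + y) ^ CARD('p) = x ^ CARD('p) + y ^ CARD('p)"
    and "sum g A ^ CARD('p) = (\<Sum>a\<in>A. (g a :: ('p mod_ring, 'n) mfps) ^ CARD('p))"
  by (rule freshmans_dream freshmans_dream_sum; simp add: char_mfps prime_card)+

lemma mod_ring_power_card: "(c :: 'p::prime_card mod_ring) ^ CARD('p) = c"
  using finite_field_power_card_eq_same [of c] by simp

section \<open>Cartier operators\<close>

lemma finite_below: "finite {a :: 'n::finite \<Rightarrow>\<^sub>0 nat. \<forall>i. Poly_Mapping.lookup a i \<le> k i}"
proof (rule finite_imageD)
  show "finite (Poly_Mapping.lookup ` {a :: 'n \<Rightarrow>\<^sub>0 nat. \<forall>i. Poly_Mapping.lookup a i \<le> k i})"
    by (rule finite_subset [of _ "PiE UNIV (\<lambda>i. {..k i})"]) (auto intro!: finite_PiE)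
qed (auto intro!: inj_onI poly_mapping_eqI)

abbreviation affine_exp :: "nat \<Rightarrow> ('n::finite \<Rightarrow> nat) \<Rightarrow> ('n \<Rightarrow>\<^sub>0 nat) \<Rightarrow> ('n \<Rightarrow>\<^sub>0 nat)"
  where "affine_exp k r m \<equiv> Abs_poly_mapping (\<lambda>i. k * Poly_Mapping.lookup m i + r i)"

abbreviation dilate :: "nat \<Rightarrow> ('n::finite \<Rightarrow>\<^sub>0 nat) \<Rightarrow> ('n \<Rightarrow>\<^sub>0 nat)"
  where "dilate k m \<equiv> Abs_poly_mapping (\<lambda>i. k * Poly_Mapping.lookup m i)"

lemma dilate_inj: "k > 0 \<Longrightarrow> dilate k a = dilate k b \<longleftrightarrow> a = b"
  by (auto simp: poly_mapping_eq_iff fun_eq_iff)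

lemma affine_exp_inj: "k > 0 \<Longrightarrow> affine_exp k r a = affine_exp k r b \<longleftrightarrow> a = b"
  by (auto simp: poly_mapping_eq_iff fun_eq_iff)

text \<open>The freshman's dream covers finite sums only. To read off the coefficient at
  \<open>M\<close>, split \<open>g\<close> into its finitely many terms with exponents componentwise
  below \<open>M\<close> and a remainder, all of whose multiples have coefficient 0 at
  \<open>M\<close>.\<close>

lemma mfps_nth_frobenius:
  fixes g :: "('p::prime_card mod_ring, 'n::finite) mfps"
  shows "mfps_nth (g ^ CARD('p)) (dilate CARD('p) m) = mfps_nth g m"
    and "(\<And>a. m' \<noteq> dilate CARD('p) a) \<Longrightarrow> mfps_nth (g ^ CARD('p)) m' = 0"
proof -
  have p: "CARD('p) > 0"
    using prime_gt_0_nat [OF prime_card [where 'a = 'p]] by simp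
  let ?e = "\<lambda>m :: 'n \<Rightarrow>\<^sub>0 nat. dilate CARD('p) m"
  have *: "mfps_nth (g ^ CARD('p)) M
      = (\<Sum>a | \<forall>i. Poly_Mapping.lookup a i \<le> Poly_Mapping.lookup M i. if M = ?e a then mfps_nth g a else 0)" for M
  proof -
    define F where "F = {a :: 'n \<Rightarrow>\<^sub>0 nat. \<forall>i. Poly_Mapping.lookup a i \<le> Poly_Mapping.lookup M i}"
    have F: "finite F" unfolding F_def by (rule finite_below)
    define g1 where "g1 = (\<Sum>a\<in>F. mfps_term (mfps_nth g a) a)"
    define g2 where "g2 = g - g1"
    have "mfps_nth g2 a = 0" if "a \<in> F" for a
      using that F by (simp add: g2_def g1_def)
    then have "mfps_nth (g2 * g2 ^ (CARD('p) - 1)) M = 0"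
      unfolding mfps_nth_mult by (intro sum.neutral) (auto simp: splits_def F_def lookup_add)
    then have g2: "mfps_nth (g2 ^ CARD('p)) M = 0"
      using p by (simp flip: power_Suc)
    have "g1 ^ CARD('p) = (\<Sum>a\<in>F. mfps_term (mfps_nth g a) (?e a))"
      by (simp add: g1_def freshmans_dream_mfps mfps_term_power mod_ring_power_card)
    moreover have "g ^ CARD('p) = g1 ^ CARD('p) + g2 ^ CARD('p)"
      using freshmans_dream_mfps(1) [of g1 g2] by (simp add: g2_def)
    ultimately show ?thesis
      using g2 by (simp add: F_def)
  qed
  have "(\<Sum>a | \<forall>i. Poly_Mapping.lookup a i \<le> Poly_Mapping.lookup (?e m) i. if ?e m = ?e a then mfps_nth g a else 0)
      = (\<Sum>a\<in>{m}. if ?e m = ?e a then mfps_nth g a else 0)"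
    using p by (intro sum.mono_neutral_right)
      (auto simp: finite_below dilate_inj)
  then show "mfps_nth (g ^ CARD('p)) (?e m) = mfps_nth g m"
    by (simp add: *)
  show "mfps_nth (g ^ CARD('p)) m' = 0" if "\<And>a. m' \<noteq> ?e a"
    using that by (simp add: *)
qed

text \<open>For \<open>k = p\<close> and residues below \<open>p\<close> this is a Cartier operator
  over the prime field. No root of the coefficients is taken, since each of them is its own
  \<open>p\<close>-th power.\<close>

definition mfps_section :: "nat \<Rightarrow> ('n \<Rightarrow> nat) \<Rightarrow> ('a, 'n::finite) mfps \<Rightarrow> ('a, 'n) mfps"
  where "mfps_section k r g = Abs_mfps (\<lambda>m. mfps_nth g (affine_exp k r m))"

lemma mfps_nth_section [simp]: "mfps_nth (mfps_section k r g) m = mfps_nth g (affine_exp k r m)"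
  by (simp add: mfps_section_def)

lemma mfps_section_0 [simp]: "mfps_section k r 0 = 0"
  by (simp add: mfps_eq_iff)

lemma mfps_section_add: "mfps_section k r (g + h) = mfps_section k r g + mfps_section k r h"
  by (simp add: mfps_eq_iff)

lemma mfps_section_diff: "mfps_section k r (g - h) = mfps_section k r g - mfps_section k r h"
  by (simp add: mfps_eq_iff)

lemma mfps_section_minus: "mfps_section k r (- g) = - mfps_section k r g"
  by (simp add: mfps_eq_iff)

lemma mfps_section_sum: "mfps_section k r (sum g A) = (\<Sum>a\<in>A. mfps_section k r (g a))"
  by (simp add: mfps_eq_iff)

text \<open>A \<open>p\<close>-th power has only exponents divisible by \<open>p\<close>. Because
  \<open>r < p\<close> excludes a carry, the pairs of exponents that contribute at
  \<open>p m + r\<close> are exactly \<open>p a\<close> and \<open>p b + r\<close> with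
  \<open>a + b = m\<close>.\<close>

lemma mfps_section_power_mult:
  fixes g h :: "('p::prime_card mod_ring, 'n::finite) mfps"
  assumes r: "\<And>i. r i < CARD('p)"
  shows "mfps_section CARD('p) r (g ^ CARD('p) * h) = g * mfps_section CARD('p) r h"
proof (rule mfps_eqI)
  fix m
  let ?e = "dilate CARD('p)" and ?r = "affine_exp CARD('p) r"
  let ?E = "\<lambda>(a, b). (?e a, ?r b)"
  have p: "CARD('p) > 0"
    using prime_gt_0_nat [OF prime_card [where 'a = 'p]] by simp
  have sub: "?E ` splits m \<subseteq> splits (?r m)"
    by (auto simp: splits_def poly_mapping_eq_iff lookup_add fun_eq_iff algebra_simps
        simp flip: distrib_left)
  have zero: "mfps_nth (g ^ CARD('p)) i = 0" if ij: "(i, j) \<in> splits (?r m) - ?E ` splits m" for i j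
  proof (rule mfps_nth_frobenius(2), rule notI)
    fix a assume i: "i = ?e a"
    have eq: "CARD('p) * Poly_Mapping.lookup a x + Poly_Mapping.lookup j x
        = CARD('p) * Poly_Mapping.lookup m x + r x" for x
      using ij by (auto simp: i poly_mapping_eq_iff lookup_add fun_eq_iff)
    have le: "Poly_Mapping.lookup a x \<le> Poly_Mapping.lookup m x" for x
    proof (rule ccontr)
      assume "\<not> ?thesis"
      then have "CARD('p) * (Poly_Mapping.lookup m x + 1) \<le> CARD('p) * Poly_Mapping.lookup a x"
        by (intro mult_left_mono) auto
      with eq [of x] r [of x] show False
        by simp
    qed
    define b where "b = Abs_poly_mapping (\<lambda>x. Poly_Mapping.lookup m x - Poly_Mapping.lookup a x)"
    have "a + b = m"
      using le by (auto simp: b_def poly_mapping_eq_iff lookup_add fun_eq_iff)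
    moreover have "j = ?r b"
      using eq le by (auto simp: b_def poly_mapping_eq_iff fun_eq_iff diff_mult_distrib2)
        (metis Nat.add_diff_assoc2 add_diff_cancel_left' mult_le_mono2)
    ultimately have "(i, j) \<in> ?E ` splits m"
      by (intro image_eqI [of _ _ "(a, b)"]) (auto simp: i)
    with ij show False by simp
  qed
  have "mfps_nth (g ^ CARD('p) * h) (?r m) = (\<Sum>(i, j)\<in>?E ` splits m. mfps_nth (g ^ CARD('p)) i * mfps_nth h j)"
    unfolding mfps_nth_mult using zero by (intro sum.mono_neutral_right sub) auto
  also have "\<dots> = (\<Sum>(a, b)\<in>splits m. mfps_nth (g ^ CARD('p)) (?e a) * mfps_nth h (?r b))"
    using p by (subst sum.reindex) (auto intro!: inj_onI sum.cong simp: affine_exp_inj dilate_inj)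
  also have "\<dots> = mfps_nth (g * mfps_section CARD('p) r h) m"
    by (simp add: mfps_nth_mult mfps_nth_frobenius)
  finally show "mfps_nth (mfps_section CARD('p) r (g ^ CARD('p) * h)) m = mfps_nth (g * mfps_section CARD('p) r h) m"
    by simp
qed

text \<open>In \<open>y\<close> only the residue \<open>k - 1\<close> is read, as for the Cartier
  operator on differentials \<open>H dy\<close>: modulo \<open>p\<close>, the powers
  \<open>y^j\<close> with \<open>j\<close> not congruent to \<open>p - 1\<close> are those that have
  an antiderivative.\<close>

definition poly_section :: "nat \<Rightarrow> ('n \<Rightarrow> nat) \<Rightarrow> ('a, 'n::finite) mfps poly \<Rightarrow> ('a::comm_ring_1, 'n) mfps poly"
  where "poly_section k r H = Abs_poly (\<lambda>j. mfps_section k r (coeff H (k * j + (k - 1))))"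

lemma coeff_poly_section:
  assumes "k > 0"
  shows "coeff (poly_section k r H) j = mfps_section k r (coeff H (k * j + (k - 1)))"
proof -
  have "\<forall>j>degree H. mfps_section k r (coeff H (k * j + (k - 1))) = 0"
  proof (intro allI impI)
    fix j assume "degree H < j"
    moreover have "1 * j \<le> k * j"
      using assms by (intro mult_le_mono1) simp
    ultimately have "degree H < k * j + (k - 1)"
      by linarith
    then show "mfps_section k r (coeff H (k * j + (k - 1))) = 0"
      by (simp add: coeff_eq_0)
  qed
  then show ?thesis
    unfolding poly_section_def by (subst coeff_Abs_poly) auto
qed

text \<open>Cartier's operator commutes with taking the residue of \<open>G / A\<close> at the root \<open>y = f\<close>
  of \<open>A\<close>: write \<open>A = (y - f) B\<close>, so that \<open>B(f) = A'(f)\<close>, and use that \<open>(y - f)^p = y^p - f^p\<close>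
  and that the coefficient of \<open>y^(p - 1)\<close> in \<open>(y - f)^(p - 1)\<close> is 1.\<close>

lemma poly_section_power_mult:
  fixes f :: "('p::prime_card mod_ring, 'n::finite) mfps"
  assumes r: "\<And>i. r i < CARD('p)"
  shows "poly (poly_section CARD('p) r ([:-f, 1:] ^ (CARD('p) - 1) * G)) f = mfps_section CARD('p) r (poly G f)"
proof -
  let ?p = "CARD('p)"
  have p: "?p > 0"
    using prime_gt_0_nat [OF prime_card [where 'a = 'p]] by simp
  have frob: "[:-f, 1:] ^ ?p = monom 1 ?p - [:f ^ ?p:]"
  proof -
    have "CHAR(('p mod_ring, 'n) mfps poly) = ?p"
      by (simp add: char_mfps)
    then have "(monom 1 1 + [:-f:]) ^ ?p = monom 1 1 ^ ?p + [:-f:] ^ ?p"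
      by (intro freshmans_dream) (auto simp: prime_card)
    moreover from freshmans_dream_mfps(1) [of f "-f"]
    have "(0 :: ('p mod_ring, 'n) mfps) = f ^ ?p + (- f) ^ ?p"
      using freshmans_dream_mfps(1) [of f "-f"] zero_power [OF p, where 'a = "('p mod_ring, 'n) mfps"]
      by simp
    then have "(- f) ^ ?p = - (f ^ ?p)"
      by (metis add.commute eq_neg_iff_add_eq_0)
    moreover have "[:-f, 1:] = monom 1 1 + [:-f:]"
      by (simp add: monom_Suc monom_0)
    ultimately show ?thesis
      by (simp add: monom_power poly_const_pow)
  qed
  have add: "poly_section ?p r (H + H') = poly_section ?p r H + poly_section ?p r H'" for H H' :: "('p mod_ring, 'n) mfps poly"
    using p by (simp add: poly_eq_iff coeff_poly_section mfps_section_add)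
  \<comment> \<open>The remainder theorem separates the value of \<open>G\<close> at
    \<open>f\<close> from a multiple of \<open>y - f\<close>, which will contribute 0.\<close>
  obtain H where H: "G = [:poly G f:] + [:-f, 1:] * H"
    using synthetic_div_correct' [of f G] by (metis add.commute)
  have "poly (poly_section ?p r ([:-f, 1:] ^ (?p - 1) * ([:-f, 1:] * H))) f = 0"
  proof -
    have "[:-f, 1:] ^ (?p - 1) * ([:-f, 1:] * H) = [:-f, 1:] ^ ?p * H"
      by (simp only: mult.assoc [symmetric] power_minus_mult [OF p])
    also have "\<dots> = monom 1 ?p * H - smult (f ^ ?p) H"
      by (simp add: frob algebra_simps)
    \<comment> \<open>The factor \<open>y^p\<close> becomes a shift by one index and
      \<open>f^p\<close> comes out as \<open>f\<close>, so the section is again a multiple of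
      \<open>y - f\<close>.\<close>
    also have "poly_section ?p r \<dots> = [:-f, 1:] * poly_section ?p r H"
    proof (rule poly_eqI)
      fix j
      show "coeff (poly_section ?p r (monom 1 ?p * H - smult (f ^ ?p) H)) j
          = coeff ([:-f, 1:] * poly_section ?p r H) j"
      proof (cases j)
        case 0
        moreover have "\<not> ?p \<le> ?p - 1"
          using p by linarith
        ultimately show ?thesis
          using p by (simp add: coeff_poly_section coeff_monom_mult mfps_section_minus mfps_section_power_mult r)
      next
        case (Suc i)
        have "coeff (monom 1 ?p * H) (?p * j + (?p - 1)) = coeff H (?p * i + (?p - 1))"
          using Suc by (simp add: coeff_monom_mult)
        then show ?thesis
          using p Suc by (simp add: coeff_poly_section mfps_section_diff mfps_section_power_mult r)
      qed
    qed
    finally show ?thesis by simp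
  qed
  moreover have "poly (poly_section ?p r ([:-f, 1:] ^ (?p - 1) * [:poly G f:])) f = mfps_section ?p r (poly G f)"
  proof -
    have deg: "degree ([:-f, 1:] ^ (?p - 1)) = ?p - 1"
      by (simp add: degree_linear_power)
    then have "coeff ([:-f, 1:] ^ (?p - 1)) (?p - 1) = 1"
      using monic_power [of "[:-f, 1:]" "?p - 1"] by simp
    then have "poly_section ?p r ([:-f, 1:] ^ (?p - 1) * [:poly G f:]) = [:mfps_section ?p r (poly G f):]"
    proof (intro poly_eqI)
      fix j
      \<comment> \<open>Only the index \<open>p - 1\<close> matters: the next one that is read,
        \<open>2 p - 1\<close>, already exceeds the degree.\<close>
      have "coeff ([:-f, 1:] ^ (?p - 1)) (?p * j + (?p - 1)) = 0" if "j > 0"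
      proof (rule coeff_eq_0)
        have "?p * j > 0"
          using that p by simp
        then show "degree ([:-f, 1:] ^ (?p - 1)) < ?p * j + (?p - 1)"
          unfolding deg by linarith
      qed
      then show "coeff (poly_section ?p r ([:-f, 1:] ^ (?p - 1) * [:poly G f:])) j
          = coeff [:mfps_section ?p r (poly G f):] j"
        using p \<open>coeff ([:-f, 1:] ^ (?p - 1)) (?p - 1) = 1\<close>
        by (cases "j = 0") (simp_all add: coeff_poly_section coeff_pCons mult.commute split: nat.splits)
    qed
    then show ?thesis by simp
  qed
  ultimately show ?thesis
    by (subst H) (simp add: add distrib_left)
qed

text \<open>If \<open>A'(f)\<close> is nonzero, \<open>w\<close> is the residue of
  \<open>P / A\<close> at \<open>y = f\<close>. Since \<open>P / A\<close> equals
  \<open>P A^(p-1) / A^p\<close>, the section takes the root of the denominator and leads back to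
  \<open>A\<close>.\<close>

lemma section_of_residue:
  fixes f :: "('p::prime_card mod_ring, 'n::finite) mfps"
  assumes r: "\<And>i. r i < CARD('p)" and A: "poly A f = 0" and w: "w * poly (pderiv A) f = poly P f"
  shows "mfps_section CARD('p) r w * poly (pderiv A) f = poly (poly_section CARD('p) r (P * A ^ (CARD('p) - 1))) f"
proof -
  let ?p = "CARD('p)"
  have p: "?p > 0"
    using prime_gt_0_nat [OF prime_card [where 'a = 'p]] by simp
  obtain B where B: "A = [:-f, 1:] * B"
    using synthetic_div_correct' [of f A] A by (metis add.right_neutral pCons_0_0)
  have Bf: "poly B f = poly (pderiv A) f"
    unfolding B pderiv_mult by (simp add: pderiv_pCons)
  have "poly (poly_section ?p r (P * A ^ (?p - 1))) f
      = poly (poly_section ?p r ([:-f, 1:] ^ (?p - 1) * (P * B ^ (?p - 1)))) f"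
    unfolding B power_mult_distrib by (simp only: mult_ac)
  also have "\<dots> = mfps_section ?p r (poly (P * B ^ (?p - 1)) f)"
    by (rule poly_section_power_mult [OF r])
  also have "poly (P * B ^ (?p - 1)) f = w * (poly B f * poly B f ^ (?p - 1))"
    by (simp add: w [symmetric] Bf)
  also have "\<dots> = poly B f ^ ?p * w"
    using p by (simp add: mult_ac flip: power_Suc)
  also have "mfps_section ?p r \<dots> = poly B f * mfps_section ?p r w"
    by (rule mfps_section_power_mult [OF r])
  finally show ?thesis
    by (simp add: Bf mult.commute)
qed

section \<open>Polynomials among the power series\<close>

definition mpolys :: "'n set \<Rightarrow> ('a::zero, 'n) mfps set"
  where "mpolys V = {g. finite {m. mfps_nth g m \<noteq> 0} \<and>
    (\<forall>m x. mfps_nth g m \<noteq> 0 \<longrightarrow> x \<notin> V \<longrightarrow> Poly_Mapping.lookup m x = 0)}"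

lemma idom_subring_mpolys: "idom_subring (mpolys V :: ('a::idom, 'n::finite) mfps set)"
proof
  show "1 \<in> (mpolys V :: ('a, 'n) mfps set)"
    by (auto simp: mpolys_def mfps_nth_1)
  fix f g :: "('a, 'n) mfps"
  assume fg: "f \<in> mpolys V" "g \<in> mpolys V"
  let ?s = "\<lambda>f :: ('a, 'n) mfps. {m. mfps_nth f m \<noteq> 0}"
  have "?s (f - g) \<subseteq> ?s f \<union> ?s g"
    by auto
  moreover have "finite (?s f \<union> ?s g)"
    using fg by (auto simp: mpolys_def)
  ultimately have "finite (?s (f - g))"
    by (rule finite_subset)
  then show "f - g \<in> mpolys V"
    using fg by (auto simp: mpolys_def) (metis diff_self)
  have ex: "\<exists>i j. m = i + j \<and> mfps_nth f i \<noteq> 0 \<and> mfps_nth g j \<noteq> 0" if "mfps_nth (f * g) m \<noteq> 0" for m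
    using mfps_mult_nonzero [OF that] .
  then have "?s (f * g) \<subseteq> (\<lambda>(i, j). i + j) ` (?s f \<times> ?s g)"
    by fastforce
  moreover have "finite ((\<lambda>(i, j). i + j) ` (?s f \<times> ?s g))"
    using fg by (auto simp: mpolys_def)
  ultimately have "finite (?s (f * g))"
    by (rule finite_subset)
  moreover have "Poly_Mapping.lookup m x = 0" if "mfps_nth (f * g) m \<noteq> 0" "x \<notin> V" for m x
    using ex [OF that(1)] fg that(2) by (auto simp: mpolys_def lookup_add)
  ultimately show "f * g \<in> mpolys V"
    by (auto simp: mpolys_def)
qed

lemma mpolys_mono: "V \<subseteq> W \<Longrightarrow> mpolys V \<subseteq> mpolys W"
  by (auto simp: mpolys_def)

lemma factorial_in_mpolys_empty: "factorial_in (mpolys {} :: ('a::field, 'n::finite) mfps set)"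
proof -
  interpret idom_subring "mpolys {} :: ('a, 'n) mfps set"
    by (rule idom_subring_mpolys)
  have "factors_in (mpolys {}) 0 g" if g: "g \<in> mpolys {}" "g \<noteq> 0" for g :: "('a, 'n) mfps"
  proof (rule factors_in_unit [OF g(1)])
    have "m = 0" if "mfps_nth g m \<noteq> 0" for m
      using g that by (auto simp: mpolys_def poly_mapping_eq_iff fun_eq_iff)
    then have eq: "g = mfps_term (mfps_nth g 0) 0" and "mfps_nth g 0 \<noteq> 0"
      using g(2) by (auto simp: mfps_eq_iff)
    from \<open>mfps_nth g 0 \<noteq> 0\<close> have "mfps_term (mfps_nth g 0) 0 * mfps_term (1 / mfps_nth g 0) 0 = 1"
      by (simp add: mfps_term_mult mfps_term_1_0)
    then have "1 = g * mfps_term (1 / mfps_nth g 0) 0"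
      using eq by metis
    moreover have "mfps_term (1 / mfps_nth g 0) 0 \<in> mpolys {}"
      by (auto simp: mpolys_def split: if_splits)
    ultimately show "dvd_in (mpolys {}) g 1"
      by (blast intro: dvd_inI)
  qed
  then show ?thesis
    using idom_subring_axioms by (auto simp: factorial_in_def)
qed

abbreviation set_exp :: "('n::finite \<Rightarrow>\<^sub>0 nat) \<Rightarrow> 'n \<Rightarrow> nat \<Rightarrow> ('n \<Rightarrow>\<^sub>0 nat)"
  where "set_exp m x k \<equiv> Abs_poly_mapping ((Poly_Mapping.lookup m)(x := k))"

text \<open>The coefficients of \<open>P\<close> do not involve the variable \<open>x\<close>, so
  the exponent of \<open>x\<close> in a monomial tells from which coefficient of \<open>P\<close> it
  stems.\<close>

lemma mfps_nth_poly_variable: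
  fixes P :: "('a::idom, 'n::finite) mfps poly"
  assumes P: "P \<in> polys (mpolys V)" and x: "x \<notin> V"
  shows "mfps_nth (poly P (mfps_term 1 (Poly_Mapping.single x (Suc 0)))) m
    = mfps_nth (coeff P (Poly_Mapping.lookup m x)) (set_exp m x 0)"
proof -
  let ?k = "Poly_Mapping.lookup m x"
  have pow: "mfps_term (1::'a) (Poly_Mapping.single x (Suc 0)) ^ i = mfps_term 1 (Poly_Mapping.single x i)" for i
    by (auto simp: mfps_term_power lookup_single poly_mapping_eq_iff fun_eq_iff when_def
        intro!: arg_cong [of _ _ "mfps_term 1"])
  have nth: "mfps_nth (g * mfps_term 1 (Poly_Mapping.single x i)) m
      = (if i = ?k then mfps_nth g (set_exp m x 0) else 0)" if g: "g \<in> mpolys V" for g :: "('a, 'n) mfps" and i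
  proof (cases "\<exists>b. m = Poly_Mapping.single x i + b")
    case True
    then obtain b where b: "m = Poly_Mapping.single x i + b"
      by blast
    then have "mfps_nth (g * mfps_term 1 (Poly_Mapping.single x i)) m = mfps_nth g b"
      by (simp add: mult.commute [of g])
    also have "\<dots> = (if i = ?k then mfps_nth g (set_exp m x 0) else 0)"
    proof (cases "i = ?k")
      case True
      then have "b = set_exp m x 0"
        using b by (auto simp: poly_mapping_eq_iff fun_eq_iff lookup_add lookup_single when_def)
      with True show ?thesis by simp
    next
      case False
      then have "Poly_Mapping.lookup b x \<noteq> 0"
        using b by (auto simp: lookup_add lookup_single)
      then show ?thesis
        using False g x by (auto simp: mpolys_def)
    qed
    finally show ?thesis .
  next
    case False
    have "m = Poly_Mapping.single x ?k + set_exp m x 0"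
      by (auto simp: poly_mapping_eq_iff fun_eq_iff lookup_add lookup_single when_def)
    with False have "i \<noteq> ?k" by auto
    with False show ?thesis
      by (simp add: mult.commute [of g] mfps_nth_term_mult_eq_0)
  qed
  have "mfps_nth (poly P (mfps_term 1 (Poly_Mapping.single x (Suc 0)))) m
      = (\<Sum>i\<le>degree P. if i = ?k then mfps_nth (coeff P i) (set_exp m x 0) else 0)"
    using polys_coeff [OF P] by (simp add: poly_altdef pow nth)
  then show ?thesis
    by (auto simp: coeff_eq_0)
qed

text \<open>Evaluation at the variable \<open>x\<close> identifies \<open>polys (mpolys V)\<close>
  with \<open>mpolys (insert x V)\<close>.\<close>

lemma factorial_in_mpolys_insert:
  assumes V: "factorial_in (mpolys V :: ('a::field, 'n::finite) mfps set)" and x: "x \<notin> V"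
  shows "factorial_in (mpolys (insert x V) :: ('a, 'n) mfps set)"
proof -
  define t :: "('a, 'n) mfps" where "t = mfps_term 1 (Poly_Mapping.single x (Suc 0))"
  have nth: "mfps_nth (poly P t) m = mfps_nth (coeff P (Poly_Mapping.lookup m x)) (set_exp m x 0)"
    if "P \<in> polys (mpolys V)" for P m
    unfolding t_def by (rule mfps_nth_poly_variable [OF that x])
  interpret idom_subring "mpolys V :: ('a, 'n) mfps set"
    by (rule idom_subring_mpolys)
  interpret W: idom_subring "mpolys (insert x V) :: ('a, 'n) mfps set"
    by (rule idom_subring_mpolys)
  interpret P: idom_subring "polys (mpolys V :: ('a, 'n) mfps set)"
    by (rule idom_subring_polys)
  have zero: "P = 0" if P: "P \<in> polys (mpolys V)" "poly P t = 0" for P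
  proof (intro poly_eqI mfps_eqI)
    fix k m
    show "mfps_nth (coeff P k) m = mfps_nth (coeff 0 k) m"
    proof (cases "Poly_Mapping.lookup m x = 0")
      case True
      then have "set_exp (set_exp m x k) x 0 = m"
        by (auto simp: poly_mapping_eq_iff fun_eq_iff)
      then show ?thesis
        using nth [OF P(1), of "set_exp m x k"] P(2) by simp
    next
      case False
      then show ?thesis
        using polys_coeff [OF P(1), of k] x by (auto simp: mpolys_def)
    qed
  qed
  have "factorial_in ((\<lambda>P. poly P t) ` polys (mpolys V))"
  proof (rule factorial_in_image [OF factorial_in_polys [OF V]])
    show "inj_on (\<lambda>P. poly P t) (polys (mpolys V))"
    proof (rule inj_onI)
      fix P Q assume "P \<in> polys (mpolys V)" "Q \<in> polys (mpolys V)" "poly P t = poly Q t"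
      then have "P - Q = 0"
        by (intro zero P.diff_mem) auto
      then show "P = Q" by simp
    qed
  qed auto
  moreover have "(\<lambda>P. poly P t) ` polys (mpolys V) = mpolys (insert x V)"
  proof (intro equalityI subsetI)
    fix g assume "g \<in> (\<lambda>P. poly P t) ` polys (mpolys V)"
    then obtain P where P: "P \<in> polys (mpolys V)" "g = poly P t"
      by blast
    have "t \<in> mpolys (insert x V)"
      by (auto simp: t_def mpolys_def lookup_single when_def split: if_splits)
    then show "g \<in> mpolys (insert x V)"
      unfolding P(2) poly_altdef
      using polys_coeff [OF P(1)] mpolys_mono [of V "insert x V"]
      by (intro W.sum_mem W.mult_mem W.power_mem) blast+
  next
    fix g :: "('a, 'n) mfps" assume g: "g \<in> mpolys (insert x V)"
    define S where "S = {m. mfps_nth g m \<noteq> 0}"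
    have S: "finite S"
      using g by (simp add: S_def mpolys_def)
    \<comment> \<open>The coefficient of the \<open>k\<close>-th power of the variable
      \<open>x\<close>; the test in its definition makes it free of \<open>x\<close>.\<close>
    define c where "c k = Abs_mfps (\<lambda>m. if Poly_Mapping.lookup m x = 0 then mfps_nth g (set_exp m x k) else 0)" for k
    define K where "K = Max (insert 0 ((\<lambda>m. Poly_Mapping.lookup m x) ` S))"
    have K: "Poly_Mapping.lookup m x \<le> K" if "m \<in> S" for m
      unfolding K_def using S that by (intro Max_ge) auto
    have "c k = 0" if "k > K" for k
    proof (rule mfps_eqI)
      fix m
      have "set_exp m x k \<notin> S"
        using K [of "set_exp m x k"] that by auto
      then show "mfps_nth (c k) m = mfps_nth 0 m"
        by (auto simp: c_def S_def)
    qed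
    then have coeff: "coeff (Abs_poly c) k = c k" for k
      by (subst coeff_Abs_poly) auto
    have "c k \<in> mpolys V" for k
    proof -
      have "{m. mfps_nth (c k) m \<noteq> 0} \<subseteq> (\<lambda>m. set_exp m x 0) ` S"
      proof
        fix m assume "m \<in> {m. mfps_nth (c k) m \<noteq> 0}"
        then have "Poly_Mapping.lookup m x = 0" "set_exp m x k \<in> S"
          by (auto simp: c_def S_def split: if_splits)
        then show "m \<in> (\<lambda>m. set_exp m x 0) ` S"
          by (intro image_eqI [of _ _ "set_exp m x k"]) (auto simp: poly_mapping_eq_iff fun_eq_iff)
      qed
      then have "finite {m. mfps_nth (c k) m \<noteq> 0}"
        using S finite_subset by blast
      moreover have "Poly_Mapping.lookup m y = 0" if "mfps_nth (c k) m \<noteq> 0" "y \<notin> V" for m y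
      proof (cases "y = x")
        case True
        then show ?thesis using that by (auto simp: c_def split: if_splits)
      next
        case False
        moreover have "mfps_nth g (set_exp m x k) \<noteq> 0"
          using that by (auto simp: c_def split: if_splits)
        ultimately have "Poly_Mapping.lookup (set_exp m x k) y = 0"
          using g that(2) unfolding mpolys_def by blast
        then show ?thesis using False by simp
      qed
      ultimately show ?thesis
        by (auto simp: mpolys_def)
    qed
    then have P: "Abs_poly c \<in> polys (mpolys V)"
      by (simp add: polys_def coeff)
    moreover have "g = poly (Abs_poly c) t"
      by (rule mfps_eqI) (simp add: nth [OF P] coeff c_def poly_mapping_eq_iff)
    ultimately show "g \<in> (\<lambda>P. poly P t) ` polys (mpolys V)"
      by blast
  qed
  ultimately show ?thesis by simp
qed

theorem factorial_in_mpolys: "factorial_in (mpolys UNIV :: ('a::field, 'n::finite) mfps set)"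
proof -
  have "factorial_in (mpolys V :: ('a, 'n) mfps set)" for V :: "'n set"
    using finite_class.finite [of V]
    by (induction V rule: finite_induct) (auto intro: factorial_in_mpolys_empty factorial_in_mpolys_insert)
  then show ?thesis .
qed

lemma mpolys_UNIV: "g \<in> mpolys UNIV \<longleftrightarrow> finite {m. mfps_nth g m \<noteq> 0}"
  by (simp add: mpolys_def)

section \<open>Weighted degrees\<close>

text \<open>Weights treat both kinds of height alike: the indicator of one variable gives the
  partial degree, constant weights 1 give the total degree.\<close>

abbreviation weight :: "('n::finite \<Rightarrow> nat) \<Rightarrow> ('n \<Rightarrow>\<^sub>0 nat) \<Rightarrow> nat"
  where "weight v m \<equiv> \<Sum>i\<in>UNIV. v i * Poly_Mapping.lookup m i"

lemma weight_add: "weight v (a + b) = weight v a + weight v b"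
  by (simp add: lookup_add distrib_left sum.distrib)

definition weight_le :: "('n::finite \<Rightarrow> nat) \<Rightarrow> nat \<Rightarrow> ('a::zero, 'n) mfps \<Rightarrow> bool"
  where "weight_le v k g \<longleftrightarrow> (\<forall>m. mfps_nth g m \<noteq> 0 \<longrightarrow> weight v m \<le> k)"

lemma weight_leD: "weight_le v k g \<Longrightarrow> mfps_nth g m \<noteq> 0 \<Longrightarrow> weight v m \<le> k"
  by (simp add: weight_le_def)

lemma weight_le_0 [simp]: "weight_le v k 0"
  by (simp add: weight_le_def)

lemma weight_le_1: "weight_le v k 1"
  by (auto simp: weight_le_def mfps_nth_1)

lemma weight_le_add: "weight_le v k f \<Longrightarrow> weight_le v k g \<Longrightarrow> weight_le v k (f + g)"
  unfolding weight_le_def by (metis add.right_neutral mfps_nth_add)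

lemma weight_le_sum: "(\<And>x. x \<in> A \<Longrightarrow> weight_le v k (g x)) \<Longrightarrow> weight_le v k (sum g A)"
  by (induction A rule: infinite_finite_induct) (auto intro: weight_le_add)

lemma weight_le_mult:
  assumes "weight_le v k f" "weight_le v l g"
  shows "weight_le v (k + l) (f * g)"
  unfolding weight_le_def
proof (intro allI impI)
  fix m assume "mfps_nth (f * g) m \<noteq> 0"
  from mfps_mult_nonzero [OF this]
  obtain i j where "m = i + j" "mfps_nth f i \<noteq> 0" "mfps_nth g j \<noteq> 0"
    by blast
  then show "weight v m \<le> k + l"
    using assms weight_leD unfolding weight_add [of v i j] \<open>m = i + j\<close> by (blast intro: add_mono)
qed

lemma weight_le_coeff_mult:
  assumes "\<And>i. weight_le v k (coeff F i)" "\<And>i. weight_le v l (coeff G i)"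
  shows "weight_le v (k + l) (coeff (F * G) i)"
  unfolding coeff_mult by (intro weight_le_sum weight_le_mult assms)

lemma weight_le_coeff_power:
  assumes "\<And>i. weight_le v k (coeff F i)"
  shows "weight_le v (n * k) (coeff (F ^ n) i)"
proof (induction n arbitrary: i)
  case 0
  then show ?case by (cases i) (auto simp: one_pCons coeff_pCons weight_le_1 split: nat.splits)
next
  case (Suc n)
  then show ?case using weight_le_coeff_mult [OF assms Suc] by simp
qed

definition weight_part :: "('n::finite \<Rightarrow> nat) \<Rightarrow> nat \<Rightarrow> ('a::zero, 'n) mfps \<Rightarrow> ('a, 'n) mfps"
  where "weight_part v k g = Abs_mfps (\<lambda>m. if weight v m = k then mfps_nth g m else 0)"

lemma weight_part_0 [simp]: "weight_part v k 0 = 0"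
  by (simp add: weight_part_def mfps_eq_iff)

lemma weight_part_sum: "weight_part v k (sum g A) = (\<Sum>x\<in>A. weight_part v k (g x))"
  by (simp add: weight_part_def mfps_eq_iff)

text \<open>In the product, an exponent of weight \<open>k + l\<close> can only be a sum of
  exponents of the extreme weights \<open>k\<close> and \<open>l\<close>.\<close>

lemma weight_part_mult:
  assumes "weight_le v k f" "weight_le v l g"
  shows "weight_part v (k + l) (f * g) = weight_part v k f * weight_part v l g"
proof (rule mfps_eqI)
  fix m
  have "(\<Sum>(i, j)\<in>splits m. mfps_nth (weight_part v k f) i * mfps_nth (weight_part v l g) j)
      = (\<Sum>(i, j)\<in>splits m. if weight v m = k + l then mfps_nth f i * mfps_nth g j else 0)"
  proof (rule sum.cong [OF refl])
    fix ij assume "ij \<in> splits m"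
    then obtain i j where ij: "ij = (i, j)" "m = i + j"
      by (auto simp: splits_def)
    have "weight v m = weight v i + weight v j"
      by (simp only: ij weight_add)
    then show "(case ij of (i, j) \<Rightarrow> mfps_nth (weight_part v k f) i * mfps_nth (weight_part v l g) j)
        = (case ij of (i, j) \<Rightarrow> if weight v m = k + l then mfps_nth f i * mfps_nth g j else 0)"
      using weight_leD [OF assms(1), of i] weight_leD [OF assms(2), of j]
      by (cases "mfps_nth f i = 0 \<or> mfps_nth g j = 0") (auto simp: ij(1) weight_part_def)
  qed
  also have "\<dots> = mfps_nth (weight_part v (k + l) (f * g)) m"
    by (simp add: weight_part_def mfps_nth_mult)
  finally show "mfps_nth (weight_part v (k + l) (f * g)) m = mfps_nth (weight_part v k f * weight_part v l g) m"
    by (simp add: mfps_nth_mult)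
qed

text \<open>The leading forms of \<open>F\<close> and \<open>G\<close> are nonzero and their product
  is the leading form of \<open>F * G\<close>, as there are no zero divisors. So exact weights add
  up, and a factor cannot exceed the product.\<close>

lemma weight_le_factor:
  fixes F G :: "('a::idom, 'n::finite) mfps poly"
  assumes F: "F \<in> polys (mpolys UNIV)" and G: "G \<in> polys (mpolys UNIV)" and FG: "F * G \<noteq> 0"
    and bound: "\<And>i. weight_le v k (coeff (F * G) i)"
  shows "weight_le v k (coeff F i)"
proof (rule ccontr)
  assume not: "\<not> weight_le v k (coeff F i)"
  \<comment> \<open>The exact weight \<open>l\<close> of a nonzero polynomial; the maximum exists
    because the supports are finite.\<close>
  have *: "\<exists>l. (\<forall>i. weight_le v l (coeff F i)) \<and> (\<exists>i. weight_part v l (coeff F i) \<noteq> 0)"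
    if F: "F \<in> polys (mpolys UNIV)" "F \<noteq> 0" for F :: "('a, 'n) mfps poly"
  proof -
    define S where "S = (\<Union>i\<in>{..degree F}. {m. mfps_nth (coeff F i) m \<noteq> 0})"
    have "finite S"
      unfolding S_def using polys_coeff [OF F(1)] by (auto simp: mpolys_UNIV)
    have memS: "m \<in> S" if "mfps_nth (coeff F i) m \<noteq> 0" for i m
      using that by (cases "i \<le> degree F") (auto simp: S_def coeff_eq_0)
    have "S \<noteq> {}"
    proof -
      have "lead_coeff F \<noteq> 0" using F by simp
      then obtain m where "mfps_nth (lead_coeff F) m \<noteq> 0"
        by (metis mfps_eqI mfps_nth_0)
      then show ?thesis using memS by blast
    qed
    define l where "l = Max (weight v ` S)"
    have le: "weight v m \<le> l" if "m \<in> S" for m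
      unfolding l_def using \<open>finite S\<close> that by (intro Max_ge) auto
    have "l \<in> weight v ` S"
      unfolding l_def using \<open>finite S\<close> \<open>S \<noteq> {}\<close> by (intro Max_in) auto
    then obtain m i where m: "weight v m = l" "mfps_nth (coeff F i) m \<noteq> 0"
      by (auto simp: S_def)
    then have "mfps_nth (weight_part v l (coeff F i)) m \<noteq> 0"
      by (simp add: weight_part_def)
    then have "weight_part v l (coeff F i) \<noteq> 0"
      by (metis mfps_nth_0)
    then show ?thesis
      using le memS by (auto simp: weight_le_def)
  qed
  have "F \<noteq> 0" "G \<noteq> 0" using FG by auto
  then obtain a b where a: "\<And>i. weight_le v a (coeff F i)" "\<exists>i. weight_part v a (coeff F i) \<noteq> 0"
    and b: "\<And>i. weight_le v b (coeff G i)" "\<exists>i. weight_part v b (coeff G i) \<noteq> 0"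
    using * [OF F] * [OF G] by blast
  have "k < a"
    using not a(1) [of i] by (meson weight_le_def le_trans not_le_imp_less)
  let ?H = "\<lambda>l F. map_poly (weight_part v l) F"
  have "?H (a + b) (F * G) = ?H a F * ?H b G"
    by (intro poly_eqI) (simp add: coeff_map_poly coeff_mult weight_part_sum weight_part_mult a b)
  moreover have "?H a F \<noteq> 0" "?H b G \<noteq> 0"
    using a(2) b(2) by (auto simp: poly_eq_iff coeff_map_poly)
  ultimately have "?H (a + b) (F * G) \<noteq> 0"
    by simp
  then obtain i where "weight_part v (a + b) (coeff (F * G) i) \<noteq> 0"
    by (auto simp: poly_eq_iff coeff_map_poly)
  then obtain m where "mfps_nth (weight_part v (a + b) (coeff (F * G) i)) m \<noteq> 0"
    by (metis mfps_eqI mfps_nth_0)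
  then have "weight v m = a + b" "mfps_nth (coeff (F * G) i) m \<noteq> 0"
    by (auto simp: weight_part_def split: if_splits)
  then show False
    using weight_leD [OF bound] \<open>k < a\<close> by force
qed

section \<open>Degrees of algebraic elements\<close>

lemma nat_pow_ring_of_type_algebra:
  "x [^]\<^bsub>ring_of_type_algebra\<^esub> (k::nat) = (x :: 'a::field) ^ k"
proof -
  interpret field "ring_of_type_algebra :: 'a ring"
    by (rule field_from_type_algebra)
  show ?thesis
    by (induction k) (auto simp: ring_of_type_algebra_def nat_pow_def)
qed

text \<open>The two representations list coefficients in opposite orders: leading coefficient first
  for \<open>ring.eval\<close>, constant coefficient first for \<open>Poly\<close>.\<close>

lemma poly_Poly_rev: "poly (Poly (rev l)) (x :: 'a::field) = ring.eval ring_of_type_algebra l x"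
proof -
  interpret field "ring_of_type_algebra :: 'a ring"
    by (rule field_from_type_algebra)
  show ?thesis
    by (induction l)
       (auto simp: Poly_snoc poly_monom nat_pow_ring_of_type_algebra,
        auto simp: ring_of_type_algebra_def)
qed

lemma subfield_of_typeI:
  fixes K :: "'a::field set"
  assumes "1 \<in> K" "\<And>x y. x \<in> K \<Longrightarrow> y \<in> K \<Longrightarrow> x - y \<in> K"
    and "\<And>x y. x \<in> K \<Longrightarrow> y \<in> K \<Longrightarrow> x * y \<in> K" "\<And>x. x \<in> K \<Longrightarrow> inverse x \<in> K"
  shows "subfield K ring_of_type_algebra"
proof -
  interpret field "ring_of_type_algebra :: 'a ring"
    by (rule field_from_type_algebra)
  have simps: "carrier (ring_of_type_algebra :: 'a ring) = UNIV"
    "\<one>\<^bsub>ring_of_type_algebra\<^esub> = (1::'a)" "\<zero>\<^bsub>ring_of_type_algebra\<^esub> = (0::'a)"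
    "\<And>x y::'a. x \<otimes>\<^bsub>ring_of_type_algebra\<^esub> y = x * y" "\<And>x y::'a. x \<oplus>\<^bsub>ring_of_type_algebra\<^esub> y = x + y"
    by (simp_all add: ring_of_type_algebra_def)
  have minus: "\<ominus>\<^bsub>ring_of_type_algebra\<^esub> x = - x" for x :: 'a
    by (rule minus_equality) (simp_all add: simps)
  have inv: "inv\<^bsub>ring_of_type_algebra\<^esub> x = inverse x" if "x \<noteq> 0" for x :: 'a
    using that by (intro comm_inv_char) (simp_all add: simps)
  have zero: "0 \<in> K"
    using assms(2) [OF assms(1,1)] by simp
  have uminus: "- x \<in> K" if "x \<in> K" for x
    using assms(2) [OF zero that] by simp
  have add: "x + y \<in> K" if "x \<in> K" "y \<in> K" for x y
    using assms(2) [OF that(1) uminus [OF that(2)]] by simp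
  show ?thesis
  proof (rule subfieldI')
    show "subring K ring_of_type_algebra"
      by (rule subringI) (auto simp: simps minus assms add uminus)
  qed (auto simp: simps inv assms)
qed

text \<open>For algebraic \<open>x\<close> the generated field is
  \<open>simple_extension K x\<close>, whose dimension is the degree of the minimal polynomial
  \<open>Irr K x\<close>. Reversing this list gives the witness of type \<open>poly\<close>.\<close>

lemma polynomial_of_ext_degree:
  fixes x :: "'a::field"
  assumes K: "subfield K ring_of_type_algebra" and x: "algebraic_elem K x"
  shows "\<exists>P. P \<in> polys K \<and> P \<noteq> 0 \<and> poly P x = 0 \<and> degree P \<le> ext_degree K x"
    and "P \<in> polys K \<Longrightarrow> P \<noteq> 0 \<Longrightarrow> poly P x = 0 \<Longrightarrow> ext_degree K x \<le> degree P"
proof -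
  let ?U = "ring_of_type_algebra :: 'a ring"
  interpret field ?U
    by (rule field_from_type_algebra)
  have carrier: "carrier ?U = UNIV" and zero: "\<zero>\<^bsub>?U\<^esub> = 0"
    by (simp_all add: ring_of_type_algebra_def)
  have alg: "(algebraic over K) x"
    using x by (simp add: algebraic_elem_def)
  have xc: "x \<in> carrier ?U" and sub: "insert x K \<subseteq> carrier ?U"
    by (simp_all add: carrier)
  have subfield_ext: "subfield (simple_extension K x) ?U"
    using simple_extension_is_subfield [OF K xc] alg by simp
  have "generate_field ?U (insert x K) \<subseteq> simple_extension K x"
    using simple_extension_mem [OF subfieldE(1) [OF K] xc] simple_extension_incl [OF subfieldE(3) [OF K] xc]
    by (intro generate_field_min_subfield1 [OF sub subfield_ext]) auto
  moreover have "simple_extension K x \<subseteq> generate_field ?U (insert x K)"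
    using generate_field_is_subfield [OF sub] generate_fieldE(2) [OF sub refl]
    by (intro simple_extension_subring_incl subfieldE(1)) auto
  ultimately have "generate_field ?U (insert x K) = simple_extension K x"
    by blast
  then have deg: "ext_degree K x = Polynomials.degree (Irr K x)"
    using simple_extension_dim [OF K xc alg] by (simp add: ext_degree_def)
  note Irr = IrrE [OF K xc alg]
  have poly: "polynomial\<^bsub>?U\<^esub> K (Irr K x)" "Irr K x \<noteq> []"
    using Irr(1) pirreducibleE(1) [OF subfieldE(1) [OF K] Irr(1,2)] by (auto simp: univ_poly_def)
  then have hd: "set (Irr K x) \<subseteq> K" "hd (Irr K x) \<noteq> 0"
    by (auto simp: polynomial_def zero)
  define M where "M = Poly (rev (Irr K x))"
  have coeffs: "coeffs M = rev (Irr K x)"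
    using hd poly by (simp add: M_def coeffs_Poly strip_while_def hd_conv_nth, cases "Irr K x") auto
  then have "M \<noteq> 0"
    using poly by auto
  moreover have "poly M x = 0"
    using Irr(4) by (simp add: M_def poly_Poly_rev zero)
  moreover have "degree M = ext_degree K x"
    by (simp add: deg degree_eq_length_coeffs coeffs)
  moreover have "poly.coeff M i \<in> K" for i
  proof -
    have "0 \<in> K"
      using subringE(2) [OF subfieldE(1) [OF K]] zero by simp
    then show ?thesis
      using hd(1) nth_mem [of i "rev (Irr K x)"] by (auto simp: M_def coeff_Poly_eq nth_default_def simp del: nth_mem)
  qed
  ultimately show "\<exists>P. P \<in> polys K \<and> P \<noteq> 0 \<and> poly P x = 0 \<and> degree P \<le> ext_degree K x"
    unfolding polys_def by (intro exI [of _ M]) auto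
  show "ext_degree K x \<le> degree P" if P: "P \<in> polys K" "P \<noteq> 0" "poly P x = 0"
  proof -
    have ne: "rev (coeffs P) \<noteq> []"
      using P by simp
    have "polynomial\<^bsub>?U\<^esub> K (rev (coeffs P))"
      using P by (auto simp: polynomial_def zero hd_rev last_coeffs_eq_coeff_degree polys_def coeffs_def)
    then have mem: "rev (coeffs P) \<in> carrier (K [X]\<^bsub>?U\<^esub>)"
      by (simp add: univ_poly_def)
    have "eval (rev (coeffs P)) x = 0"
      using P by (simp flip: poly_Poly_rev)
    then have "Irr K x pdivides\<^bsub>?U\<^esub> rev (coeffs P)"
      by (intro Irr_minimal [OF K xc alg mem]) (simp add: zero)
    then have "Polynomials.degree (Irr K x) \<le> Polynomials.degree (rev (coeffs P))"
      by (rule pdivides_imp_degree_le [OF subfieldE(1) [OF K] Irr(1) mem ne])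
    then show ?thesis
      by (simp add: deg degree_eq_length_coeffs)
  qed
qed

lemma algebraic_elemI:
  fixes x :: "'a::field"
  assumes P: "P \<in> polys K" "P \<noteq> 0" "poly P x = 0"
  shows "algebraic_elem K x"
proof -
  let ?U = "ring_of_type_algebra :: 'a ring"
  interpret field ?U
    by (rule field_from_type_algebra)
  have zero: "\<zero>\<^bsub>?U\<^esub> = 0"
    by (simp add: ring_of_type_algebra_def)
  have "polynomial\<^bsub>?U\<^esub> K (rev (coeffs P))"
    using P by (auto simp: polynomial_def zero hd_rev last_coeffs_eq_coeff_degree polys_def coeffs_def)
  then have "rev (coeffs P) \<in> carrier (K [X]\<^bsub>?U\<^esub>)"
    by (simp add: univ_poly_def)
  moreover have "eval (rev (coeffs P)) x = \<zero>\<^bsub>?U\<^esub>"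
    using P by (simp add: zero flip: poly_Poly_rev)
  ultimately show ?thesis
    using P algebraicI [of "rev (coeffs P)" K x] by (auto simp: algebraic_elem_def over_def)
qed

section \<open>Fractions of polynomials\<close>

definition fractions :: "'a::idom set \<Rightarrow> 'a fract set"
  where "fractions R = {Fract a b | a b. a \<in> R \<and> b \<in> R \<and> b \<noteq> 0}"

lemma Fract_in_fractions: "a \<in> R \<Longrightarrow> b \<in> R \<Longrightarrow> b \<noteq> 0 \<Longrightarrow> Fract a b \<in> fractions R"
  by (auto simp: fractions_def)

lemma (in idom_subring) subfield_fractions: "subfield (fractions R) ring_of_type_algebra"
proof (rule subfield_of_typeI)
  show "1 \<in> fractions R"
    using one_mem unfolding fractions_def One_fract_def
    by (intro CollectI exI [of _ 1] conjI) simp_all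
next
  fix x y assume "x \<in> fractions R" "y \<in> fractions R"
  then obtain a b c d where *: "a \<in> R" "b \<in> R" "b \<noteq> 0" "c \<in> R" "d \<in> R" "d \<noteq> 0"
    "x = Fract a b" "y = Fract c d"
    by (auto simp: fractions_def)
  then have "x - y = Fract (a * d - c * b) (b * d)" "x * y = Fract (a * c) (b * d)"
    by simp_all
  then show "x - y \<in> fractions R" "x * y \<in> fractions R"
    using * by (auto intro!: Fract_in_fractions diff_mem mult_mem)
next
  fix x assume "x \<in> fractions R"
  then obtain a b where *: "a \<in> R" "b \<in> R" "b \<noteq> 0" "x = Fract a b"
    by (auto simp: fractions_def)
  show "inverse x \<in> fractions R"
  proof (cases "a = 0")
    case True
    then have "inverse x = Fract 0 1"
      using * by (simp add: fract_collapse)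
    then show ?thesis
      using one_mem zero_mem by (simp add: Fract_in_fractions)
  next
    case False
    then show ?thesis
      using * by (auto simp: fractions_def)
  qed
qed

lemma (in idom_subring) common_denominator:
  assumes "finite I" "\<And>i. i \<in> I \<Longrightarrow> x i \<in> fractions R"
  shows "\<exists>D\<in>R. D \<noteq> 0 \<and> (\<forall>i\<in>I. \<exists>c\<in>R. Fract D 1 * x i = Fract c 1)"
  using assms
proof (induction I rule: finite_induct)
  case empty
  then show ?case using one_mem by (auto intro!: bexI [of _ 1])
next
  case (insert j I)
  then obtain D where D: "D \<in> R" "D \<noteq> 0" "\<forall>i\<in>I. \<exists>c\<in>R. Fract D 1 * x i = Fract c 1"
    by auto
  obtain a b where ab: "a \<in> R" "b \<in> R" "b \<noteq> 0" "x j = Fract a b"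
    using insert.prems [of j] by (auto simp: fractions_def)
  have "\<exists>c\<in>R. Fract (D * b) 1 * x i = Fract c 1" if "i \<in> insert j I" for i
  proof (cases "i = j")
    case True
    then have "Fract (D * b) 1 * x i = Fract (D * a) 1"
      using ab by (simp add: eq_fract)
    then show ?thesis using D ab mult_mem by blast
  next
    case False
    then have "i \<in> I"
      using that by simp
    then obtain c where c: "c \<in> R" "Fract D 1 * x i = Fract c 1"
      using D(3) by (elim ballE [of _ _ i] bexE) auto
    have "Fract (D * b) 1 * x i = Fract b 1 * (Fract D 1 * x i)"
    proof -
      have "Fract (D * b) 1 = Fract b 1 * Fract D 1"
        by (simp add: mult.commute)
      then show ?thesis by (simp only: mult.assoc)
    qed
    also have "\<dots> = Fract (b * c) 1"
      using c by simp
    finally show ?thesis using c ab mult_mem by blast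
  qed
  then show ?case
    using D ab by (intro bexI [of _ "D * b"]) (auto intro: mult_mem)
qed

lemma poly_Fract: "poly (map_poly (\<lambda>a. Fract a 1) P) (Fract x 1) = Fract (poly P x) 1"
  by (induction P) (simp_all add: map_poly_pCons Zero_fract_def [symmetric])

lemma (in idom_subring) clear_denominators:
  assumes P: "P \<in> polys (fractions R)" "P \<noteq> 0" "poly P (Fract x 1) = 0"
  shows "\<exists>Q. Q \<in> polys R \<and> Q \<noteq> 0 \<and> poly Q x = 0 \<and> degree Q \<le> degree P"
proof -
  obtain D where D: "D \<in> R" "D \<noteq> 0" "\<And>i. i \<le> degree P \<Longrightarrow> \<exists>c\<in>R. Fract D 1 * coeff P i = Fract c 1"
    using common_denominator [of "{..degree P}" "coeff P"] polys_coeff [OF P(1)] by auto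
  have "\<exists>c\<in>R. Fract D 1 * coeff P i = Fract c 1" for i
  proof (cases "i \<le> degree P")
    case False
    then show ?thesis
      using zero_mem by (intro bexI [of _ 0]) (simp_all add: coeff_eq_0 Zero_fract_def [symmetric])
  qed (rule D(3))
  then obtain c where c: "\<And>i. c i \<in> R" "\<And>i. Fract D 1 * coeff P i = Fract (c i) 1"
    by metis
  have D0: "Fract D 1 \<noteq> 0"
    using D by (simp add: eq_fract Zero_fract_def)
  have "c i = 0 \<longleftrightarrow> Fract (c i) 1 = 0" for i
    by (simp add: eq_fract Zero_fract_def)
  then have c0: "c i = 0 \<longleftrightarrow> coeff P i = 0" for i
    using c(2) [of i] D0 by (metis mult_eq_0_iff)
  then have coeff: "coeff (Abs_poly c) i = c i" for i
    by (subst coeff_Abs_poly [of "degree P"]) (auto simp: coeff_eq_0)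
  have "smult (Fract D 1) P = map_poly (\<lambda>a. Fract a 1) (Abs_poly c)"
    by (intro poly_eqI) (simp add: coeff_map_poly coeff c Zero_fract_def [symmetric])
  then have "Fract (poly (Abs_poly c) x) 1 = poly (smult (Fract D 1) P) (Fract x 1)"
    by (simp only: poly_Fract)
  then have "Fract (poly (Abs_poly c) x) 1 = 0"
    using P(3) by simp
  then have "poly (Abs_poly c) x = 0"
    by (simp add: eq_fract Zero_fract_def)
  moreover have "Abs_poly c \<noteq> 0"
    using P(2) by (auto simp: poly_eq_iff coeff c0)
  moreover have "degree (Abs_poly c) \<le> degree P"
    by (intro degree_le) (simp add: coeff c0 coeff_eq_0)
  moreover have "Abs_poly c \<in> polys R"
    using c(1) by (simp add: polys_def coeff)
  ultimately show ?thesis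
    by blast
qed

lemma mfps_of_mpoly_mem: "mfps_of_mpoly P \<in> mpolys UNIV"
  by (simp add: mpolys_UNIV mfps_of_mpoly_def)

lemma mfps_of_mpoly_Abs: "g \<in> mpolys UNIV \<Longrightarrow> mfps_of_mpoly (Abs_poly_mapping (mfps_nth g)) = g"
  by (simp add: mpolys_UNIV mfps_of_mpoly_def Abs_poly_mapping_inverse mfps_nth_inverse)

lemma mfps_of_mpoly_0 [simp]: "mfps_of_mpoly P = 0 \<longleftrightarrow> P = 0"
  by (simp add: mfps_of_mpoly_def mfps_eq_iff poly_mapping_eq_iff fun_eq_iff)

lemma rat_functions_eq: "rat_functions = fractions (mpolys UNIV)"
proof (intro equalityI subsetI)
  fix x assume "x \<in> fractions (mpolys UNIV :: (rat, 'a) mfps set)"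
  then obtain a b where "a \<in> mpolys UNIV" "b \<in> mpolys UNIV" "b \<noteq> 0" "x = Fract a b"
    by (auto simp: fractions_def)
  then show "x \<in> rat_functions"
    unfolding rat_functions_def
    by (intro CollectI exI [of _ "Abs_poly_mapping (mfps_nth a)"] exI [of _ "Abs_poly_mapping (mfps_nth b)"])
       (simp add: mfps_of_mpoly_Abs flip: mfps_of_mpoly_0)
qed (auto simp: rat_functions_def intro!: Fract_in_fractions mfps_of_mpoly_mem)

section \<open>Reduction modulo a prime\<close>

lemma mfps_nth_of_int [simp]: "mfps_nth (mfps_of_int f) m = of_int (mfps_nth f m)"
  by (simp add: mfps_of_int_def)

lemma mfps_of_int_0 [simp]: "mfps_of_int 0 = 0"
  by (simp add: mfps_eq_iff)

lemma mfps_of_int_add: "mfps_of_int (f + g) = mfps_of_int f + mfps_of_int g"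
  by (simp add: mfps_eq_iff)

lemma mfps_of_int_mult: "mfps_of_int (f * g) = (mfps_of_int f * mfps_of_int g :: ('a::comm_ring_1, 'n::finite) mfps)"
  by (simp add: mfps_eq_iff mfps_nth_mult case_prod_beta)

lemma poly_mfps_of_int:
  "poly (map_poly mfps_of_int P) (mfps_of_int f) = (mfps_of_int (poly P f) :: ('a::comm_ring_1, 'n::finite) mfps)"
  by (induction P) (simp_all add: map_poly_pCons mfps_of_int_add mfps_of_int_mult)

lemma clear_integer_denominators:
  assumes "finite S"
  shows "\<exists>D. D \<noteq> 0 \<and> (\<forall>s\<in>S. \<exists>z. of_int D * c s = (of_int z :: rat))"
  using assms
proof (induction S rule: finite_induct)
  case (insert t S)
  then obtain D where D: "D \<noteq> 0" "\<forall>s\<in>S. \<exists>z. of_int D * c s = (of_int z :: rat)"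
    by blast
  obtain a b where ab: "quotient_of (c t) = (a, b)"
    by fastforce
  then have b: "b > 0" and ct: "c t = of_int a / of_int b"
    by (auto dest: quotient_of_denom_pos quotient_of_div)
  have "\<exists>z. of_int (D * b) * c s = (of_int z :: rat)" if "s \<in> insert t S" for s
  proof (cases "s = t")
    case True
    then show ?thesis
      using b by (intro exI [of _ "D * a"]) (simp add: ct)
  next
    case False
    then have "s \<in> S"
      using that by simp
    then obtain z where "of_int D * c s = (of_int z :: rat)"
      using D(2) by blast
    then show ?thesis
      by (intro exI [of _ "b * z"]) (simp add: mult_ac)
  qed
  then show ?case
    using D b by (intro exI [of _ "D * b"]) auto
qed (auto intro: exI [of _ 1])

text \<open>The aim is a multiple that survives reduction modulo \<open>p\<close>. Dividing the
  integral coefficients by their gcd \<open>g\<close> achieves this: if \<open>p\<close> divided all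
  quotients, then \<open>p * g\<close> would divide \<open>g\<close>.\<close>

lemma primitive_integer_multiple:
  fixes c :: "'s \<Rightarrow> rat"
  assumes "finite S" "s0 \<in> S" "c s0 \<noteq> 0" and p: "p > (1::int)"
  shows "\<exists>D z. D \<noteq> 0 \<and> (\<forall>s\<in>S. of_int (z s) = D * c s) \<and> (\<exists>s\<in>S. \<not> p dvd z s)"
proof -
  obtain D where D: "D \<noteq> 0" "\<forall>s\<in>S. \<exists>z. of_int D * c s = (of_int z :: rat)"
    using clear_integer_denominators [OF assms(1)] by blast
  then obtain z where z: "\<And>s. s \<in> S \<Longrightarrow> of_int D * c s = (of_int (z s) :: rat)"
    by metis
  define g where "g = Gcd (z ` S)"
  have "z s0 \<noteq> 0"
    using z [OF assms(2)] D(1) assms(3) by auto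
  then have g: "g \<noteq> 0"
    using assms(2) by (auto simp: g_def)
  have dvd: "g dvd z s" if "s \<in> S" for s
    using that by (simp add: g_def)
  have "\<exists>s\<in>S. \<not> p dvd z s div g"
  proof (rule ccontr)
    assume "\<not> ?thesis"
    then have "p * g dvd z s" if "s \<in> S" for s
      using that dvd [OF that] g by (metis dvd_div_iff_mult)
    then have "p * g dvd g"
      unfolding g_def by (intro Gcd_greatest) auto
    then have "p dvd 1"
      using g by (metis dvd_times_right_cancel_iff mult_1)
    with p show False by simp
  qed
  moreover have "of_int (z s div g) = (of_int D / of_int g) * c s" if "s \<in> S" for s
    using z [OF that] dvd [OF that] g by (simp add: of_int_div field_simps)
  ultimately show ?thesis
    using D(1) g by (intro exI [of _ "of_int D / of_int g"] exI [of _ "\<lambda>s. z s div g"]) auto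
qed

lemma of_int_mod_ring_eq_0: "(of_int z :: 'p::prime_card mod_ring) = 0 \<longleftrightarrow> int CARD('p) dvd z"
  using of_int_eq_0_iff_char_dvd [of z, where 'a = "'p mod_ring"] by simp

text \<open>The relation is carried through the integers, which embed into the rationals and map
  onto the prime field. Supports can only shrink, and this last conclusion transports every weight
  bound at once.\<close>

lemma reduce_annihilator:
  fixes f :: "(int, 'n::finite) mfps"
  assumes B: "B \<in> polys (mpolys UNIV)" "B \<noteq> 0" "poly B (mfps_of_int f :: (rat, 'n) mfps) = 0"
  shows "\<exists>C :: ('p::prime_card mod_ring, 'n) mfps poly. C \<in> polys (mpolys UNIV) \<and> C \<noteq> 0 \<and>
    poly C (mfps_of_int f) = 0 \<and> degree C \<le> degree B \<and>
    (\<forall>i m. mfps_nth (coeff C i) m \<noteq> 0 \<longrightarrow> mfps_nth (coeff B i) m \<noteq> 0)"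
proof -
  define b where "b s = mfps_nth (coeff B (fst s)) (snd s)" for s
  define S where "S = Sigma {..degree B} (\<lambda>i. {m. mfps_nth (coeff B i) m \<noteq> 0})"
  have S: "finite S"
    unfolding S_def using polys_coeff [OF B(1)] by (auto simp: mpolys_UNIV)
  have S_iff: "s \<in> S \<longleftrightarrow> b s \<noteq> 0" for s
    by (cases s) (auto simp: S_def b_def coeff_eq_0 intro: ccontr [of "_ \<le> _"])
  obtain m where "mfps_nth (lead_coeff B) m \<noteq> 0"
    using B(2) by (metis leading_coeff_0_iff mfps_eqI mfps_nth_0)
  then have s0: "b (degree B, m) \<noteq> 0"
    by (simp add: b_def)
  obtain D z where Dz: "D \<noteq> 0" "\<And>s. s \<in> S \<Longrightarrow> of_int (z s) = D * b s" "\<exists>s\<in>S. \<not> int CARD('p) dvd z s"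
  proof -
    have "int CARD('p) > 1"
      using prime_gt_1_nat [OF prime_card [where 'a = 'p]] by simp
    then show thesis
      using primitive_integer_multiple [of S "(degree B, m)" b "int CARD('p)"] S s0 S_iff that by blast
  qed
  \<comment> \<open>\<open>z\<close> is controlled on \<open>S\<close> only, hence the explicit 0
    elsewhere.\<close>
  define c where "c i = Abs_mfps (\<lambda>m. if (i, m) \<in> S then z (i, m) else 0)" for i
  have nth_c: "mfps_nth (c i) m = (if (i, m) \<in> S then z (i, m) else 0)" for i m
    by (simp add: c_def)
  have "c i = 0" if "i > degree B" for i
    using that by (auto simp: mfps_eq_iff nth_c S_def)
  then have coeff: "coeff (Abs_poly c) i = c i" for i
    by (subst coeff_Abs_poly) auto
  have "map_poly mfps_of_int (Abs_poly c) = smult (mfps_term D 0) B"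
  proof (intro poly_eqI mfps_eqI)
    fix i m
    have "mfps_nth (mfps_term D 0 * coeff B i) (0 + m) = D * mfps_nth (coeff B i) m"
      by (rule mfps_nth_term_mult_add)
    then show "mfps_nth (coeff (map_poly mfps_of_int (Abs_poly c)) i) m
        = mfps_nth (coeff (smult (mfps_term D 0) B) i) m"
      using Dz(2) [of "(i, m)"] S_iff [of "(i, m)"] by (auto simp: coeff_map_poly coeff nth_c b_def)
  qed
  then have "mfps_of_int (poly (Abs_poly c) f) = (0 :: (rat, 'n) mfps)"
    using B(3) by (simp flip: poly_mfps_of_int)
  then have root: "poly (Abs_poly c) f = 0"
    by (simp add: mfps_eq_iff)
  define C :: "('p mod_ring, 'n) mfps poly" where "C = map_poly mfps_of_int (Abs_poly c)"
  have nth_C: "mfps_nth (coeff C i) m = (if (i, m) \<in> S then of_int (z (i, m)) else 0)" for i m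
    by (simp add: C_def coeff_map_poly coeff nth_c)
  have supp: "mfps_nth (coeff B i) m \<noteq> 0" if "mfps_nth (coeff C i) m \<noteq> 0" for i m
    using that S_iff [of "(i, m)"] by (auto simp: nth_C b_def split: if_splits)
  have "coeff C i \<in> mpolys UNIV" for i
  proof -
    have "{m. mfps_nth (coeff C i) m \<noteq> 0} \<subseteq> {m. mfps_nth (coeff B i) m \<noteq> 0}"
      using supp by auto
    then show ?thesis
      using polys_coeff [OF B(1), of i] by (auto simp: mpolys_UNIV intro: finite_subset)
  qed
  moreover have "C \<noteq> 0"
  proof -
    obtain i m where "(i, m) \<in> S" "\<not> int CARD('p) dvd z (i, m)"
      using Dz(3) by auto
    then have "mfps_nth (coeff C i) m \<noteq> 0"
      by (simp add: nth_C of_int_mod_ring_eq_0)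
    then show ?thesis by auto
  qed
  moreover have "poly C (mfps_of_int f) = 0"
    by (simp add: C_def poly_mfps_of_int root)
  moreover have "degree C \<le> degree B"
  proof (rule degree_le, intro allI impI)
    fix i assume "i > degree B"
    then show "coeff C i = 0"
      by (auto simp: mfps_eq_iff nth_C S_def)
  qed
  ultimately show ?thesis
    using supp by (auto simp: polys_def)
qed

lemma annihilates_mpolys:
  assumes "A \<noteq> 0" "annihilates A f"
  shows "map_poly mfps_of_mpoly A \<in> polys (mpolys UNIV)" "map_poly mfps_of_mpoly A \<noteq> 0"
    "poly (map_poly mfps_of_mpoly A) (mfps_of_int f) = 0"
  using assms by (auto simp: polys_def coeff_map_poly mfps_of_mpoly_mem annihilates_def poly_eq_iff)

lemma annihilates_Abs:
  fixes f :: "(int, 'n::finite) mfps" and B :: "(rat, 'n) mfps poly"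
  assumes B: "B \<in> polys (mpolys UNIV)" "B \<noteq> 0" "poly B (mfps_of_int f) = 0"
  shows "\<exists>A. A \<noteq> 0 \<and> annihilates A f"
proof -
  define A where "A = map_poly (\<lambda>g. Abs_poly_mapping (mfps_nth g)) B"
  have "Abs_poly_mapping (mfps_nth 0) = (0 :: ('n \<Rightarrow>\<^sub>0 nat) \<Rightarrow>\<^sub>0 rat)"
    unfolding mfps_nth_0 [abs_def] by (rule poly_mapping_eqI) (simp add: Abs_poly_mapping_inverse)
  then have "map_poly mfps_of_mpoly A = B"
    using polys_coeff [OF B(1)] by (intro poly_eqI) (simp add: A_def coeff_map_poly mfps_of_mpoly_Abs)
  then show ?thesis
    using B by (intro exI [of _ A]) (auto simp: annihilates_def)
qed

lemma finite_t_monomials: "finite (t_monomials A)"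
  by (auto simp: t_monomials_def)

lemma coeff_in_t_monomials:
  assumes "mfps_nth (coeff (map_poly mfps_of_mpoly A) i) m \<noteq> 0"
  shows "m \<in> t_monomials A"
proof -
  have "Poly_Mapping.lookup (coeff A i) m \<noteq> 0"
    using assms coeff_map_poly [of mfps_of_mpoly A i] by (simp add: mfps_of_mpoly_def [of "coeff A i"])
  moreover from this have "coeff A i \<noteq> 0"
    by auto
  then have "coeff A i \<in> set (coeffs A)"
    by (intro coeff_in_coeffs le_degree) auto
  ultimately show ?thesis
    unfolding t_monomials_def in_keys_iff [symmetric] by blast
qed

text \<open>The witness \<open>A0\<close> ensures that the \<open>LEAST\<close> in the height is
  attained.\<close>

lemma partial_height_bound:
  fixes f :: "(int, 'n::finite) mfps"
  assumes "A0 \<noteq> 0" "annihilates A0 f"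
  shows "\<exists>A. A \<noteq> 0 \<and> annihilates A f \<and>
    (\<forall>j. weight_le (\<lambda>x. of_bool (x = i)) (partial_height f i) (coeff (map_poly mfps_of_mpoly A) j))"
proof -
  obtain A where A: "A \<noteq> 0" "annihilates A f" "partial_degree i A = partial_height f i"
    unfolding partial_height_def using LeastI_ex [of "\<lambda>k. \<exists>A. A \<noteq> 0 \<and> annihilates A f \<and> partial_degree i A = k"] assms by blast
  have "weight_le (\<lambda>x. of_bool (x = i)) (partial_height f i) (coeff (map_poly mfps_of_mpoly A) j)" for j
    unfolding weight_le_def
  proof (intro allI impI)
    fix m assume "mfps_nth (coeff (map_poly mfps_of_mpoly A) j) m \<noteq> 0"
    from coeff_in_t_monomials [OF this] have "Poly_Mapping.lookup m i \<le> partial_degree i A"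
      unfolding partial_degree_def using finite_t_monomials [of A] by (intro Max_ge) auto
    moreover have "weight (\<lambda>x. of_bool (x = i)) m = Poly_Mapping.lookup m i"
    proof -
      have "weight (\<lambda>x. of_bool (x = i)) m = (\<Sum>x\<in>UNIV. if x = i then Poly_Mapping.lookup m x else 0)"
        by (intro sum.cong) auto
      then show ?thesis by simp
    qed
    ultimately show "weight (\<lambda>x. of_bool (x = i)) m \<le> partial_height f i"
      using A(3) by simp
  qed
  with A show ?thesis by blast
qed

lemma total_height_bound:
  fixes f :: "(int, 'n::finite) mfps"
  assumes "A0 \<noteq> 0" "annihilates A0 f"
  shows "\<exists>A. A \<noteq> 0 \<and> annihilates A f \<and>
    (\<forall>j. weight_le (\<lambda>x. 1) (total_height f) (coeff (map_poly mfps_of_mpoly A) j))"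
proof -
  obtain A where A: "A \<noteq> 0" "annihilates A f" "total_degree A = total_height f"
    unfolding total_height_def using LeastI_ex [of "\<lambda>k. \<exists>A. A \<noteq> 0 \<and> annihilates A f \<and> total_degree A = k"] assms by blast
  have "weight_le (\<lambda>x. 1) (total_height f) (coeff (map_poly mfps_of_mpoly A) j)" for j
    unfolding weight_le_def
  proof (intro allI impI)
    fix m assume "mfps_nth (coeff (map_poly mfps_of_mpoly A) j) m \<noteq> 0"
    from coeff_in_t_monomials [OF this] have "(\<Sum>i\<in>UNIV. Poly_Mapping.lookup m i) \<le> total_degree A"
      unfolding total_degree_def using finite_t_monomials [of A] by (intro Max_ge) auto
    then show "weight (\<lambda>x. 1) m \<le> total_height f"
      using A(3) by simp
  qed
  with A show ?thesis by blast
qed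

section \<open>Linear dependence over a domain\<close>

text \<open>Gaussian elimination without division: an unknown \<open>k\<close> with nonzero
  coefficient in equation \<open>i\<close> is removed from the remaining equations by
  cross-multiplication.\<close>

lemma linear_dependence:
  fixes c :: "'j \<Rightarrow> 'i \<Rightarrow> 'a::idom"
  assumes "finite I" "finite J" "card I < card J"
  shows "\<exists>e. (\<exists>j\<in>J. e j \<noteq> 0) \<and> (\<forall>i\<in>I. (\<Sum>j\<in>J. e j * c j i) = 0)"
  using assms
proof (induction I arbitrary: J c rule: finite_induct)
  case empty
  then obtain j where "j \<in> J" by fastforce
  then show ?case by (intro exI [of _ "\<lambda>_. 1"]) auto
next
  case (insert i I)
  show ?case
  proof (cases "\<forall>j\<in>J. c j i = 0")
    case True
    moreover have "card I < card J"
      using insert by simp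
    ultimately obtain e where "\<exists>j\<in>J. e j \<noteq> 0" "\<forall>i\<in>I. (\<Sum>j\<in>J. e j * c j i) = 0"
      using insert.IH [of J c] insert.prems by blast
    with True show ?thesis
      by (intro exI [of _ e]) simp
  next
    case False
    then obtain k where k: "k \<in> J" "c k i \<noteq> 0" by blast
    let ?J = "J - {k}"
    have "finite ?J" "card I < card ?J"
      using insert k by auto
    from insert.IH [OF this, of "\<lambda>j l. c k i * c j l - c j i * c k l"]
    obtain e where e: "\<exists>j\<in>?J. e j \<noteq> 0"
      "\<And>l. l \<in> I \<Longrightarrow> (\<Sum>j\<in>?J. e j * (c k i * c j l - c j i * c k l)) = 0"
      by blast
    \<comment> \<open>Scaling the other unknowns by the pivot \<open>c k i\<close> lets equation
      \<open>i\<close> determine the value at \<open>k\<close> without a quotient.\<close>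
    define e' where "e' j = (if j = k then - (\<Sum>j\<in>?J. e j * c j i) else c k i * e j)" for j
    have sum: "(\<Sum>j\<in>J. e' j * c j l) = (\<Sum>j\<in>?J. e j * (c k i * c j l - c j i * c k l))" for l
    proof -
      have "(\<Sum>j\<in>J. e' j * c j l) = e' k * c k l + (\<Sum>j\<in>?J. e' j * c j l)"
        using k insert.prems by (simp add: sum.remove)
      also have "(\<Sum>j\<in>?J. e' j * c j l) = (\<Sum>j\<in>?J. c k i * e j * c j l)"
        by (intro sum.cong) (auto simp: e'_def)
      also have "e' k * c k l = - (\<Sum>j\<in>?J. e j * c j i * c k l)"
        by (simp add: e'_def sum_distrib_right)
      finally show ?thesis
        by (simp add: sum_subtractf right_diff_distrib mult_ac)
    qed
    have "(\<Sum>j\<in>J. e' j * c j l) = 0" if "l \<in> insert i I" for l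
      using that e(2) [of l] unfolding sum by (cases "l = i") (auto simp: mult.commute)
    moreover have "\<exists>j\<in>J. e' j \<noteq> 0"
      using e(1) k by (auto simp: e'_def)
    ultimately show ?thesis by blast
  qed
qed

section \<open>Univariate power series over a prime field\<close>

text \<open>From \<open>g = c + X h\<close> one gets \<open>g^p = c + X^p h^p\<close>, which lowers
  the index by \<open>p\<close>.\<close>

lemma fps_nth_frobenius:
  fixes g :: "'p::prime_card mod_ring fps"
  shows "fps_nth (g ^ CARD('p)) n = (if CARD('p) dvd n then fps_nth g (n div CARD('p)) else 0)"
proof (induction n arbitrary: g rule: less_induct)
  case (less n)
  let ?p = "CARD('p)"
  have p: "?p > 0"
    using prime_gt_0_nat [OF prime_card [where 'a = 'p]] by simp
  have "g = fps_const (fps_nth g 0) + fps_X * fps_shift 1 g"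
    by (rule fps_ext) (simp split: nat.splits)
  then have "g ^ ?p = (fps_const (fps_nth g 0) + fps_X * fps_shift 1 g) ^ ?p"
    by simp
  also have "\<dots> = fps_const (fps_nth g 0) ^ ?p + (fps_X * fps_shift 1 g) ^ ?p"
    by (rule freshmans_dream) (simp_all add: prime_card)
  finally have eq: "g ^ ?p = fps_const (fps_nth g 0) + fps_X ^ ?p * fps_shift 1 g ^ ?p"
    by (simp add: mod_ring_power_card power_mult_distrib)
  show ?case
  proof (cases "n < ?p")
    case True
    then show ?thesis
      by (auto simp: eq fps_X_power_mult_nth dest: dvd_imp_le)
  next
    case False
    then obtain k where k: "n = ?p + k"
      by (metis le_Suc_ex not_le)
    then have "fps_nth (fps_shift 1 g ^ ?p) k = (if ?p dvd k then fps_nth (fps_shift 1 g) (k div ?p) else 0)"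
      using p by (intro less) simp
    moreover have "n \<noteq> 0"
      using k p by simp
    ultimately show ?thesis
      using p by (simp add: eq fps_X_power_mult_nth k)
  qed
qed

section \<open>Sections of univariate series and linear combinations over rational functions\<close>

definition fps_section :: "nat \<Rightarrow> nat \<Rightarrow> 'a fps \<Rightarrow> 'a fps"
  where "fps_section k r g = Abs_fps (\<lambda>i. fps_nth g (k * i + r))"

lemma fps_section_decomposition:
  fixes g :: "'p::prime_card mod_ring fps"
  shows "g = (\<Sum>r<CARD('p). fps_X ^ r * fps_section CARD('p) r g ^ CARD('p))"
proof (rule fps_ext)
  fix n
  let ?p = "CARD('p)"
  have p: "?p > 0"
    using prime_gt_0_nat [OF prime_card [where 'a = 'p]] by simp
  have "fps_nth (fps_X ^ r * fps_section ?p r g ^ ?p) n = (if r = n mod ?p then fps_nth g n else 0)"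
    if r: "r < ?p" for r
  proof -
    have "r \<le> n \<and> ?p dvd n - r \<longleftrightarrow> r = n mod ?p"
    proof
      assume *: "r \<le> n \<and> ?p dvd n - r"
      then obtain l where "n - r = ?p * l" by blast
      then have "n = r + ?p * l" using * by simp
      then show "r = n mod ?p" using r by simp
    qed (auto simp: minus_mod_eq_mult_div mod_less_eq_dividend)
    moreover have "?p * ((n - n mod ?p) div ?p) + n mod ?p = n"
      using p by (simp add: minus_mod_eq_mult_div)
    ultimately show ?thesis
      using mod_less_eq_dividend [of n ?p]
      by (auto simp: fps_X_power_mult_nth fps_nth_frobenius fps_section_def simp del: mod_less_eq_dividend)
  qed
  then have "fps_nth (\<Sum>r<?p. fps_X ^ r * fps_section ?p r g ^ ?p) n = (\<Sum>r<?p. if r = n mod ?p then fps_nth g n else 0)"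
    by (simp add: fps_sum_nth)
  then show "fps_nth g n = fps_nth (\<Sum>r<?p. fps_X ^ r * fps_section ?p r g ^ ?p) n"
    using p by simp
qed

text \<open>The denominator \<open>q\<close> is moved to the side of \<open>w\<close> so that
  everything stays among power series. The vectors form an indexed family, so \<open>B\<close>
  remains the index set when all of them are raised to a power.\<close>

definition rational_span :: "'b set \<Rightarrow> ('b \<Rightarrow> 'a::idom fps) \<Rightarrow> 'a fps set"
  where "rational_span B v = {w. \<exists>q c. q \<noteq> 0 \<and> fps_of_poly q * w = (\<Sum>b\<in>B. fps_of_poly (c b) * v b)}"

lemma rational_span_0: "0 \<in> rational_span B v"
  unfolding rational_span_def by (intro CollectI exI [of _ 1] exI [of _ "\<lambda>_. 0"]) simp

lemma rational_span_add:
  assumes "w \<in> rational_span B v" "w' \<in> rational_span B v"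
  shows "w + w' \<in> rational_span B v"
proof -
  obtain q c q' c' where *: "q \<noteq> 0" "fps_of_poly q * w = (\<Sum>b\<in>B. fps_of_poly (c b) * v b)"
    "q' \<noteq> 0" "fps_of_poly q' * w' = (\<Sum>b\<in>B. fps_of_poly (c' b) * v b)"
    using assms unfolding rational_span_def by blast
  have "fps_of_poly (q * q') * (w + w') = fps_of_poly q' * (fps_of_poly q * w) + fps_of_poly q * (fps_of_poly q' * w')"
    by (simp add: fps_of_poly_mult algebra_simps)
  also have "\<dots> = (\<Sum>b\<in>B. fps_of_poly (q' * c b + q * c' b) * v b)"
    unfolding * by (simp add: fps_of_poly_mult fps_of_poly_add sum_distrib_left sum.distrib algebra_simps)
  finally show ?thesis
    using *(1,3) unfolding rational_span_def
    by (intro CollectI exI [of _ "q * q'"] exI [of _ "\<lambda>b. q' * c b + q * c' b"]) simp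
qed

lemma rational_span_mult:
  assumes "w \<in> rational_span B v"
  shows "fps_of_poly a * w \<in> rational_span B v"
proof -
  obtain q c where *: "q \<noteq> 0" "fps_of_poly q * w = (\<Sum>b\<in>B. fps_of_poly (c b) * v b)"
    using assms unfolding rational_span_def by blast
  have "fps_of_poly q * (fps_of_poly a * w) = fps_of_poly a * (fps_of_poly q * w)"
    by (simp only: mult_ac)
  also have "\<dots> = (\<Sum>b\<in>B. fps_of_poly (a * c b) * v b)"
    unfolding *(2) by (simp add: fps_of_poly_mult sum_distrib_left mult_ac)
  finally show ?thesis
    using *(1) unfolding rational_span_def
    by (intro CollectI exI [of _ q] exI [of _ "\<lambda>b. a * c b"]) simp
qed

lemma rational_span_sum: "(\<And>x. x \<in> A \<Longrightarrow> h x \<in> rational_span B v) \<Longrightarrow> sum h A \<in> rational_span B v"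
  by (induction A rule: infinite_finite_induct) (auto intro: rational_span_0 rational_span_add)

lemma rational_span_frobenius:
  fixes w :: "'p::prime_card mod_ring fps"
  assumes "w \<in> rational_span B v"
  shows "w ^ CARD('p) \<in> rational_span B (\<lambda>b. v b ^ CARD('p))"
proof -
  obtain q c where *: "q \<noteq> 0" "fps_of_poly q * w = (\<Sum>b\<in>B. fps_of_poly (c b) * v b)"
    using assms unfolding rational_span_def by blast
  have "fps_of_poly (q ^ CARD('p)) * w ^ CARD('p) = (fps_of_poly q * w) ^ CARD('p)"
    by (simp add: fps_of_poly_power power_mult_distrib)
  also have "\<dots> = (\<Sum>b\<in>B. (fps_of_poly (c b) * v b) ^ CARD('p))"
    unfolding *(2) by (rule freshmans_dream_sum) (simp_all add: prime_card)
  also have "\<dots> = (\<Sum>b\<in>B. fps_of_poly (c b ^ CARD('p)) * v b ^ CARD('p))"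
    by (simp add: fps_of_poly_power power_mult_distrib)
  finally show ?thesis
    using *(1) unfolding rational_span_def
    by (intro CollectI exI [of _ "q ^ CARD('p)"] exI [of _ "\<lambda>b. c b ^ CARD('p)"]) simp
qed

text \<open>The powers \<open>g, g^p, g^(p^2), \<dots>\<close> up to \<open>g^(p^N)\<close> are all combinations of the
  \<open>p^N\<close>-th powers of a basis of \<open>D\<close>.\<close>

lemma frobenius_relation:
  fixes g :: "'p::prime_card mod_ring fps"
  assumes g: "g \<in> D" and sec: "\<And>u r. u \<in> D \<Longrightarrow> r < CARD('p) \<Longrightarrow> fps_section CARD('p) r u \<in> D"
    and dep: "\<And>B. B \<subseteq> D \<Longrightarrow> finite B \<Longrightarrow> card B = Suc N \<Longrightarrow>
      \<exists>e. (\<exists>b\<in>B. e b \<noteq> 0) \<and> (\<Sum>b\<in>B. fps_of_poly (e b) * b) = 0"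
  shows "\<exists>e. (\<exists>i\<le>N. e i \<noteq> 0) \<and> (\<Sum>i\<le>N. fps_of_poly (e i) * g ^ (CARD('p) ^ i)) = 0"
proof -
  let ?p = "CARD('p)"
  \<comment> \<open>A largest independent set \<open>B\<close> will serve as a basis of the span of
    \<open>D\<close> over the rational functions; \<open>dep\<close> keeps its size at most
    \<open>N\<close>.\<close>
  define indep where "indep B \<longleftrightarrow> B \<subseteq> D \<and> finite B \<and>
    (\<forall>e. (\<Sum>b\<in>B. fps_of_poly (e b) * b) = 0 \<longrightarrow> (\<forall>b\<in>B. e b = 0))" for B
  have card: "card B \<le> N" if B: "indep B" for B
  proof (rule ccontr)
    assume "\<not> card B \<le> N"
    then obtain B' where B': "B' \<subseteq> B" "card B' = Suc N" "finite B'"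
      using obtain_subset_with_card_n [of "Suc N" B] by (auto simp: not_le Suc_le_eq)
    then obtain e where e: "\<exists>b\<in>B'. e b \<noteq> 0" "(\<Sum>b\<in>B'. fps_of_poly (e b) * b) = 0"
      using dep [of B'] B by (auto simp: indep_def)
    have "(\<Sum>b\<in>B. fps_of_poly (if b \<in> B' then e b else 0) * b) = (\<Sum>b\<in>B'. fps_of_poly (e b) * b)"
      using B B' by (intro sum.mono_neutral_cong_right) (auto simp: indep_def)
    with e(2) have "(\<Sum>b\<in>B. fps_of_poly (if b \<in> B' then e b else 0) * b) = 0"
      by simp
    with B have "\<forall>b\<in>B. (if b \<in> B' then e b else 0) = 0"
      unfolding indep_def by (elim conjE allE [of _ "\<lambda>b. if b \<in> B' then e b else 0"]) simp
    moreover obtain b where "b \<in> B'" "e b \<noteq> 0"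
      using e(1) by blast
    ultimately show False
      using B'(1) by (metis subsetD)
  qed
  have "indep {}" by (simp add: indep_def)
  moreover have "\<forall>B. indep B \<longrightarrow> card B < Suc N"
    using card by (simp add: less_Suc_eq_le)
  ultimately obtain B where B: "indep B" and max: "\<And>B'. indep B' \<Longrightarrow> card B' \<le> card B"
    using ex_has_greatest_nat [of indep "{}" card "Suc N"] by (metis less_imp_le)
  have fB: "finite B" using B by (simp add: indep_def)
  have span1: "u \<in> rational_span B (\<lambda>b. b)" if u: "u \<in> D" for u
  proof (cases "u \<in> B")
    case True
    have "(\<Sum>b\<in>B. fps_of_poly (if b = u then 1 else 0) * b) = (\<Sum>b\<in>{u}. fps_of_poly 1 * b)"
      using True fB by (intro sum.mono_neutral_cong_right) auto
    then have "fps_of_poly 1 * u = (\<Sum>b\<in>B. fps_of_poly (if b = u then 1 else 0) * b)"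
      by simp
    then show ?thesis
      unfolding rational_span_def
      by (intro CollectI exI [of _ 1] exI [of _ "\<lambda>b. if b = u then 1 else 0"]) simp
  next
    case False
    have "card (insert u B) > card B"
      using False fB by simp
    then have "\<not> indep (insert u B)"
      using max [of "insert u B"] by linarith
    moreover have "insert u B \<subseteq> D" "finite (insert u B)"
      using B u by (auto simp: indep_def)
    ultimately have "\<exists>e. (\<Sum>b\<in>insert u B. fps_of_poly (e b) * b) = 0 \<and> \<not> (\<forall>b\<in>insert u B. e b = 0)"
      unfolding indep_def by meson
    then obtain e where e: "(\<Sum>b\<in>insert u B. fps_of_poly (e b) * b) = 0" "\<exists>b\<in>insert u B. e b \<noteq> 0"
      by (elim exE conjE) (rule that, auto)
    have sum: "fps_of_poly (e u) * u + (\<Sum>b\<in>B. fps_of_poly (e b) * b) = 0"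
      using e(1) False fB by simp
    have "e u \<noteq> 0"
    proof
      assume "e u = 0"
      with sum B have "\<forall>b\<in>B. e b = 0" by (simp add: indep_def)
      with e(2) \<open>e u = 0\<close> show False by auto
    qed
    moreover have "fps_of_poly (- e u) * u = (\<Sum>b\<in>B. fps_of_poly (e b) * b)"
      using minus_unique [OF sum] by (simp add: fps_of_poly_uminus)
    ultimately show ?thesis
      unfolding rational_span_def by (intro CollectI exI [of _ "- e u"] exI [of _ e]) simp
  qed
  \<comment> \<open>\<open>u\<close> is a combination of \<open>p\<close>-th powers of its sections.
    These lie in \<open>D\<close>, and Frobenius lifts their expansions from level \<open>j\<close>
    to level \<open>j + 1\<close>.\<close>
  have span: "u \<in> rational_span B (\<lambda>b. b ^ (?p ^ j))" if "u \<in> D" for u j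
    using that
  proof (induction j arbitrary: u)
    case 0
    then show ?case using span1 by simp
  next
    case (Suc j)
    have "fps_section ?p r u ^ ?p \<in> rational_span B (\<lambda>b. b ^ (?p ^ Suc j))" if "r < ?p" for r
      using rational_span_frobenius [OF Suc.IH [OF sec [OF Suc.prems that]]]
      by (simp add: mult.commute flip: power_mult)
    then have "(\<Sum>r<?p. fps_of_poly (monom 1 r) * fps_section ?p r u ^ ?p) \<in> rational_span B (\<lambda>b. b ^ (?p ^ Suc j))"
      by (intro rational_span_sum rational_span_mult) auto
    then show ?case
      using fps_section_decomposition [of u] by (simp add: fps_of_poly_monom')
  qed
  \<comment> \<open>Here Frobenius is applied to \<open>g\<close> as well. The choice
    \<open>j = N - i\<close> then brings all these powers to the common level
    \<open>N\<close>.\<close>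
  have "g ^ (?p ^ i) \<in> rational_span B (\<lambda>b. b ^ (?p ^ (j + i)))" for i j
  proof (induction i)
    case 0
    then show ?case using span [OF g] by simp
  next
    case (Suc i)
    then show ?case
      using rational_span_frobenius [OF Suc] by (simp add: mult.commute flip: power_mult)
  qed
  from this [of _ "N - _"] have "g ^ (?p ^ i) \<in> rational_span B (\<lambda>b. b ^ (?p ^ N))" if "i \<le> N" for i
    using that by (metis le_add_diff_inverse2)
  then have "\<forall>i. \<exists>q c. i \<le> N \<longrightarrow> q \<noteq> 0 \<and> fps_of_poly q * g ^ (?p ^ i) = (\<Sum>b\<in>B. fps_of_poly (c b) * b ^ (?p ^ N))"
    unfolding rational_span_def by blast
  from choice [OF this] obtain q where
    "\<forall>i. \<exists>c. i \<le> N \<longrightarrow> q i \<noteq> 0 \<and> fps_of_poly (q i) * g ^ (?p ^ i) = (\<Sum>b\<in>B. fps_of_poly (c b) * b ^ (?p ^ N))" ..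
  from choice [OF this] obtain c where qc: "\<And>i. i \<le> N \<Longrightarrow> q i \<noteq> 0"
    "\<And>i. i \<le> N \<Longrightarrow> fps_of_poly (q i) * g ^ (?p ^ i) = (\<Sum>b\<in>B. fps_of_poly (c i b) * b ^ (?p ^ N))"
    by auto
  \<comment> \<open>There are \<open>N + 1\<close> powers of \<open>g\<close> but at most
    \<open>N\<close> coordinates.\<close>
  obtain e where e: "\<exists>i\<in>{..N}. e i \<noteq> 0" "\<And>b. b \<in> B \<Longrightarrow> (\<Sum>i\<le>N. e i * c i b) = 0"
  proof -
    have "card B < card {..N}"
      using card [OF B] by simp
    from linear_dependence [OF fB finite_atMost this, of c] that show thesis
      by blast
  qed
  have "(\<Sum>i\<le>N. fps_of_poly (e i * q i) * g ^ (?p ^ i))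
      = (\<Sum>i\<le>N. fps_of_poly (e i) * (fps_of_poly (q i) * g ^ (?p ^ i)))"
    by (simp add: fps_of_poly_mult mult_ac)
  also have "\<dots> = (\<Sum>i\<le>N. \<Sum>b\<in>B. fps_of_poly (e i * c i b) * b ^ (?p ^ N))"
    using qc by (simp add: fps_of_poly_mult sum_distrib_left mult_ac)
  also have "\<dots> = (\<Sum>b\<in>B. fps_of_poly (\<Sum>i\<le>N. e i * c i b) * b ^ (?p ^ N))"
    by (subst sum.swap) (simp add: fps_of_poly_sum sum_distrib_right)
  also have "\<dots> = 0"
    using e(2) by simp
  finally show ?thesis
    using e(1) qc(1) by (intro exI [of _ "\<lambda>i. e i * q i"]) auto
qed

section \<open>The field of rational functions in one variable\<close>

lemma subfield_fls_rat_functions: "subfield (fls_rat_functions :: 'a::field fls set) ring_of_type_algebra"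
proof (rule subfield_of_typeI)
  let ?h = "\<lambda>P :: 'a poly. fps_to_fls (fps_of_poly P)"
  have h0: "?h P = 0 \<longleftrightarrow> P = 0" for P
    by simp
  have I: "?h P / ?h Q \<in> fls_rat_functions" if "Q \<noteq> 0" for P Q
    using that by (auto simp: fls_rat_functions_def)
  show "1 \<in> (fls_rat_functions :: 'a fls set)"
    using I [of 1 1] by simp
  fix x y :: "'a fls" assume "x \<in> fls_rat_functions" "y \<in> fls_rat_functions"
  then obtain P Q P' Q' where *: "x = ?h P / ?h Q" "Q \<noteq> 0" "y = ?h P' / ?h Q'" "Q' \<noteq> 0"
    by (auto simp: fls_rat_functions_def)
  have "x - y = ?h (P * Q' - P' * Q) / ?h (Q * Q')"
    using * by (simp add: fps_of_poly_mult fps_of_poly_diff fls_times_fps_to_fls diff_frac_eq)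
  then show "x - y \<in> fls_rat_functions"
    using I [of "Q * Q'"] * by simp
  have "x * y = ?h (P * P') / ?h (Q * Q')"
    using * by (simp add: fps_of_poly_mult fls_times_fps_to_fls)
  then show "x * y \<in> fls_rat_functions"
    using I [of "Q * Q'"] * by simp
  show "inverse x \<in> fls_rat_functions"
  proof (cases "P = 0")
    case True
    then show ?thesis using * I [of 1 0] by simp
  next
    case False
    then show ?thesis using * I [of P Q] by simp
  qed
qed

lemma fps_of_poly_mem_fls_rat_functions: "fps_to_fls (fps_of_poly P) \<in> fls_rat_functions"
  unfolding fls_rat_functions_def by (intro CollectI exI [of _ P] exI [of _ 1]) simp

text \<open>Dividing the relation by a nonzero \<open>g\<close> turns the exponents into
  \<open>p^i - 1\<close>, which accounts for the \<open>- 1\<close> in the final bound.\<close>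

lemma ext_degree_of_frobenius_relation:
  fixes g :: "'a::field fps"
  assumes p: "p \<ge> 2" and N: "N \<ge> 1" and e: "\<exists>i\<le>N. e i \<noteq> 0" "(\<Sum>i\<le>N. fps_of_poly (e i) * g ^ (p ^ i)) = 0"
  shows "algebraic_elem fls_rat_functions (fps_to_fls g) \<and> ext_degree fls_rat_functions (fps_to_fls g) \<le> p ^ N - 1"
proof -
  let ?K = "fls_rat_functions :: 'a fls set"
  have mem01: "0 \<in> ?K" "1 \<in> ?K"
    using fps_of_poly_mem_fls_rat_functions [of 0] fps_of_poly_mem_fls_rat_functions [of 1] by auto
  have "\<exists>P. P \<in> polys ?K \<and> P \<noteq> 0 \<and> poly P (fps_to_fls g) = 0 \<and> degree P \<le> p ^ N - 1"
  proof (cases "g = 0")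
    case True
    \<comment> \<open>For \<open>g = 0\<close> the polynomial \<open>y\<close> serves; its degree 1
      obeys the bound because \<open>p\<close> is at least 2 and \<open>N\<close> at least
      1.\<close>
    have "p ^ 1 \<le> p ^ N"
      using p N by (intro power_increasing) auto
    then have "1 \<le> p ^ N - 1"
      using p by simp
    then show ?thesis
      using True mem01 by (intro exI [of _ "monom 1 1"]) (auto simp: polys_def poly_monom degree_monom_eq)
  next
    case False
    define P where "P = (\<Sum>i\<le>N. monom (fps_to_fls (fps_of_poly (e i))) (p ^ i - 1))"
    have pos: "p ^ i > 0" for i
      using p by simp
    \<comment> \<open>Distinct exponents keep the coefficients \<open>e i\<close> apart, so
      \<open>P\<close> is nonzero.\<close>
    have inj: "p ^ i - 1 = p ^ j - 1 \<longleftrightarrow> i = j" for i j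
    proof -
      have "p ^ i - 1 = p ^ j - 1 \<longleftrightarrow> p ^ i = p ^ j"
        using pos [of i] pos [of j] by linarith
      then show ?thesis
        using p by (simp add: power_inject_exp)
    qed
    have coeff: "coeff P k = (\<Sum>i\<le>N. if p ^ i - 1 = k then fps_to_fls (fps_of_poly (e i)) else 0)" for k
      by (simp add: P_def coeff_sum)
    have "coeff P (p ^ i - 1) = fps_to_fls (fps_of_poly (e i))" if "i \<le> N" for i
      using that by (simp add: coeff inj del: One_nat_def)
    then have P0: "P \<noteq> 0"
      using e(1) by fastforce
    have "coeff P k \<in> ?K" for k
    proof (cases "\<exists>i\<le>N. k = p ^ i - 1")
      case True
      then obtain i where "i \<le> N" "k = p ^ i - 1" by blast
      then show ?thesis
        by (simp add: coeff inj fps_of_poly_mem_fls_rat_functions del: One_nat_def)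
    next
      case False
      then have "coeff P k = 0"
        unfolding coeff by (intro sum.neutral) auto
      then show ?thesis using mem01 by simp
    qed
    moreover have "degree P \<le> p ^ N - 1"
      unfolding P_def using p
      by (intro degree_sum_le order_trans [OF degree_monom_le] diff_le_mono power_increasing) auto
    moreover have "poly P (fps_to_fls g) = 0"
    proof -
      have "fps_to_fls g * poly P (fps_to_fls g)
          = (\<Sum>i\<le>N. fps_to_fls (fps_of_poly (e i)) * (fps_to_fls g * fps_to_fls g ^ (p ^ i - 1)))"
        by (simp add: P_def poly_sum poly_monom sum_distrib_left mult_ac)
      also have "\<dots> = (\<Sum>i\<le>N. fps_to_fls (fps_of_poly (e i) * g ^ (p ^ i)))"
        using pos by (simp add: fls_times_fps_to_fls fps_to_fls_power flip: power_Suc)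
      also have "\<dots> = fps_to_fls (\<Sum>i\<le>N. fps_of_poly (e i) * g ^ (p ^ i))"
        by (induction N) simp_all
      finally show ?thesis
        using e(2) False by simp
    qed
    ultimately show ?thesis
      using P0 by (auto simp: polys_def)
  qed
  then obtain P where P: "P \<in> polys ?K" "P \<noteq> 0" "poly P (fps_to_fls g) = 0" "degree P \<le> p ^ N - 1"
    by blast
  have alg: "algebraic_elem ?K (fps_to_fls g)"
    using P by (intro algebraic_elemI)
  moreover have "ext_degree ?K (fps_to_fls g) \<le> degree P"
    using polynomial_of_ext_degree(2) [OF subfield_fls_rat_functions alg] P by blast
  ultimately show ?thesis
    using P(4) by simp
qed

section \<open>Diagonals\<close>

abbreviation const_exp :: "nat \<Rightarrow> ('n::finite \<Rightarrow>\<^sub>0 nat)"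
  where "const_exp k \<equiv> Abs_poly_mapping (\<lambda>_. k)"

lemma fps_nth_diagonal [simp]: "fps_nth (diagonal w) i = mfps_nth w (const_exp i)"
  by (simp add: diagonal_def)

lemma diagonal_add: "diagonal (v + w) = diagonal v + diagonal w"
  by (simp add: fps_eq_iff)

lemma diagonal_0 [simp]: "diagonal 0 = 0"
  by (simp add: fps_eq_iff)

lemma diagonal_sum: "diagonal (sum g A) = (\<Sum>x\<in>A. diagonal (g x))"
  by (induction A rule: infinite_finite_induct) (auto simp: diagonal_add)

lemma diagonal_section: "fps_section k r (diagonal w) = diagonal (mfps_section k (\<lambda>_. r) w)"
  by (simp add: fps_eq_iff fps_section_def)

lemma diagonal_term_0_mult: "diagonal (mfps_term c 0 * w) = fps_const c * diagonal w"
proof (rule fps_ext)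
  fix i
  have "mfps_nth (mfps_term c 0 * w) (0 + const_exp i) = c * mfps_nth w (const_exp i)"
    by (rule mfps_nth_term_mult_add)
  then show "fps_nth (diagonal (mfps_term c 0 * w)) i = fps_nth (fps_const c * diagonal w) i"
    by simp
qed

abbreviation all_variables :: "('a::comm_ring_1, 'n::finite) mfps"
  where "all_variables \<equiv> mfps_term 1 (const_exp 1)"

lemma diagonal_all_variables_mult: "diagonal (all_variables * w) = fps_X * diagonal w"
proof (rule fps_ext)
  fix i
  show "fps_nth (diagonal (all_variables * w)) i = fps_nth (fps_X * diagonal w) i"
  proof (cases i)
    case 0
    have "mfps_nth (all_variables * w) (const_exp 0) = 0"
      by (rule mfps_nth_term_mult_eq_0) (auto simp: poly_mapping_eq_iff lookup_add fun_eq_iff)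
    then show ?thesis using 0 by simp
  next
    case (Suc j)
    have "const_exp i = const_exp 1 + (const_exp j :: 'b \<Rightarrow>\<^sub>0 nat)"
      by (auto simp: Suc poly_mapping_eq_iff lookup_add fun_eq_iff)
    then show ?thesis
      using mfps_nth_term_mult_add [of 1 "const_exp 1" w "const_exp j"] by (simp add: Suc)
  qed
qed

text \<open>\<open>subst_all e\<close> is \<open>e(t\<^sub>1 \<dots> t\<^sub>n)\<close>.\<close>

definition subst_all :: "'a::comm_ring_1 poly \<Rightarrow> ('a, 'n::finite) mfps"
  where "subst_all e = poly (map_poly (\<lambda>c. mfps_term c 0) e) all_variables"

lemma mfps_term_0 [simp]: "mfps_term 0 a = 0"
  by (simp add: mfps_eq_iff)

lemma subst_all_0 [simp]: "subst_all 0 = 0"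
  by (simp add: subst_all_def)

lemma subst_all_pCons: "subst_all (pCons a e) = mfps_term a 0 + all_variables * subst_all e"
  by (cases "a = 0 \<and> e = 0") (auto simp: subst_all_def map_poly_pCons)

lemma subst_all_add: "subst_all (e + e') = subst_all e + subst_all e'"
proof (induction e e' rule: poly_induct2)
  case (pCons a e b e')
  have "mfps_term (a + b) 0 = mfps_term a 0 + (mfps_term b 0 :: ('a, 'b) mfps)"
    by (simp add: mfps_eq_iff)
  moreover have "(subst_all (pCons a e + pCons b e') :: ('a, 'b) mfps)
      = mfps_term (a + b) 0 + all_variables * (subst_all e + subst_all e')"
    by (simp add: subst_all_pCons pCons)
  ultimately show ?case
    by (simp add: subst_all_pCons distrib_left)
qed simp

lemma subst_all_sum: "subst_all (sum g A) = (\<Sum>x\<in>A. subst_all (g x))"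
  by (induction A rule: infinite_finite_induct) (auto simp: subst_all_add)

lemma subst_all_smult: "subst_all (smult a e) = mfps_term a 0 * subst_all e"
  by (induction e) (simp_all add: subst_all_pCons algebra_simps mfps_term_mult)

lemma subst_all_mult: "subst_all (e * e') = subst_all e * subst_all e'"
  by (induction e) (simp_all add: subst_all_pCons subst_all_add subst_all_smult algebra_simps)

lemma subst_all_monom: "subst_all (monom c k) = mfps_term c (const_exp k)"
proof (induction k)
  case 0
  have "const_exp 0 = (0 :: 'b \<Rightarrow>\<^sub>0 nat)"
    by (intro poly_mapping_eqI) simp
  then show ?case
    by (simp add: monom_0 subst_all_pCons)
next
  case (Suc k)
  have "const_exp 1 + const_exp k = (const_exp (Suc k) :: 'b \<Rightarrow>\<^sub>0 nat)"
    by (auto simp: poly_mapping_eq_iff lookup_add fun_eq_iff)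
  then show ?case
    by (simp add: monom_Suc subst_all_pCons Suc mfps_term_mult)
qed

lemma diagonal_subst_all_mult: "diagonal (subst_all e * w) = fps_of_poly e * diagonal w"
proof (induction e)
  case (pCons a e)
  have "diagonal (subst_all (pCons a e) * w)
      = diagonal (mfps_term a 0 * w) + diagonal (all_variables * (subst_all e * w))"
    by (simp add: subst_all_pCons distrib_right mult.assoc diagonal_add)
  then show ?case
    unfolding diagonal_term_0_mult diagonal_all_variables_mult pCons
    by (simp add: fps_of_poly_pCons algebra_simps)
qed simp

section \<open>Linear combinations over polynomials in the product of all variables\<close>

definition subst_span :: "'x set \<Rightarrow> ('x \<Rightarrow> ('a::comm_ring_1, 'n::finite) mfps) \<Rightarrow> ('a, 'n) mfps set"
  where "subst_span T g = {u. \<exists>c. u = (\<Sum>x\<in>T. subst_all (c x) * g x)}"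

lemma subst_span_sum:
  assumes "\<And>y. y \<in> A \<Longrightarrow> h y \<in> subst_span T g"
  shows "sum h A \<in> subst_span T g"
proof -
  have "\<forall>y. \<exists>c. y \<in> A \<longrightarrow> h y = (\<Sum>x\<in>T. subst_all (c x) * g x)"
    using assms unfolding subst_span_def by blast
  from choice [OF this] obtain c where c: "\<And>y. y \<in> A \<Longrightarrow> h y = (\<Sum>x\<in>T. subst_all (c y x) * g x)"
    by blast
  have "sum h A = (\<Sum>x\<in>T. subst_all (\<Sum>y\<in>A. c y x) * g x)"
    by (simp add: c subst_all_sum sum_distrib_right sum.swap [of _ T A])
  then show ?thesis
    unfolding subst_span_def by (intro CollectI exI [of _ "\<lambda>x. \<Sum>y\<in>A. c y x"])
qed

lemma subst_span_base:
  assumes "finite T" "x \<in> T"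
  shows "subst_all e * g x \<in> subst_span T g"
proof -
  have "(\<Sum>y\<in>T. subst_all (if y = x then e else 0) * g y) = (\<Sum>y\<in>{x}. subst_all e * g y)"
    using assms by (intro sum.mono_neutral_cong_right) auto
  then show ?thesis
    unfolding subst_span_def by (intro CollectI exI [of _ "\<lambda>y. if y = x then e else 0"]) simp
qed

section \<open>Diagonals of algebraic series in positive characteristic\<close>

lemma poly_eq_sum: "degree (P :: 'a::comm_semiring_1 poly) \<le> k \<Longrightarrow> poly P x = (\<Sum>i\<le>k. coeff P i * x ^ i)"
  unfolding poly_altdef by (rule sum.mono_neutral_left) (auto simp: coeff_eq_0)

lemma (in idom_subring) of_nat_mem: "of_nat k \<in> R"
  by (induction k) (auto intro: zero_mem one_mem add_mem)

text \<open>Otherwise \<open>A\<close> is a polynomial in \<open>y^p\<close>, and applying a Cartier operator to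
  \<open>A(f) = 0\<close> gives a relation of smaller degree.\<close>

lemma separable_relation:
  fixes f :: "('p::prime_card mod_ring, 'n::finite) mfps"
  assumes A: "A \<in> polys (mpolys UNIV)" "A \<noteq> 0" "poly A f = 0"
    and min: "\<And>B. B \<in> polys (mpolys UNIV) \<Longrightarrow> B \<noteq> 0 \<Longrightarrow> poly B f = 0 \<Longrightarrow> degree A \<le> degree B"
  shows "poly (pderiv A) f \<noteq> 0"
proof
  assume root: "poly (pderiv A) f = 0"
  let ?p = "CARD('p)"
  have p: "?p > 1"
    using prime_gt_1_nat [OF prime_card [where 'a = 'p]] by simp
  interpret R: idom_subring "mpolys UNIV :: ('p mod_ring, 'n) mfps set"
    by (rule idom_subring_mpolys)
  have deg: "degree A > 0"
  proof (rule ccontr)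
    assume "\<not> ?thesis"
    then obtain a where "A = [:a:]" by (metis degree_eq_zeroE neq0_conv)
    with A show False by simp
  qed
  have "pderiv A \<in> polys (mpolys UNIV)"
    using A(1) unfolding polys_def by (auto simp: coeff_pderiv simp del: of_nat_Suc intro: R.mult_mem R.of_nat_mem)
  moreover have "degree (pderiv A) < degree A"
    using deg degree_pderiv_le [of A] by linarith
  ultimately have "pderiv A = 0"
    using min [of "pderiv A"] root by fastforce
  have zero: "coeff A j = 0" if "\<not> ?p dvd j" for j
  proof -
    obtain i where j: "j = Suc i"
      using \<open>\<not> ?p dvd j\<close> by (cases j) auto
    have "of_nat (Suc i) * coeff A (Suc i) = 0"
      using coeff_pderiv [of A i] \<open>pderiv A = 0\<close> by simp
    moreover have "of_nat (Suc i) \<noteq> (0 :: ('p mod_ring, 'n) mfps)"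
      using that unfolding of_nat_eq_0_iff_char_dvd char_mfps j by simp
    ultimately show ?thesis using j by simp
  qed
  have lc: "lead_coeff A \<noteq> 0"
    using A by simp
  then have "?p dvd degree A"
    using zero by blast
  then obtain k where k: "degree A = ?p * k" by blast
  obtain m where m: "mfps_nth (lead_coeff A) m \<noteq> 0"
    using lc by (metis mfps_eqI mfps_nth_0)
  \<comment> \<open>The residues of an exponent \<open>m\<close> that occurs in the leading
    coefficient: with this choice the section of that coefficient is nonzero.\<close>
  define r where "r i = Poly_Mapping.lookup m i mod ?p" for i
  have r: "r i < ?p" for i
    using p by (simp add: r_def)
  \<comment> \<open>The residue in \<open>y\<close> is 0 here, unlike in
    \<open>poly_section\<close>, because only powers of \<open>y^p\<close> occur in
    \<open>A\<close>.\<close>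
  define B where "B = Abs_poly (\<lambda>i. mfps_section ?p r (coeff A (?p * i)))"
  have coeff_B: "coeff B i = mfps_section ?p r (coeff A (?p * i))" for i
    unfolding B_def
  proof (subst coeff_Abs_poly [of k])
    fix i assume "k < i"
    then show "mfps_section ?p r (coeff A (?p * i)) = 0"
      using p by (subst coeff_eq_0) (auto simp: k)
  qed simp
  have "coeff B i \<in> mpolys UNIV" for i
  proof -
    have "finite {m. mfps_nth (coeff A (?p * i)) m \<noteq> 0}"
      using polys_coeff [OF A(1)] by (simp add: mpolys_UNIV)
    then have "finite (affine_exp ?p r -` {m. mfps_nth (coeff A (?p * i)) m \<noteq> 0})"
      using p by (intro finite_vimageI injI) (auto simp: affine_exp_inj)
    then show ?thesis
      by (simp add: mpolys_UNIV coeff_B vimage_def)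
  qed
  then have "B \<in> polys (mpolys UNIV)"
    by (simp add: polys_def)
  moreover have "B \<noteq> 0"
  proof -
    have "affine_exp ?p r (Abs_poly_mapping (\<lambda>i. Poly_Mapping.lookup m i div ?p)) = m"
      by (auto simp: r_def poly_mapping_eq_iff fun_eq_iff)
    then have "mfps_nth (coeff B k) (Abs_poly_mapping (\<lambda>i. Poly_Mapping.lookup m i div ?p)) \<noteq> 0"
      using m by (simp add: coeff_B k)
    then show ?thesis by auto
  qed
  moreover have "degree B < degree A"
  proof -
    have "degree B \<le> k"
      by (rule degree_le) (use p in \<open>auto simp: coeff_B k intro!: arg_cong [of _ 0 "mfps_section _ _", simplified] coeff_eq_0\<close>)
    also have "1 * k < ?p * k"
      using deg k p by (intro mult_less_mono1) auto
    then have "k < ?p * k"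
      by simp
    finally show ?thesis by (simp add: k)
  qed
  moreover have "poly B f = 0"
  proof -
    have "poly A f = (\<Sum>j\<le>?p * k. coeff A j * f ^ j)"
      by (simp add: poly_altdef k)
    also have "\<dots> = (\<Sum>j\<in>(\<lambda>i. ?p * i) ` {..k}. coeff A j * f ^ j)"
    proof (rule sum.mono_neutral_right)
      show "\<forall>j\<in>{..?p * k} - (\<lambda>i. ?p * i) ` {..k}. coeff A j * f ^ j = 0"
      proof
        fix j assume j: "j \<in> {..?p * k} - (\<lambda>i. ?p * i) ` {..k}"
        have "\<not> ?p dvd j"
        proof
          assume "?p dvd j"
          then obtain i where "j = ?p * i" by (rule dvdE)
          with j p show False by auto
        qed
        then show "coeff A j * f ^ j = 0"
          by (simp add: zero)
      qed
    qed auto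
    also have "\<dots> = (\<Sum>i\<le>k. (f ^ i) ^ ?p * coeff A (?p * i))"
      using p by (subst sum.reindex) (auto intro!: inj_onI sum.cong simp: mult.commute simp flip: power_mult)
    finally have "0 = mfps_section ?p r (\<Sum>i\<le>k. (f ^ i) ^ ?p * coeff A (?p * i))"
      using A(3) by simp
    also have "\<dots> = (\<Sum>i\<le>k. coeff B i * f ^ i)"
      by (simp add: mfps_section_sum mfps_section_power_mult r coeff_B)
        (simp add: mult.commute)
    also have "\<dots> = poly B f"
      by (rule poly_eq_sum [symmetric]) (use p in \<open>auto simp: coeff_B k coeff_eq_0 intro: degree_le\<close>)
    finally show ?thesis by simp
  qed
  ultimately show False
    using min [of B] by simp
qed

text \<open>The series \<open>w\<close> with \<open>w A'(f) = P(f)\<close>, where \<open>P\<close> satisfies the degree bounds of \<open>A\<close>,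
  include \<open>f\<close> and are stable under the sections.\<close>

lemma diagonal_frobenius_relation:
  fixes f :: "('p::prime_card mod_ring, 'n::finite) mfps"
    and \<Lambda> :: "'l set" and v :: "'l \<Rightarrow> 'n \<Rightarrow> nat" and c :: "'l \<Rightarrow> nat" and d :: nat
  defines "Box \<equiv> {m. \<forall>l\<in>\<Lambda>. weight (v l) m \<le> c l}"
  defines "N \<equiv> (d + 1) * card {m \<in> Box. \<exists>i. Poly_Mapping.lookup m i = 0}"
  assumes fin: "finite Box"
    and deg: "\<exists>B. B \<in> polys (mpolys UNIV) \<and> B \<noteq> 0 \<and> poly B f = 0 \<and> degree B \<le> d"
    and weights: "\<And>l. l \<in> \<Lambda> \<Longrightarrow> \<exists>B. B \<in> polys (mpolys UNIV) \<and> B \<noteq> 0 \<and> poly B f = 0 \<and>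
      (\<forall>j. weight_le (v l) (c l) (coeff B j))"
  shows "\<exists>e. (\<exists>i\<le>N. e i \<noteq> 0) \<and> (\<Sum>i\<le>N. fps_of_poly (e i) * diagonal f ^ (CARD('p) ^ i)) = 0"
proof -
  let ?p = "CARD('p)"
  have p: "?p > 1"
    using prime_gt_1_nat [OF prime_card [where 'a = 'p]] by simp
  have "\<exists>B. B \<in> polys (mpolys UNIV) \<and> B \<noteq> 0 \<and> poly B f = 0"
    using deg by blast
  from minimal_relation [OF factorial_in_mpolys this]
  obtain A where A: "A \<in> polys (mpolys UNIV)" "A \<noteq> 0" "poly A f = 0"
    and min: "\<And>B. B \<in> polys (mpolys UNIV) \<Longrightarrow> B \<noteq> 0 \<Longrightarrow> poly B f = 0 \<Longrightarrow> degree A \<le> degree B"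
    and dvd: "\<And>B. B \<in> polys (mpolys UNIV) \<Longrightarrow> poly B f = 0 \<Longrightarrow> dvd_in (polys (mpolys UNIV)) A B"
    by blast
  have sep: "poly (pderiv A) f \<noteq> 0"
    using separable_relation [OF A min] .
  have degA: "degree A \<le> d"
    using deg min by (meson order_trans)
  \<comment> \<open>All bounds meet in the common divisor \<open>A\<close>, although each comes from
    its own relation \<open>B\<close>.\<close>
  have wA: "weight_le (v l) (c l) (coeff A j)" if l: "l \<in> \<Lambda>" for l j
  proof -
    obtain B where B: "B \<in> polys (mpolys UNIV)" "B \<noteq> 0" "poly B f = 0" "\<And>j. weight_le (v l) (c l) (coeff B j)"
      using weights [OF l] by blast
    from dvd [OF B(1,3)] obtain C where "C \<in> polys (mpolys UNIV)" "B = A * C"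
      by (rule dvd_inE)
    with B show ?thesis
      using weight_le_factor [OF A(1), of C "v l" "c l" j] by simp
  qed
  define bounded where "bounded P \<longleftrightarrow> (\<forall>j>d. coeff P j = 0) \<and> (\<forall>j. \<forall>l\<in>\<Lambda>. weight_le (v l) (c l) (coeff P j))"
    for P :: "('p mod_ring, 'n) mfps poly"
  define W where "W = {w. \<exists>P. bounded P \<and> w * poly (pderiv A) f = poly P f}"
  have fW: "f \<in> W"
  proof -
    \<comment> \<open>\<open>y A'\<close> takes the value \<open>f A'(f)\<close> at
      \<open>f\<close>. The factor \<open>y\<close> restores the indices of \<open>A\<close>, so its
      weight bounds apply coefficient by coefficient.\<close>
    have coeff: "coeff (pCons 0 (pderiv A)) j = of_nat j * coeff A j" for j
      by (cases j) (simp_all add: coeff_pderiv)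
    have "weight_le (v l) (c l) (of_nat j * coeff A j)" if "l \<in> \<Lambda>" for l j
      using weight_le_sum [of "{..<j}" "v l" "c l" "\<lambda>_. coeff A j"] wA [OF that] by simp
    then have "bounded (pCons 0 (pderiv A))"
      using degA unfolding bounded_def coeff by (auto simp: coeff_eq_0)
    then show ?thesis
      unfolding W_def by (intro CollectI exI [of _ "pCons 0 (pderiv A)"]) simp
  qed
  have secW: "mfps_section ?p r w \<in> W" if w: "w \<in> W" and r: "\<And>i. r i < ?p" for w r
  proof -
    obtain P where P: "bounded P" "w * poly (pderiv A) f = poly P f"
      using w unfolding W_def by blast
    let ?Q = "P * A ^ (?p - 1)"
    have coeff: "coeff (poly_section ?p r ?Q) j = mfps_section ?p r (coeff ?Q (?p * j + (?p - 1)))" for j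
      using p by (intro coeff_poly_section) simp
    \<comment> \<open>\<open>P A^(p-1)\<close> has degree at most \<open>d + (p - 1) d = p d\<close>
      in \<open>y\<close>, and the section divides indices by \<open>p\<close>.\<close>
    have "coeff (poly_section ?p r ?Q) j = 0" if "j > d" for j
    proof -
      have "degree P \<le> d"
        using P(1) by (intro degree_le) (simp add: bounded_def)
      moreover have "degree (A ^ (?p - 1)) \<le> d * (?p - 1)"
        using degree_power_le [of A "?p - 1"] mult_le_mono1 [OF degA] by (meson order_trans)
      ultimately have "degree ?Q \<le> d + d * (?p - 1)"
        using degree_mult_le [of P "A ^ (?p - 1)"] by linarith
      also have "\<dots> = ?p * d"
        using p by (cases ?p) auto
      also have "\<dots> < ?p * j"
        using p that by simp
      finally have "coeff ?Q (?p * j + (?p - 1)) = 0"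
        by (intro coeff_eq_0) linarith
      then show ?thesis
        unfolding coeff by simp
    qed
    moreover have "weight_le (v l) (c l) (coeff (poly_section ?p r ?Q) j)" if l: "l \<in> \<Lambda>" for l j
      unfolding weight_le_def
    proof (intro allI impI)
      fix m assume m: "mfps_nth (coeff (poly_section ?p r ?Q) j) m \<noteq> 0"
      \<comment> \<open>The same count for weights: adding the residues \<open>r\<close> can only
        increase \<open>p\<close> times the weight of \<open>m\<close>, and the result is at most
        \<open>p\<close> times the bound.\<close>
      have "weight_le (v l) (c l + (?p - 1) * c l) (coeff ?Q i)" for i
        using P(1) wA l by (intro weight_le_coeff_mult weight_le_coeff_power) (auto simp: bounded_def)
      moreover have "c l + (?p - 1) * c l = ?p * c l"
        using p by (cases ?p) auto
      ultimately have "weight (v l) (affine_exp ?p r m) \<le> ?p * c l"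
        using m unfolding coeff mfps_nth_section weight_le_def by metis
      moreover have "?p * weight (v l) m \<le> weight (v l) (affine_exp ?p r m)"
        unfolding sum_distrib_left by (intro sum_mono) (simp add: algebra_simps)
      ultimately have "?p * weight (v l) m \<le> ?p * c l"
        by (rule order_trans [rotated])
      then show "weight (v l) m \<le> c l"
        using p by simp
    qed
    ultimately have "bounded (poly_section ?p r ?Q)"
      by (simp add: bounded_def)
    then show ?thesis
      using section_of_residue [where r = r, OF r A(3) P(2)] unfolding W_def by blast
  qed
  \<comment> \<open>Indices of the generators over polynomials in the product of all variables: a
    monomial that omits a variable, and one of the \<open>d + 1\<close> powers of
    \<open>f\<close>.\<close>
  define T where "T = {m \<in> Box. \<exists>i. Poly_Mapping.lookup m i = 0} \<times> {..d}"
  have T: "finite T" "card T = N"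
    using fin by (simp_all add: T_def N_def card_cartesian_product)
  define g where "g x = mfps_term 1 (fst x) * f ^ snd x" for x :: "('n \<Rightarrow>\<^sub>0 nat) \<times> nat"
  have spanP: "poly P f \<in> subst_span T g" if P: "bounded P" for P
  proof -
    have termT: "mfps_term b a * f ^ j \<in> subst_span T g" if a: "a \<in> Box" and j: "j \<le> d" for b a j
    proof -
      \<comment> \<open>The product of all variables divides the monomial \<open>a\<close> exactly
        \<open>k\<close> times. The quotient \<open>a'\<close> omits the variable \<open>i0\<close>
        and stays in \<open>Box\<close>, since lowering exponents lowers weights.\<close>
      define k where "k = Min (range (Poly_Mapping.lookup a))"
      have k: "k \<le> Poly_Mapping.lookup a i" for i
        by (simp add: k_def)
      have "k \<in> range (Poly_Mapping.lookup a)"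
        unfolding k_def by (intro Min_in) auto
      then obtain i0 where i0: "Poly_Mapping.lookup a i0 = k"
        by auto
      define a' where "a' = Abs_poly_mapping (\<lambda>i. Poly_Mapping.lookup a i - k)"
      have "weight (v l) a' \<le> weight (v l) a" for l
        by (intro sum_mono) (simp add: a'_def)
      then have "a' \<in> Box"
        using a unfolding Box_def by (auto intro: order_trans)
      moreover have "Poly_Mapping.lookup a' i0 = 0"
        by (simp add: a'_def i0)
      ultimately have mem: "(a', j) \<in> T"
        using j by (auto simp: T_def)
      have "const_exp k + a' = a"
        using k by (auto simp: a'_def poly_mapping_eq_iff lookup_add fun_eq_iff)
      then have "mfps_term b a * f ^ j = subst_all (monom b k) * g (a', j)"
        by (simp add: subst_all_monom g_def mfps_term_mult flip: mult.assoc)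
      then show ?thesis
        using subst_span_base [OF T(1) mem] by simp
    qed
    have eq: "coeff P j = (\<Sum>a\<in>Box. mfps_term (mfps_nth (coeff P j) a) a)" for j
    proof (rule mfps_eqI)
      fix m
      have "m \<in> Box" if "mfps_nth (coeff P j) m \<noteq> 0"
        using P that by (auto simp: bounded_def Box_def weight_le_def)
      then show "mfps_nth (coeff P j) m = mfps_nth (\<Sum>a\<in>Box. mfps_term (mfps_nth (coeff P j) a) a) m"
        using fin by auto
    qed
    have "poly P f = (\<Sum>j\<le>d. coeff P j * f ^ j)"
      using P by (intro poly_eq_sum degree_le) (auto simp: bounded_def)
    also have "\<dots> = (\<Sum>j\<le>d. \<Sum>a\<in>Box. mfps_term (mfps_nth (coeff P j) a) a * f ^ j)"
      by (subst eq) (simp add: sum_distrib_right)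
    also have "\<dots> \<in> subst_span T g"
      by (intro subst_span_sum termT) auto
    finally show ?thesis .
  qed
  have dep: "\<exists>e. (\<exists>b\<in>B. e b \<noteq> 0) \<and> (\<Sum>b\<in>B. fps_of_poly (e b) * b) = 0"
    if B: "B \<subseteq> diagonal ` W" "finite B" "card B = Suc N" for B
  proof -
    have "\<forall>b. \<exists>w c. b \<in> B \<longrightarrow> b = diagonal w \<and> w * poly (pderiv A) f = (\<Sum>x\<in>T. subst_all (c x) * g x)"
    proof (intro allI)
      fix b
      show "\<exists>w c. b \<in> B \<longrightarrow> b = diagonal w \<and> w * poly (pderiv A) f = (\<Sum>x\<in>T. subst_all (c x) * g x)"
      proof (cases "b \<in> B")
        case True
        then obtain w where w: "w \<in> W" "b = diagonal w"
          using B(1) by blast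
        then obtain P where "bounded P" "w * poly (pderiv A) f = poly P f"
          unfolding W_def by blast
        moreover from this(1) obtain c where "poly P f = (\<Sum>x\<in>T. subst_all (c x) * g x)"
          using spanP [of P] unfolding subst_span_def by blast
        ultimately show ?thesis
          using w by (intro exI [of _ w] exI [of _ c]) simp
      qed simp
    qed
    from choice [OF this] obtain w where
      "\<forall>b. \<exists>c. b \<in> B \<longrightarrow> b = diagonal (w b) \<and> w b * poly (pderiv A) f = (\<Sum>x\<in>T. subst_all (c x) * g x)" ..
    from choice [OF this] obtain c where wc: "\<And>b. b \<in> B \<Longrightarrow> b = diagonal (w b)"
      "\<And>b. b \<in> B \<Longrightarrow> w b * poly (pderiv A) f = (\<Sum>x\<in>T. subst_all (c b x) * g x)"
      by blast
    obtain e where e: "\<exists>b\<in>B. e b \<noteq> 0" "\<And>x. x \<in> T \<Longrightarrow> (\<Sum>b\<in>B. e b * c b x) = 0"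
    proof -
      have "card T < card B"
        using B(3) T(2) by simp
      from linear_dependence [OF T(1) B(2) this, of c] that show thesis
        by blast
    qed
    have "(\<Sum>b\<in>B. subst_all (e b) * w b) * poly (pderiv A) f
        = (\<Sum>b\<in>B. \<Sum>x\<in>T. subst_all (e b * c b x) * g x)"
      using wc(2) by (simp add: sum_distrib_right sum_distrib_left subst_all_mult mult.assoc)
    also have "\<dots> = (\<Sum>x\<in>T. subst_all (\<Sum>b\<in>B. e b * c b x) * g x)"
      by (subst sum.swap) (simp add: subst_all_sum sum_distrib_right)
    also have "\<dots> = 0"
      using e(2) by simp
    \<comment> \<open>The common factor \<open>A'(f)\<close> must go before diagonals are taken, as
      they do not respect products with it.\<close>
    finally have "(\<Sum>b\<in>B. subst_all (e b) * w b) = 0"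
      using sep by simp
    then have "0 = (\<Sum>b\<in>B. fps_of_poly (e b) * diagonal (w b))"
      by (metis (no_types, lifting) diagonal_0 diagonal_sum diagonal_subst_all_mult sum.cong)
    also have "\<dots> = (\<Sum>b\<in>B. fps_of_poly (e b) * b)"
      using wc(1) by simp
    finally show ?thesis
      using e(1) by auto
  qed
  show ?thesis
  proof (rule frobenius_relation [OF _ _ dep])
    show "diagonal f \<in> diagonal ` W"
      using fW by blast
    show "fps_section ?p r u \<in> diagonal ` W" if "u \<in> diagonal ` W" "r < ?p" for u r
      using that secW [of _ "\<lambda>_. r"] by (auto simp: diagonal_section)
  qed
qed

section \<open>Counting exponents\<close>

lemma card_exponents:
  "card {m :: 'n::finite \<Rightarrow>\<^sub>0 nat. Q (Poly_Mapping.lookup m)} = card {g. Q g}"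
  by (rule bij_betw_same_card [of Poly_Mapping.lookup], rule bij_betw_byWitness [of _ Abs_poly_mapping])
     (auto intro: poly_mapping_eqI)

text \<open>The exponents without a zero entry form the smaller box in which every entry starts at
  1.\<close>

lemma card_box_boundary:
  fixes k :: "'n::finite \<Rightarrow> nat"
  shows "card {m :: 'n \<Rightarrow>\<^sub>0 nat. (\<forall>i. Poly_Mapping.lookup m i \<le> k i) \<and> (\<exists>i. Poly_Mapping.lookup m i = 0)}
    = (\<Prod>i\<in>UNIV. k i + 1) - (\<Prod>i\<in>UNIV. k i)"
proof -
  have eq: "{g :: 'n \<Rightarrow> nat. (\<forall>i. g i \<le> k i) \<and> (\<exists>i. g i = 0)} = PiE UNIV (\<lambda>i. {..k i}) - PiE UNIV (\<lambda>i. {1..k i})"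
    by (auto simp: PiE_UNIV_domain Pi_def Suc_le_eq) (metis neq0_conv)
  have "card (PiE UNIV (\<lambda>i. {..k i}) - PiE UNIV (\<lambda>i. {1..k i})) = (\<Prod>i\<in>UNIV. k i + 1) - (\<Prod>i\<in>UNIV. k i)"
  proof (subst card_Diff_subset)
    show "finite (PiE UNIV (\<lambda>i. {1..k i}))"
      by (intro finite_PiE) auto
    show "PiE UNIV (\<lambda>i. {1..k i}) \<subseteq> PiE UNIV (\<lambda>i. {..k i})"
      by (intro PiE_mono) auto
  qed (simp add: card_PiE)
  then show ?thesis
    using card_exponents [of "\<lambda>g. (\<forall>i. g i \<le> k i) \<and> (\<exists>i. g i = 0)"] by (simp add: eq)
qed

text \<open>Splitting off the value at \<open>x\<close> leads to the hockey-stick sum of binomial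
  coefficients. Extensional functions make the set finite for every \<open>V\<close>.\<close>

lemma card_simplex_PiE:
  assumes "finite V"
  shows "finite {g \<in> extensional V. (\<Sum>i\<in>V. g i :: nat) \<le> h}
    \<and> card {g \<in> extensional V. (\<Sum>i\<in>V. g i :: nat) \<le> h} = (card V + h) choose card V"
  using assms
proof (induction V arbitrary: h rule: finite_induct)
  case empty
  have "{g :: 'a \<Rightarrow> nat. g \<in> extensional {}} = {\<lambda>_. undefined}"
    by auto
  then show ?case by simp
next
  case (insert x V)
  let ?S = "\<lambda>V h. {g \<in> extensional V. (\<Sum>i\<in>V. g i :: nat) \<le> h}"
  let ?T = "Sigma {..h} (\<lambda>k. ?S V (h - k))"
  have bij: "bij_betw (\<lambda>(k, g). g(x := k)) ?T (?S (insert x V) h)"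
  proof (rule bij_betw_byWitness [of _ "\<lambda>g. (g x, g(x := undefined))"])
    have sum: "(\<Sum>i\<in>V. (g(x := k)) i) = (\<Sum>i\<in>V. g i)" for g :: "'a \<Rightarrow> nat" and k
      using insert by (intro sum.cong) auto
    show "\<forall>a\<in>?T. (\<lambda>g. (g x, g(x := undefined))) (case a of (k, g) \<Rightarrow> g(x := k)) = a"
      using insert by (auto simp: extensional_def)
    show "\<forall>a\<in>?S (insert x V) h. (case (a x, a(x := undefined)) of (k, g) \<Rightarrow> g(x := k)) = a"
      by auto
    show "(\<lambda>(k, g). g(x := k)) ` ?T \<subseteq> ?S (insert x V) h"
      using insert sum by (auto simp: extensional_def)
    show "(\<lambda>g. (g x, g(x := undefined))) ` ?S (insert x V) h \<subseteq> ?T"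
      using insert sum by (auto simp: extensional_def)
  qed
  have "finite ?T"
    using insert.IH by blast
  moreover have "card ?T = (\<Sum>k\<le>h. (card V + (h - k)) choose card V)"
    using insert.IH by (subst card_SigmaI) auto
  moreover have "\<dots> = (\<Sum>k\<le>h. (card V + k) choose card V)"
    by (rule sum.reindex_bij_witness [of _ "\<lambda>k. h - k" "\<lambda>k. h - k"]) auto
  moreover have "\<dots> = (Suc (card V) + h) choose Suc (card V)"
  proof (induction h)
    case (Suc h)
    then show ?case by (simp add: add.commute)
  qed simp
  ultimately show ?case
    using bij_betw_same_card [OF bij] bij_betw_finite [OF bij] insert by simp
qed

lemma simplex_boundary:
  shows "finite {m :: 'n::finite \<Rightarrow>\<^sub>0 nat. (\<Sum>i\<in>UNIV. Poly_Mapping.lookup m i) \<le> h}"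
    and "card {m :: 'n::finite \<Rightarrow>\<^sub>0 nat. (\<Sum>i\<in>UNIV. Poly_Mapping.lookup m i) \<le> h \<and> (\<exists>i. Poly_Mapping.lookup m i = 0)}
      = ((CARD('n) + h) choose CARD('n)) - (h choose CARD('n))"
proof -
  have simplex: "finite {g :: 'n \<Rightarrow> nat. (\<Sum>i\<in>UNIV. g i) \<le> k}"
    "card {g :: 'n \<Rightarrow> nat. (\<Sum>i\<in>UNIV. g i) \<le> k} = (CARD('n) + k) choose CARD('n)" for k
    using card_simplex_PiE [of "UNIV :: 'n set" k] by (simp_all add: extensional_def)
  have "{m :: 'n \<Rightarrow>\<^sub>0 nat. (\<Sum>i\<in>UNIV. Poly_Mapping.lookup m i) \<le> h} \<subseteq> {m. \<forall>i. Poly_Mapping.lookup m i \<le> h}"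
  proof safe
    fix m :: "'n \<Rightarrow>\<^sub>0 nat" and i assume "(\<Sum>i\<in>UNIV. Poly_Mapping.lookup m i) \<le> h"
    moreover have "Poly_Mapping.lookup m i \<le> (\<Sum>i\<in>UNIV. Poly_Mapping.lookup m i)"
      by (rule member_le_sum) auto
    ultimately show "Poly_Mapping.lookup m i \<le> h" by linarith
  qed
  then show "finite {m :: 'n \<Rightarrow>\<^sub>0 nat. (\<Sum>i\<in>UNIV. Poly_Mapping.lookup m i) \<le> h}"
    using finite_below [of "\<lambda>_. h"] by (rule finite_subset)
  \<comment> \<open>Subtracting 1 from every entry maps these exponents onto the simplex of size
    \<open>h - CARD('n)\<close>. If \<open>h\<close> is smaller than \<open>CARD('n)\<close>, there
    are none, in accordance with the binomial coefficient being 0.\<close>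
  let ?P = "{g :: 'n \<Rightarrow> nat. (\<Sum>i\<in>UNIV. g i) \<le> h \<and> (\<forall>i. g i \<noteq> 0)}"
  have P: "card ?P = h choose CARD('n)"
  proof (cases "CARD('n) \<le> h")
    case True
    have "bij_betw (\<lambda>g i. Suc (g i)) {g :: 'n \<Rightarrow> nat. (\<Sum>i\<in>UNIV. g i) \<le> h - CARD('n)} ?P"
    proof (rule bij_betw_byWitness [of _ "\<lambda>g i. g i - 1"])
      have Suc: "(\<Sum>i\<in>UNIV. Suc (g i)) = (\<Sum>i\<in>UNIV. g i) + CARD('n)" for g :: "'n \<Rightarrow> nat"
        by (simp add: sum_Suc)
      then show "(\<lambda>g i. Suc (g i)) ` {g :: 'n \<Rightarrow> nat. (\<Sum>i\<in>UNIV. g i) \<le> h - CARD('n)} \<subseteq> ?P"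
        using True by auto
      have "(\<Sum>i\<in>UNIV. g i - 1) \<le> h - CARD('n)" if "g \<in> ?P" for g
      proof -
        have "(\<Sum>i\<in>UNIV. Suc (g i - 1)) = (\<Sum>i\<in>UNIV. g i)"
          using that by (intro sum.cong) auto
        then show ?thesis
          using that Suc [of "\<lambda>i. g i - 1"] by (simp, linarith)
      qed
      then show "(\<lambda>g i. g i - 1) ` ?P \<subseteq> {g. (\<Sum>i\<in>UNIV. g i) \<le> h - CARD('n)}"
        by auto
    qed (auto simp: fun_eq_iff)
    then show ?thesis
      using simplex(2) [of "h - CARD('n)"] True by (simp add: bij_betw_same_card [symmetric])
  next
    case False
    have "g \<notin> ?P" for g
    proof
      assume g: "g \<in> ?P"
      then have "(\<Sum>i\<in>(UNIV :: 'n set). 1) \<le> (\<Sum>i\<in>UNIV. g i)"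
        by (intro sum_mono) (simp add: Suc_le_eq)
      with g False show False by simp
    qed
    then have "?P = {}" by blast
    then show ?thesis using False by (simp only: card.empty binomial_eq_0 not_le)
  qed
  have "{g :: 'n \<Rightarrow> nat. (\<Sum>i\<in>UNIV. g i) \<le> h \<and> (\<exists>i. g i = 0)} = {g. (\<Sum>i\<in>UNIV. g i) \<le> h} - ?P"
    by (simp add: set_eq_iff) blast
  moreover have "card ({g. (\<Sum>i\<in>UNIV. g i) \<le> h} - ?P) = ((CARD('n) + h) choose CARD('n)) - (h choose CARD('n))"
    using simplex P by (subst card_Diff_subset) (auto intro: finite_subset [OF _ simplex(1) [of h]])
  ultimately show "card {m :: 'n::finite \<Rightarrow>\<^sub>0 nat. (\<Sum>i\<in>UNIV. Poly_Mapping.lookup m i) \<le> h \<and> (\<exists>i. Poly_Mapping.lookup m i = 0)}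
      = ((CARD('n) + h) choose CARD('n)) - (h choose CARD('n))"
    using card_exponents [of "\<lambda>g :: 'n \<Rightarrow> nat. (\<Sum>i\<in>UNIV. g i) \<le> h \<and> (\<exists>i. g i = 0)"] by simp
qed

section \<open>From integer coefficients to the prime field, and the two bounds\<close>

lemma diagonal_of_int: "diagonal (mfps_of_int f) = reduce_mod (diagonal f)"
  by (simp add: fps_eq_iff reduce_mod_def)

text \<open>The common source of both terms of the minimum: \<Lambda> indexes the degree conditions,
  one for each variable or a single one for the total degree.\<close>

lemma diagonal_degree_bound:
  fixes f :: "(int, 'n::finite) mfps"
    and \<Lambda> :: "'l set" and v :: "'l \<Rightarrow> 'n \<Rightarrow> nat" and c :: "'l \<Rightarrow> nat"
  defines "Box \<equiv> {m. \<forall>l\<in>\<Lambda>. weight (v l) m \<le> c l}"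
  defines "N \<equiv> (ext_degree rat_functions (mfps_to_fract f) + 1) * card {m \<in> Box. \<exists>i. Poly_Mapping.lookup m i = 0}"
  assumes alg: "algebraic_elem rat_functions (mfps_to_fract f)" and fin: "finite Box"
    and weights: "\<And>l A0. l \<in> \<Lambda> \<Longrightarrow> A0 \<noteq> 0 \<Longrightarrow> annihilates A0 f \<Longrightarrow> \<exists>A. A \<noteq> 0 \<and> annihilates A f \<and>
      (\<forall>j. weight_le (v l) (c l) (coeff (map_poly mfps_of_mpoly A) j))"
  shows "algebraic_elem fls_rat_functions (fps_to_fls (reduce_mod (diagonal f) :: 'p::prime_card mod_ring fps))
    \<and> ext_degree fls_rat_functions (fps_to_fls (reduce_mod (diagonal f) :: 'p mod_ring fps)) \<le> CARD('p) ^ N - 1"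
proof -
  define d where "d = ext_degree rat_functions (mfps_to_fract f)"
  interpret R: idom_subring "mpolys UNIV :: (rat, 'n) mfps set"
    by (rule idom_subring_mpolys)
  have sub: "subfield (rat_functions :: (rat, 'n) mfps fract set) ring_of_type_algebra"
    unfolding rat_functions_eq by (rule R.subfield_fractions)
  obtain P where P: "P \<in> polys rat_functions" "P \<noteq> 0" "poly P (mfps_to_fract f) = 0" "degree P \<le> d"
    using polynomial_of_ext_degree(1) [OF sub alg] unfolding d_def by blast
  then obtain Q where Q: "Q \<in> polys (mpolys UNIV)" "Q \<noteq> 0" "poly Q (mfps_of_int f :: (rat, 'n) mfps) = 0" "degree Q \<le> d"
    using R.clear_denominators [of P "mfps_of_int f"] unfolding rat_functions_eq mfps_to_fract_def
    by (meson order_trans)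
  let ?f = "mfps_of_int f :: ('p mod_ring, 'n) mfps"
  have "\<exists>e. (\<exists>i\<le>N. e i \<noteq> 0) \<and> (\<Sum>i\<le>N. fps_of_poly (e i) * diagonal ?f ^ (CARD('p) ^ i)) = 0"
    unfolding N_def Box_def d_def [symmetric]
  proof (rule diagonal_frobenius_relation)
    show "finite {m. \<forall>l\<in>\<Lambda>. weight (v l) m \<le> c l}"
      using fin by (simp add: Box_def)
    show "\<exists>B. B \<in> polys (mpolys UNIV) \<and> B \<noteq> 0 \<and> poly B ?f = 0 \<and> degree B \<le> d"
      using reduce_annihilator [OF Q(1-3), where 'p = 'p] Q(4) by (meson order_trans)
    fix l assume l: "l \<in> \<Lambda>"
    obtain A0 where "A0 \<noteq> 0" "annihilates A0 f"
      using annihilates_Abs [OF Q(1-3)] by blast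
    then obtain A where A: "A \<noteq> 0" "annihilates A f"
      "\<And>j. weight_le (v l) (c l) (coeff (map_poly mfps_of_mpoly A) j)"
      using weights [OF l] by blast
    obtain C where "C \<in> polys (mpolys UNIV)" "C \<noteq> 0" "poly C ?f = 0"
      "\<forall>i m. mfps_nth (coeff C i) m \<noteq> 0 \<longrightarrow> mfps_nth (coeff (map_poly mfps_of_mpoly A) i) m \<noteq> 0"
      using reduce_annihilator [OF annihilates_mpolys [OF A(1,2)], where 'p = 'p] by blast
    moreover from this(4) A(3) have "\<forall>j. weight_le (v l) (c l) (coeff C j)"
      unfolding weight_le_def by blast
    ultimately show "\<exists>B. B \<in> polys (mpolys UNIV) \<and> B \<noteq> 0 \<and> poly B ?f = 0 \<and>
        (\<forall>j. weight_le (v l) (c l) (coeff B j))"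
      by blast
  qed
  then obtain e where "\<exists>i\<le>N. e i \<noteq> 0"
    "(\<Sum>i\<le>N. fps_of_poly (e i) * (reduce_mod (diagonal f) :: 'p mod_ring fps) ^ (CARD('p) ^ i)) = 0"
    unfolding diagonal_of_int by blast
  \<comment> \<open>The exponent 0 lies in the box and omits a variable. Positivity of
    \<open>N\<close> covers the case of a diagonal that reduces to 0.\<close>
  moreover have "N \<ge> 1"
  proof -
    have "0 \<in> {m \<in> Box. \<exists>i. Poly_Mapping.lookup m i = 0}"
      by (simp add: Box_def)
    then have "card {m \<in> Box. \<exists>i. Poly_Mapping.lookup m i = 0} > 0"
      using fin by (subst card_gt_0_iff) auto
    then show ?thesis by (simp add: N_def Suc_le_eq)
  qed
  moreover have "CARD('p) \<ge> 2"
    using prime_ge_2_nat [OF prime_card [where 'a = 'p]] .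
  ultimately show ?thesis
    by (intro ext_degree_of_frobenius_relation)
qed

theorem theorem5p2:
  fixes f :: "(int, 'n::finite) mfps" and n d h N p :: nat and hp :: "'n \<Rightarrow> nat"
  assumes "n = CARD('n)"
    and "algebraic_elem rat_functions (mfps_to_fract f)"
    and "d = ext_degree rat_functions (mfps_to_fract f)"
    and "h = total_height f"
    and "\<And>i. hp i = partial_height f i"
    and "N = (d + 1) * min ((\<Prod>i\<in>UNIV. (hp i + 1)) - (\<Prod>i\<in>UNIV. hp i))
                            (((n + h) choose n) - (h choose n))"
    and "prime p" and "CARD('p::prime_card) = p"
  shows "algebraic_elem fls_rat_functions
           (fps_to_fls (reduce_mod (diagonal f) :: 'p mod_ring fps))
       \<and> ext_degree fls_rat_functions
           (fps_to_fls (reduce_mod (diagonal f) :: 'p mod_ring fps)) \<le> p ^ N - 1"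
proof (cases "(\<Prod>i\<in>UNIV. (hp i + 1)) - (\<Prod>i\<in>UNIV. hp i) \<le> ((n + h) choose n) - (h choose n)")
  case True
  \<comment> \<open>One condition per variable, with the indicator of that variable as
    weight.\<close>
  let ?v = "\<lambda>i x :: 'n. of_bool (x = i)"
  have weight: "weight (?v i) m = Poly_Mapping.lookup m i" for i m
  proof -
    have "weight (?v i) m = (\<Sum>x\<in>UNIV. if x = i then Poly_Mapping.lookup m x else 0)"
      by (intro sum.cong) auto
    then show ?thesis by simp
  qed
  have "N = (ext_degree rat_functions (mfps_to_fract f) + 1)
      * card {m \<in> {m. \<forall>i\<in>UNIV. weight (?v i) m \<le> hp i}. \<exists>i. Poly_Mapping.lookup m i = 0}"
    using True card_box_boundary [of hp] by (simp add: weight assms(3,6) min_absorb1 del: of_bool_eq_iff)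
  moreover have "finite {m. \<forall>i\<in>UNIV. weight (?v i) m \<le> hp i}"
    using finite_below [of hp] by (simp add: weight)
  ultimately show ?thesis
    using diagonal_degree_bound [OF assms(2), of UNIV ?v hp, where 'p = 'p] partial_height_bound [of _ f]
    by (simp add: assms(5,8))
next
  case False
  \<comment> \<open>A single condition, indexed by the type \<open>unit\<close>, with all weights
    1.\<close>
  have "N = (ext_degree rat_functions (mfps_to_fract f) + 1)
      * card {m :: 'n \<Rightarrow>\<^sub>0 nat. m \<in> {m. \<forall>l\<in>UNIV. weight (\<lambda>_. 1) m \<le> h} \<and> (\<exists>i. Poly_Mapping.lookup m i = 0)}"
    using False simplex_boundary(2) [where 'n = 'n, of h] by (simp add: assms(1,3,6) min_absorb2)
  moreover have "finite {m :: 'n \<Rightarrow>\<^sub>0 nat. \<forall>l\<in>UNIV. weight (\<lambda>_. 1) m \<le> h}"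
    using simplex_boundary(1) [of h] by simp
  ultimately show ?thesis
    using diagonal_degree_bound [OF assms(2), of "UNIV :: unit set" "\<lambda>_ _. 1" "\<lambda>_. h", where 'p = 'p]
      total_height_bound [of _ f]
    by (simp add: assms(4,8))
qed

end
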